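(* For any dense floating point neural network architecture $NN(\vec\sigma,\vec a)$, where $\vec\sigma=(\sigma_1,\dots,\sigma_n)$ is an $n$-tuple of activation functions $\sigma_i:R\to R$ and $\vec a=(a_0,\dots,a_n)$ is an $(n+1)$-tuple of natural numbers, there exists a coherent functor $\iota:RSpan(a_0,a_n)\to G$ such that the $Set$-models of $G$ are neural networks of $NN(\vec\sigma,\vec a)$, and such that the functor $Coh(\iota,Set):Coh(G,Set)\to Coh(RSpan(a_0,a_n),Set)$, $M\mapsto M\iota$, is, on objects, the inference function.
   Context: Coherent categories. A coherent category has finite limits, pullback-stable image factorisations and pullback-stable finite unions of subobjects. A coherent functor preserves these. $Coh(A,B)$ is the category of coherent functors $A\to B$ and natural transformations. A $Set$-model of $A$ is a coherent functor $A\to Set$. $Coh_\sim$ is the $(2,1)$-category of coherent categories, coherent functors and natural isomorphisms; it has all 2-colimits, whose diagrams commute and factor up to 2-cell isomorphism. Floating point arithmetic. $R$ is a fixed finite set, a model of the floating point numbers for some number of bits, with fixed functions $add,mul:R\times R\to R$. $Float$ is the smallest replete (closed under isomorphisms of $Set$) coherent subcategory of $Set$ (with $Set$ treated as a small category) containing the objects $R$, $R\times R$, the morphisms $add,mul$, and all morphisms $\mathbf 1\to R$ and $\mathbf 1\to R\times R$. Write $V$ for its object $R$. Every coherent functor $P:Float\to Set$ satisfies $P(V)\cong R$, compatibly with $add$ and $mul$. Spans. $Sort$ is the coherent category for which coherent functors $Sort\to C$ correspond to objects of $C$. $Span$ is the coherent category for which coherent functors $Span\to C$ correspond to diagrams $X\xleftarrow{f}N\xrightarrow{t}Y$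 in $C$. $RSpan(p,q)$ is the 2-colimit in $Coh_\sim$ gluing $Span$ and $Float$ by identifying $X$ with $V^p$ and $Y$ with $V^q$ (each identification along a copy of $Sort$). A coherent functor $RSpan(p,q)\to Set$ induces a model of $Span$ in $Set$ whose endpoints are isomorphic to $R^p$ and $R^q$, and in this way is regarded as an R-span dataset. $RSpanData(p,q)$, the set of R-span datasets, is the set of all spans of functions $R^p\xleftarrow{f}N\xrightarrow{t}R^q$ with $N$ finite. Networks. $NN(\vec\sigma,\vec a)$ is the set of pairs $(\vec w,\vec\beta)$, where $\vec w=(w_1,\dots,w_n)$ is an $n$-tuple of weight matrices $w_i:R^{a_{i-1}}\to R^{a_i}$ with entries in $R$, and $\vec\beta=(\beta_1,\dots,\beta_n)$ is an $n$-tuple of bias vectors $\beta_i:\mathbf 1\to R^{a_i}$. Inference. The inference function $Inf:NN(\vec\sigma,\vec a)\to RSpanData(a_0,a_n)$ sends $(\vec w,\vec\beta)$ to the span $R^{a_0}\xleftarrow{Id}R^{a_0}\xrightarrow{t}R^{a_n}$ with $t(x)=\sigma_n(w_n\cdots\sigma_1(w_1x+\beta_1)\cdots+\beta_n)$, where each $\sigma_i$ is applied coordinatewise. Here $w_ix+\beta_i$ is computed in floating point arithmetic: its $j$-th coordinate is $add\big(add_{a_{i-1}}(mul((w_i)_{j1},x_1),\dots,mul((w_i)_{j\,a_{i-1}},x_{a_{i-1}})),(\beta_i)_j\big)$, where the iterated sum is given inductively for $k\ge1$ by $add_1=Id_R$, $add_k(x_1,\dots,x_k)=add(x_1,add_{k-1}(x_2,\dots,x_k))$.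 *)

theory Defs
  imports Main "HOL-Library.FuncSet"
begin

section \<open>Categories, functors, natural isomorphisms\<close>

record ('o, 'a) cat =
  Obj :: "'o set"
  Arr :: "'a set"
  Dom :: "'a \<Rightarrow> 'o"
  Cod :: "'a \<Rightarrow> 'o"
  Ident :: "'o \<Rightarrow> 'a"
  Comp :: "'a \<Rightarrow> 'a \<Rightarrow> 'a"  \<comment> \<open>\<open>Comp C g f\<close> is ``g after f''\<close>

definition hom :: "('o, 'a) cat \<Rightarrow> 'o \<Rightarrow> 'o \<Rightarrow> 'a set" where
  "hom C x y = {f \<in> Arr C. Dom C f = x \<and> Cod C f = y}"

definition category :: "('o, 'a) cat \<Rightarrow> bool" where
  "category C \<longleftrightarrow>
     (\<forall>f\<in>Arr C. Dom C f \<in> Obj C \<and> Cod C f \<in> Obj C) \<and>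
     (\<forall>x\<in>Obj C. Ident C x \<in> hom C x x) \<and>
     (\<forall>f\<in>Arr C. \<forall>g\<in>Arr C. Cod C f = Dom C g \<longrightarrow> Comp C g f \<in> hom C (Dom C f) (Cod C g)) \<and>
     (\<forall>f\<in>Arr C. Comp C f (Ident C (Dom C f)) = f \<and> Comp C (Ident C (Cod C f)) f = f) \<and>
     (\<forall>f\<in>Arr C. \<forall>g\<in>Arr C. \<forall>h\<in>Arr C. Cod C f = Dom C g \<and> Cod C g = Dom C h \<longrightarrow>
        Comp C h (Comp C g f) = Comp C (Comp C h g) f)"

definition is_iso :: "('o, 'a) cat \<Rightarrow> 'a \<Rightarrow> bool" where
  "is_iso C f \<longleftrightarrow> f \<in> Arr C \<and>
     (\<exists>g\<in>hom C (Cod C f) (Dom C f).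
        Comp C g f = Ident C (Dom C f) \<and> Comp C f g = Ident C (Cod C f))"

definition is_mono :: "('o, 'a) cat \<Rightarrow> 'a \<Rightarrow> bool" where
  "is_mono C m \<longleftrightarrow> m \<in> Arr C \<and>
     (\<forall>f\<in>Arr C. \<forall>g\<in>Arr C. Cod C f = Dom C m \<and> Cod C g = Dom C m \<and> Dom C f = Dom C g \<and>
        Comp C m f = Comp C m g \<longrightarrow> f = g)"

record ('o, 'a, 'p, 'b) func =
  onObj :: "'o \<Rightarrow> 'p"
  onArr :: "'a \<Rightarrow> 'b"

definition is_functor :: "('o, 'a) cat \<Rightarrow> ('p, 'b) cat \<Rightarrow> ('o, 'a, 'p, 'b) func \<Rightarrow> bool" where
  "is_functor C D F \<longleftrightarrow> category C \<and> category D \<and>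
     (\<forall>x\<in>Obj C. onObj F x \<in> Obj D) \<and>
     (\<forall>f\<in>Arr C. onArr F f \<in> hom D (onObj F (Dom C f)) (onObj F (Cod C f))) \<and>
     (\<forall>x\<in>Obj C. onArr F (Ident C x) = Ident D (onObj F x)) \<and>
     (\<forall>f\<in>Arr C. \<forall>g\<in>Arr C. Cod C f = Dom C g \<longrightarrow>
        onArr F (Comp C g f) = Comp D (onArr F g) (onArr F f))"

definition func_comp ::
    "('p, 'b, 'q, 'c) func \<Rightarrow> ('o, 'a, 'p, 'b) func \<Rightarrow> ('o, 'a, 'q, 'c) func" where
  "func_comp G F = \<lparr>onObj = onObj G \<circ> onObj F, onArr = onArr G \<circ> onArr F\<rparr>"

definition id_func :: "('o, 'a, 'o, 'a) func" where
  "id_func = \<lparr>onObj = id, onArr = id\<rparr>"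

definition nat_iso ::
    "('o, 'a) cat \<Rightarrow> ('p, 'b) cat \<Rightarrow> ('o, 'a, 'p, 'b) func \<Rightarrow> ('o, 'a, 'p, 'b) func \<Rightarrow>
     ('o \<Rightarrow> 'b) \<Rightarrow> bool" where
  "nat_iso C D F G \<eta> \<longleftrightarrow>
     (\<forall>x\<in>Obj C. \<eta> x \<in> hom D (onObj F x) (onObj G x) \<and> is_iso D (\<eta> x)) \<and>
     (\<forall>f\<in>Arr C. Comp D (\<eta> (Cod C f)) (onArr F f) = Comp D (onArr G f) (\<eta> (Dom C f)))"

section \<open>Finite limits, images, unions\<close>

text \<open>Diagrams are indexed by directed graphs whose vertices and edges are natural numbers;
  this covers all finite diagrams up to renaming.\<close>

record ('o, 'a) diag =
  verts :: "nat set"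
  edges :: "nat set"
  esrc :: "nat \<Rightarrow> nat"
  etgt :: "nat \<Rightarrow> nat"
  dobj :: "nat \<Rightarrow> 'o"
  darr :: "nat \<Rightarrow> 'a"

definition finite_diagram :: "('o, 'a) cat \<Rightarrow> ('o, 'a) diag \<Rightarrow> bool" where
  "finite_diagram C d \<longleftrightarrow> finite (verts d) \<and> finite (edges d) \<and>
     (\<forall>i\<in>verts d. dobj d i \<in> Obj C) \<and>
     (\<forall>e\<in>edges d. esrc d e \<in> verts d \<and> etgt d e \<in> verts d \<and>
        darr d e \<in> hom C (dobj d (esrc d e)) (dobj d (etgt d e)))"

definition map_diagram :: "('o, 'a, 'p, 'b) func \<Rightarrow> ('o, 'a) diag \<Rightarrow> ('p, 'b) diag" where
  "map_diagram F d = \<lparr>verts = verts d, edges = edges d, esrc = esrc d, etgt = etgt d,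
     dobj = onObj F \<circ> dobj d, darr = onArr F \<circ> darr d\<rparr>"

definition is_cone :: "('o, 'a) cat \<Rightarrow> ('o, 'a) diag \<Rightarrow> 'o \<Rightarrow> (nat \<Rightarrow> 'a) \<Rightarrow> bool" where
  "is_cone C d L p \<longleftrightarrow> L \<in> Obj C \<and>
     (\<forall>i\<in>verts d. p i \<in> hom C L (dobj d i)) \<and>
     (\<forall>e\<in>edges d. Comp C (darr d e) (p (esrc d e)) = p (etgt d e))"

definition is_limit :: "('o, 'a) cat \<Rightarrow> ('o, 'a) diag \<Rightarrow> 'o \<Rightarrow> (nat \<Rightarrow> 'a) \<Rightarrow> bool" where
  "is_limit C d L p \<longleftrightarrow> is_cone C d L p \<and>
     (\<forall>K q. is_cone C d K q \<longrightarrow>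
        (\<exists>!u. u \<in> hom C K L \<and> (\<forall>i\<in>verts d. Comp C (p i) u = q i)))"

definition is_power :: "('o, 'a) cat \<Rightarrow> 'o \<Rightarrow> nat \<Rightarrow> 'o \<Rightarrow> (nat \<Rightarrow> 'a) \<Rightarrow> bool" where
  "is_power C V k L p \<longleftrightarrow>
     is_limit C \<lparr>verts = {..<k}, edges = {}, esrc = id, etgt = id,
       dobj = (\<lambda>_. V), darr = (\<lambda>_. Ident C V)\<rparr> L p"

definition is_pullback :: "('o, 'a) cat \<Rightarrow> 'a \<Rightarrow> 'a \<Rightarrow> 'a \<Rightarrow> 'a \<Rightarrow> bool" where
  "is_pullback C f g p q \<longleftrightarrow>
     f \<in> Arr C \<and> g \<in> Arr C \<and> Cod C f = Cod C g \<and>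
     p \<in> Arr C \<and> q \<in> Arr C \<and> Dom C p = Dom C q \<and> Cod C p = Dom C f \<and> Cod C q = Dom C g \<and>
     Comp C f p = Comp C g q \<and>
     (\<forall>p'\<in>Arr C. \<forall>q'\<in>Arr C.
        Dom C p' = Dom C q' \<and> Cod C p' = Dom C f \<and> Cod C q' = Dom C g \<and>
        Comp C f p' = Comp C g q' \<longrightarrow>
        (\<exists>!u. u \<in> hom C (Dom C p') (Dom C p) \<and> Comp C p u = p' \<and> Comp C q u = q'))"

definition factors_through :: "('o, 'a) cat \<Rightarrow> 'a \<Rightarrow> 'a \<Rightarrow> bool" where
  "factors_through C f m \<longleftrightarrow> (\<exists>e\<in>hom C (Dom C f) (Dom C m). Comp C m e = f)"

text \<open>Subobjects are represented by monomorphisms, ordered by \<^const>\<open>factors_through\<close>.\<close>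

definition is_image :: "('o, 'a) cat \<Rightarrow> 'a \<Rightarrow> 'a \<Rightarrow> bool" where
  "is_image C f m \<longleftrightarrow> f \<in> Arr C \<and> is_mono C m \<and> Cod C m = Cod C f \<and> factors_through C f m \<and>
     (\<forall>n. is_mono C n \<and> Cod C n = Cod C f \<and> factors_through C f n \<longrightarrow> factors_through C m n)"

definition is_union :: "('o, 'a) cat \<Rightarrow> 'o \<Rightarrow> 'a set \<Rightarrow> 'a \<Rightarrow> bool" where
  "is_union C A S m \<longleftrightarrow> A \<in> Obj C \<and> (\<forall>s\<in>S. is_mono C s \<and> Cod C s = A) \<and>
     is_mono C m \<and> Cod C m = A \<and> (\<forall>s\<in>S. factors_through C s m) \<and>
     (\<forall>n. is_mono C n \<and> Cod C n = A \<and> (\<forall>s\<in>S. factors_through C s n) \<longrightarrow> factors_through C m n)"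

section \<open>Coherent categories and functors\<close>

definition coherent_category :: "('o, 'a) cat \<Rightarrow> bool" where
  "coherent_category C \<longleftrightarrow> category C \<and>
     (\<forall>d. finite_diagram C d \<longrightarrow> (\<exists>L p. is_limit C d L p)) \<and>
     (\<forall>f\<in>Arr C. \<exists>m. is_image C f m) \<and>
     (\<forall>f m g f' r m' s. is_image C f m \<and> is_pullback C g f f' r \<and> is_pullback C g m m' s \<longrightarrow>
        is_image C f' m') \<and>
     (\<forall>A\<in>Obj C. \<forall>S. finite S \<and> (\<forall>s\<in>S. is_mono C s \<and> Cod C s = A) \<longrightarrow>
        (\<exists>m. is_union C A S m)) \<and>
     (\<forall>A S m g m' r n t. finite S \<and> is_union C A S m \<and> is_pullback C g m m' r \<and>
        (\<forall>s\<in>S. is_pullback C g s (n s) (t s)) \<longrightarrow>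
        is_union C (Dom C g) (n ` S) m')"

definition coherent_functor :: "('o, 'a) cat \<Rightarrow> ('p, 'b) cat \<Rightarrow> ('o, 'a, 'p, 'b) func \<Rightarrow> bool" where
  "coherent_functor C D F \<longleftrightarrow> is_functor C D F \<and>
     (\<forall>d L p. finite_diagram C d \<and> is_limit C d L p \<longrightarrow>
        is_limit D (map_diagram F d) (onObj F L) (onArr F \<circ> p)) \<and>
     (\<forall>f m. is_image C f m \<longrightarrow> is_image D (onArr F f) (onArr F m)) \<and>
     (\<forall>A S m. finite S \<and> is_union C A S m \<longrightarrow>
        is_union D (onObj F A) (onArr F ` S) (onArr F m))"

section \<open>2-colimits in the (2,1)-category of coherent categories\<close>

text \<open>A diagram of coherent categories is indexed by a directed graph (vertices \<open>I\<close>, edges \<open>E\<close>)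
  and given by categories \<open>D i\<close> and functors \<open>T e\<close>. Its pseudo-cocones commute up to the
  natural isomorphisms \<open>\<lambda> e : L (src e) \<cong> L (tgt e) \<circ> T e\<close>.\<close>

definition pseudo_cocone ::
    "'i set \<Rightarrow> 'e set \<Rightarrow> ('e \<Rightarrow> 'i) \<Rightarrow> ('e \<Rightarrow> 'i) \<Rightarrow>
     ('i \<Rightarrow> ('o, 'a) cat) \<Rightarrow> ('e \<Rightarrow> ('o, 'a, 'o, 'a) func) \<Rightarrow>
     ('o, 'a) cat \<Rightarrow> ('i \<Rightarrow> ('o, 'a, 'o, 'a) func) \<Rightarrow> ('e \<Rightarrow> 'o \<Rightarrow> 'a) \<Rightarrow> bool" where
  "pseudo_cocone I E src tgt D T C L l \<longleftrightarrow> coherent_category C \<and>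
     (\<forall>i\<in>I. coherent_functor (D i) C (L i)) \<and>
     (\<forall>e\<in>E. nat_iso (D (src e)) C (L (src e)) (func_comp (L (tgt e)) (T e)) (l e))"

text \<open>The universal property says that, for every \<open>C'\<close>, the functor from coherent functors
  \<open>C \<rightarrow> C'\<close> and natural isomorphisms to pseudo-cocones under the diagram with vertex \<open>C'\<close> is an
  equivalence: essentially surjective (first clause) and fully faithful (second clause).\<close>

definition is_2colimit ::
    "'i set \<Rightarrow> 'e set \<Rightarrow> ('e \<Rightarrow> 'i) \<Rightarrow> ('e \<Rightarrow> 'i) \<Rightarrow>
     ('i \<Rightarrow> ('o, 'a) cat) \<Rightarrow> ('e \<Rightarrow> ('o, 'a, 'o, 'a) func) \<Rightarrow>
     ('o, 'a) cat \<Rightarrow> ('i \<Rightarrow> ('o, 'a, 'o, 'a) func) \<Rightarrow> ('e \<Rightarrow> 'o \<Rightarrow> 'a) \<Rightarrow> bool" where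
  "is_2colimit I E src tgt D T C L l \<longleftrightarrow>
     (\<forall>i\<in>I. coherent_category (D i)) \<and>
     (\<forall>e\<in>E. src e \<in> I \<and> tgt e \<in> I \<and> coherent_functor (D (src e)) (D (tgt e)) (T e)) \<and>
     pseudo_cocone I E src tgt D T C L l \<and>
     (\<forall>(C' :: ('o, 'a) cat) L' l'. pseudo_cocone I E src tgt D T C' L' l' \<longrightarrow>
        (\<exists>H \<theta>. coherent_functor C C' H \<and>
           (\<forall>i\<in>I. nat_iso (D i) C' (func_comp H (L i)) (L' i) (\<theta> i)) \<and>
           (\<forall>e\<in>E. \<forall>x\<in>Obj (D (src e)).
              Comp C' (l' e x) (\<theta> (src e) x) =
              Comp C' (\<theta> (tgt e) (onObj (T e) x)) (onArr H (l e x))))) \<and>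
     (\<forall>(C' :: ('o, 'a) cat) H H' \<Gamma>. coherent_category C' \<and> coherent_functor C C' H \<and> coherent_functor C C' H' \<and>
        (\<forall>i\<in>I. nat_iso (D i) C' (func_comp H (L i)) (func_comp H' (L i)) (\<Gamma> i)) \<and>
        (\<forall>e\<in>E. \<forall>x\<in>Obj (D (src e)).
           Comp C' (onArr H' (l e x)) (\<Gamma> (src e) x) =
           Comp C' (\<Gamma> (tgt e) (onObj (T e) x)) (onArr H (l e x))) \<longrightarrow>
        (\<exists>\<gamma>. nat_iso C C' H H' \<gamma> \<and> (\<forall>i\<in>I. \<forall>x\<in>Obj (D i). \<gamma> (onObj (L i) x) = \<Gamma> i x)) \<and>
        (\<forall>\<gamma> \<gamma>'. nat_iso C C' H H' \<gamma> \<and> (\<forall>i\<in>I. \<forall>x\<in>Obj (D i). \<gamma> (onObj (L i) x) = \<Gamma> i x) \<and>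
           nat_iso C C' H H' \<gamma>' \<and> (\<forall>i\<in>I. \<forall>x\<in>Obj (D i). \<gamma>' (onObj (L i) x) = \<Gamma> i x) \<longrightarrow>
           (\<forall>y\<in>Obj C. \<gamma> y = \<gamma>' y)))"

section \<open>The categories Sort and Span\<close>

text \<open>\<open>S\<close> is the coherent category \<open>Sort\<close> with generic object \<open>x\<close>: evaluation at \<open>x\<close> is an
  equivalence between coherent functors \<open>S \<rightarrow> C\<close> and objects of \<open>C\<close> (with isomorphisms).\<close>

definition is_Sort :: "('o, 'a) cat \<Rightarrow> 'o \<Rightarrow> bool" where
  "is_Sort S x \<longleftrightarrow> coherent_category S \<and> x \<in> Obj S \<and>
     (\<forall>C :: ('o, 'a) cat. coherent_category C \<longrightarrow>
        (\<forall>c\<in>Obj C. \<exists>F e. coherent_functor S C F \<and> e \<in> hom C (onObj F x) c \<and> is_iso C e) \<and>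
        (\<forall>F G h. coherent_functor S C F \<and> coherent_functor S C G \<and>
           h \<in> hom C (onObj F x) (onObj G x) \<and> is_iso C h \<longrightarrow>
           (\<exists>\<eta>. nat_iso S C F G \<eta> \<and> \<eta> x = h) \<and>
           (\<forall>\<eta> \<eta>'. nat_iso S C F G \<eta> \<and> \<eta> x = h \<and> nat_iso S C F G \<eta>' \<and> \<eta>' x = h \<longrightarrow>
              (\<forall>y\<in>Obj S. \<eta> y = \<eta>' y))))"

definition span_arrows :: "('o, 'a) cat \<Rightarrow> 'a \<Rightarrow> 'a \<Rightarrow> bool" where
  "span_arrows C f t \<longleftrightarrow> f \<in> Arr C \<and> t \<in> Arr C \<and> Dom C f = Dom C t"

definition span_arrows_iso ::
    "('o, 'a) cat \<Rightarrow> 'a \<Rightarrow> 'a \<Rightarrow> 'a \<Rightarrow> 'a \<Rightarrow> 'a \<Rightarrow> 'a \<Rightarrow> 'a \<Rightarrow> bool" where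
  "span_arrows_iso C f t f' t' hN hX hY \<longleftrightarrow>
     is_iso C hN \<and> hN \<in> hom C (Dom C f) (Dom C f') \<and>
     is_iso C hX \<and> hX \<in> hom C (Cod C f) (Cod C f') \<and>
     is_iso C hY \<and> hY \<in> hom C (Cod C t) (Cod C t') \<and>
     Comp C hX f = Comp C f' hN \<and> Comp C hY t = Comp C t' hN"

definition is_Span :: "('o, 'a) cat \<Rightarrow> 'a \<Rightarrow> 'a \<Rightarrow> bool" where
  "is_Span S f t \<longleftrightarrow> coherent_category S \<and> span_arrows S f t \<and>
     (\<forall>C :: ('o, 'a) cat. coherent_category C \<longrightarrow>
        (\<forall>f' t'. span_arrows C f' t' \<longrightarrow>
           (\<exists>F hN hX hY. coherent_functor S C F \<and>
              span_arrows_iso C (onArr F f) (onArr F t) f' t' hN hX hY)) \<and>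
        (\<forall>F G hN hX hY. coherent_functor S C F \<and> coherent_functor S C G \<and>
           span_arrows_iso C (onArr F f) (onArr F t) (onArr G f) (onArr G t) hN hX hY \<longrightarrow>
           (\<exists>\<eta>. nat_iso S C F G \<eta> \<and> \<eta> (Dom S f) = hN \<and> \<eta> (Cod S f) = hX \<and> \<eta> (Cod S t) = hY) \<and>
           (\<forall>\<eta> \<eta>'.
              nat_iso S C F G \<eta> \<and> \<eta> (Dom S f) = hN \<and> \<eta> (Cod S f) = hX \<and> \<eta> (Cod S t) = hY \<and>
              nat_iso S C F G \<eta>' \<and> \<eta>' (Dom S f) = hN \<and> \<eta>' (Cod S f) = hX \<and> \<eta>' (Cod S t) = hY \<longrightarrow>
              (\<forall>y\<in>Obj S. \<eta> y = \<eta>' y))))"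

section \<open>The small category Set\<close>

text \<open>The objects are all subsets of an infinite type \<open>'s\<close>, i.e. up to isomorphism all sets of
  cardinality at most that of \<open>'s\<close>. An arrow is a triple (domain, extensional function, codomain).
  A small coherent category is one whose objects and arrows are drawn from the types of the
  objects and arrows of \<open>Set\<close>; thus \<open>Set\<close> itself is small.\<close>

type_synonym 's sarr = "'s set \<times> ('s \<Rightarrow> 's) \<times> 's set"
type_synonym 's scat = "('s set, 's sarr) cat"
type_synonym 's sfunc = "('s set, 's sarr, 's set, 's sarr) func"

definition sdom :: "'s sarr \<Rightarrow> 's set" where "sdom h = fst h"
definition sfun :: "'s sarr \<Rightarrow> 's \<Rightarrow> 's" where "sfun h = fst (snd h)"
definition scod :: "'s sarr \<Rightarrow> 's set" where "scod h = snd (snd h)"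

definition set_cat :: "'s scat" where
  "set_cat = \<lparr>Obj = UNIV,
     Arr = {h. sfun h \<in> sdom h \<rightarrow>\<^sub>E scod h},
     Dom = sdom, Cod = scod,
     Ident = (\<lambda>A. (A, \<lambda>x\<in>A. x, A)),
     Comp = (\<lambda>g f. (sdom f, compose (sdom f) (sfun g) (sfun f), scod g))\<rparr>"

section \<open>The category Float\<close>

definition replete_coherent_subcategory :: "('o, 'a) cat \<Rightarrow> 'o set \<Rightarrow> 'a set \<Rightarrow> bool" where
  "replete_coherent_subcategory C X Y \<longleftrightarrow> X \<subseteq> Obj C \<and> Y \<subseteq> Arr C \<and>
     coherent_category (C\<lparr>Obj := X, Arr := Y\<rparr>) \<and>
     coherent_functor (C\<lparr>Obj := X, Arr := Y\<rparr>) C id_func \<and>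
     (\<forall>f. is_iso C f \<and> Dom C f \<in> X \<longrightarrow> f \<in> Y)"

text \<open>The set \<open>R \<times> R\<close> is realised as an object of \<open>Set\<close> by an injective pairing, which exists
  because \<open>'s\<close> is infinite. By repleteness its choice does not matter.\<close>

definition pair_code :: "'s \<times> 's \<Rightarrow> 's" where
  "pair_code = (SOME f. inj f)"

definition square :: "'s set \<Rightarrow> 's set" where
  "square R = pair_code ` (R \<times> R)"

definition binop_arr :: "'s set \<Rightarrow> ('s \<Rightarrow> 's \<Rightarrow> 's) \<Rightarrow> 's sarr" where
  "binop_arr R f = (square R, \<lambda>z\<in>square R. case_prod f (inv_into (R \<times> R) pair_code z), R)"

text \<open>All singletons are used as the terminal object.\<close>

definition const_arr :: "'s \<Rightarrow> 's \<Rightarrow> 's set \<Rightarrow> 's sarr" where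
  "const_arr z r A = ({z}, \<lambda>_\<in>{z}. r, A)"

definition float_generated ::
    "'s set \<Rightarrow> ('s \<Rightarrow> 's \<Rightarrow> 's) \<Rightarrow> ('s \<Rightarrow> 's \<Rightarrow> 's) \<Rightarrow> 's set set \<Rightarrow> 's sarr set \<Rightarrow> bool" where
  "float_generated R add mul X Y \<longleftrightarrow> replete_coherent_subcategory set_cat X Y \<and>
     R \<in> X \<and> square R \<in> X \<and> binop_arr R add \<in> Y \<and> binop_arr R mul \<in> Y \<and>
     (\<forall>z. \<forall>r\<in>R. const_arr z r R \<in> Y) \<and>
     (\<forall>z. \<forall>r\<in>square R. const_arr z r (square R) \<in> Y)"

definition float_cat :: "'s set \<Rightarrow> ('s \<Rightarrow> 's \<Rightarrow> 's) \<Rightarrow> ('s \<Rightarrow> 's \<Rightarrow> 's) \<Rightarrow> 's scat" where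
  "float_cat R add mul = set_cat\<lparr>
     Obj := \<Inter>{X. \<exists>Y. float_generated R add mul X Y},
     Arr := \<Inter>{Y. \<exists>X. float_generated R add mul X Y}\<rparr>"

section \<open>The category RSpan(p,q)\<close>

datatype rvert = SortX | SortY | SpanV | FloatV
datatype redge = XSpan | XFloat | YSpan | YFloat

fun redge_src :: "redge \<Rightarrow> rvert" where
  "redge_src XSpan = SortX" | "redge_src XFloat = SortX" |
  "redge_src YSpan = SortY" | "redge_src YFloat = SortY"

fun redge_tgt :: "redge \<Rightarrow> rvert" where
  "redge_tgt XSpan = SpanV" | "redge_tgt XFloat = FloatV" |
  "redge_tgt YSpan = SpanV" | "redge_tgt YFloat = FloatV"

text \<open>An \<open>'s rspan\<close> bundles a choice of all the data, each determined only up to equivalence or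
  isomorphism, from which \<open>RSpan(p,q)\<close> is built: \<open>Sort\<close>, \<open>Span\<close>, the powers \<open>V^p\<close> and \<open>V^q\<close> of
  \<open>V\<close> in \<open>Float\<close> with their projections, the four functors out of the two copies of \<open>Sort\<close>, and
  the resulting 2-colimit.\<close>

record 's rspan =
  sort_cat :: "'s scat"
  sort_obj :: "'s set"
  span_cat :: "'s scat"
  span_f :: "'s sarr"
  span_t :: "'s sarr"
  pow_p :: "'s set"
  proj_p :: "nat \<Rightarrow> 's sarr"
  pow_q :: "'s set"
  proj_q :: "nat \<Rightarrow> 's sarr"
  glue :: "redge \<Rightarrow> 's sfunc"
  rspan_cat :: "'s scat"
  leg :: "rvert \<Rightarrow> 's sfunc"
  cell :: "redge \<Rightarrow> 's set \<Rightarrow> 's sarr"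

fun rspan_vertex :: "'s scat \<Rightarrow> 's rspan \<Rightarrow> rvert \<Rightarrow> 's scat" where
  "rspan_vertex Fl D SortX = sort_cat D" |
  "rspan_vertex Fl D SortY = sort_cat D" |
  "rspan_vertex Fl D SpanV = span_cat D" |
  "rspan_vertex Fl D FloatV = Fl"

definition is_RSpan ::
    "'s set \<Rightarrow> ('s \<Rightarrow> 's \<Rightarrow> 's) \<Rightarrow> ('s \<Rightarrow> 's \<Rightarrow> 's) \<Rightarrow> nat \<Rightarrow> nat \<Rightarrow> 's rspan \<Rightarrow> bool" where
  "is_RSpan R add mul p q D \<longleftrightarrow>
     is_Sort (sort_cat D) (sort_obj D) \<and>
     is_Span (span_cat D) (span_f D) (span_t D) \<and>
     is_power (float_cat R add mul) R p (pow_p D) (proj_p D) \<and>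
     is_power (float_cat R add mul) R q (pow_q D) (proj_q D) \<and>
     onObj (glue D XSpan) (sort_obj D) = Cod (span_cat D) (span_f D) \<and>
     onObj (glue D YSpan) (sort_obj D) = Cod (span_cat D) (span_t D) \<and>
     onObj (glue D XFloat) (sort_obj D) = pow_p D \<and>
     onObj (glue D YFloat) (sort_obj D) = pow_q D \<and>
     is_2colimit UNIV UNIV redge_src redge_tgt
       (rspan_vertex (float_cat R add mul) D) (glue D) (rspan_cat D) (leg D) (cell D)"

section \<open>R-span datasets\<close>

text \<open>\<open>R^k\<close> is the set of lists of length \<open>k\<close> over \<open>R\<close>. A span is a triple (apex, left leg,
  right leg) whose legs are relevant only on the apex.\<close>

definition Rvec :: "'s set \<Rightarrow> nat \<Rightarrow> 's list set" where
  "Rvec R k = {xs. length xs = k \<and> set xs \<subseteq> R}"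

type_synonym ('n, 's) lspan = "'n set \<times> ('n \<Rightarrow> 's list) \<times> ('n \<Rightarrow> 's list)"

definition RSpanData :: "'s set \<Rightarrow> nat \<Rightarrow> nat \<Rightarrow> ('n, 's) lspan set" where
  "RSpanData R p q = {(N, f, t). finite N \<and> f ` N \<subseteq> Rvec R p \<and> t ` N \<subseteq> Rvec R q}"

fun lspan_iso :: "('n, 's) lspan \<Rightarrow> ('m, 's) lspan \<Rightarrow> bool" where
  "lspan_iso (N, f, t) (N', f', t') \<longleftrightarrow>
     (\<exists>\<phi>. bij_betw \<phi> N N' \<and> (\<forall>x\<in>N. f x = f' (\<phi> x) \<and> t x = t' (\<phi> x)))"

text \<open>For a coherent functor \<open>Q : Float \<rightarrow> Set\<close>, the canonical bijection \<open>Q(V) \<cong> R\<close> sends \<open>v\<close> to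
  the \<open>r \<in> R\<close> for which \<open>v\<close> is the value of \<open>Q(r : 1 \<rightarrow> V)\<close>.\<close>

definition float_decode :: "'s set \<Rightarrow> 's sfunc \<Rightarrow> 's \<Rightarrow> 's" where
  "float_decode R Q v = (THE r. r \<in> R \<and>
     (\<exists>z. v \<in> sfun (onArr Q (const_arr z r R)) ` sdom (onArr Q (const_arr z r R))))"

text \<open>For \<open>P : RSpan(p,q) \<rightarrow> Set\<close>, the bijections \<open>P(X) \<cong> P(V^k) \<cong> P(V)^k \<cong> R^k\<close> at an endpoint.
  The first one is induced by the two cells \<open>P(x) \<rightarrow> P(X)\<close> and \<open>P(x) \<rightarrow> P(V^k)\<close> at the generic
  object \<open>x\<close> of \<open>Sort\<close>.\<close>

definition endpoint_coords ::
    "'s set \<Rightarrow> 's rspan \<Rightarrow> 's sfunc \<Rightarrow> redge \<Rightarrow> redge \<Rightarrow> nat \<Rightarrow> (nat \<Rightarrow> 's sarr) \<Rightarrow> 's \<Rightarrow> 's list" where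
  "endpoint_coords R D P eSpan eFloat k proj v =
     (let Q = func_comp P (leg D FloatV);
          a = onArr P (cell D eSpan (sort_obj D));
          b = onArr P (cell D eFloat (sort_obj D));
          w = sfun b (inv_into (sdom a) (sfun a) v)
      in map (\<lambda>j. float_decode R Q (sfun (onArr Q (proj j)) w)) [0..<k])"

definition dataset_of :: "'s set \<Rightarrow> nat \<Rightarrow> nat \<Rightarrow> 's rspan \<Rightarrow> 's sfunc \<Rightarrow> ('s, 's) lspan" where
  "dataset_of R p q D P =
     (let S = func_comp P (leg D SpanV) in
      (onObj S (Dom (span_cat D) (span_f D)),
       \<lambda>x. endpoint_coords R D P XSpan XFloat p (proj_p D) (sfun (onArr S (span_f D)) x),
       \<lambda>x. endpoint_coords R D P YSpan YFloat q (proj_q D) (sfun (onArr S (span_t D)) x)))"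

section \<open>Networks and inference\<close>

text \<open>A \<open>k \<times> l\<close> matrix is the list of its \<open>k\<close> rows. The lists of weights, biases and activation
  functions are indexed from 0, so that item \<open>i\<close> belongs to layer \<open>i + 1\<close>.\<close>

type_synonym 's network = "'s list list list \<times> 's list list"

definition Rmat :: "'s set \<Rightarrow> nat \<Rightarrow> nat \<Rightarrow> 's list list set" where
  "Rmat R k l = {W. length W = k \<and> set W \<subseteq> Rvec R l}"

definition NN :: "'s set \<Rightarrow> ('s \<Rightarrow> 's) list \<Rightarrow> nat list \<Rightarrow> 's network set" where
  "NN R \<sigma> a = {(w, b). length w = length \<sigma> \<and> length b = length \<sigma> \<and>
     (\<forall>i<length \<sigma>. w ! i \<in> Rmat R (a ! Suc i) (a ! i) \<and> b ! i \<in> Rvec R (a ! Suc i))}"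

text \<open>The iterated sum is unspecified on the empty list.\<close>

fun add_iter :: "('s \<Rightarrow> 's \<Rightarrow> 's) \<Rightarrow> 's list \<Rightarrow> 's" where
  "add_iter add [x] = x" |
  "add_iter add (x # y # ys) = add x (add_iter add (y # ys))"

definition layer ::
    "('s \<Rightarrow> 's \<Rightarrow> 's) \<Rightarrow> ('s \<Rightarrow> 's \<Rightarrow> 's) \<Rightarrow> ('s \<Rightarrow> 's) \<Rightarrow> 's list list \<Rightarrow> 's list \<Rightarrow> 's list \<Rightarrow> 's list" where
  "layer add mul s W b x = map2 (\<lambda>row c. s (add (add_iter add (map2 mul row x)) c)) W b"

fun forward ::
    "('s \<Rightarrow> 's \<Rightarrow> 's) \<Rightarrow> ('s \<Rightarrow> 's \<Rightarrow> 's) \<Rightarrow> ('s \<Rightarrow> 's) list \<Rightarrow> 's network \<Rightarrow> nat \<Rightarrow> 's list \<Rightarrow> 's list" where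
  "forward add mul \<sigma> (w, b) 0 x = x" |
  "forward add mul \<sigma> (w, b) (Suc i) x =
     layer add mul (\<sigma> ! i) (w ! i) (b ! i) (forward add mul \<sigma> (w, b) i x)"

definition Inf_NN ::
    "'s set \<Rightarrow> ('s \<Rightarrow> 's \<Rightarrow> 's) \<Rightarrow> ('s \<Rightarrow> 's \<Rightarrow> 's) \<Rightarrow> ('s \<Rightarrow> 's) list \<Rightarrow> nat list \<Rightarrow> 's network \<Rightarrow>
     ('s list, 's) lspan" where
  "Inf_NN R add mul \<sigma> a net = (Rvec R (a ! 0), \<lambda>x. x, forward add mul \<sigma> net (length \<sigma>))"

end

theory Submission
  imports Defs
begin

text \<open>The set \<open>K\<close> of networks is finite, so \<open>G\<close> can be taken to be the category of finite sets over
  \<open>K\<close>, which is equivalent to the \<open>K\<close>-fold power of the category of finite sets. In a model of \<open>G\<close>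
  the terminal object, a finite disjoint union of subterminal objects indexed by \<open>K\<close>, becomes a
  singleton, so exactly one of its summands \<open>k\<close> is inhabited. Since every object is a finite union of
  points, the model is naturally isomorphic to taking the fibre over \<open>k\<close>.

  Float consists of finite sets, and its limits, images and unions agree with those of Set because
  repleteness puts the ones computed in Set into every coherent subcategory in the intersection.
  Hence \<open>A \<mapsto> K \<times> A\<close> is a coherent functor from Float to \<open>G\<close>. Fibrewise inference is an arrow of
  \<open>G\<close> from \<open>K \<times> R^p\<close> to \<open>K \<times> R^q\<close>; together with the identity it forms a span, and the
  universal property of RSpan turns the two into \<open>\<iota>\<close>.\<close>

section \<open>Categories of labelled sets\<close>

text \<open>The universal properties of Sort, Span and RSpan are stated only for categories whose
  objects and arrows have the types of those of Set. So \<open>G\<close> has to live there: labels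
  are carried by the elements of \<open>'s\<close> themselves, through a coding of
  \<open>K \<times> 's\<close> in \<open>'s\<close>. With all subsets and a single label the same
  construction is Set, so one elementwise analysis, tested on arrows out of singletons, serves both
  categories.

  Coherent functors preserve only finite unions. Therefore both the set of labels and each object
  have to be finite; with infinite ones, ultraproducts would give further models.

  Float is an intersection taken separately on objects and on arrows, and its own limits, images and
  unions are tested only against cones and subobjects in Float. Comparing them with Set is what
  allows copying by \<open>K\<close> and reading coordinates off a power of \<open>V\<close> to be
  computed on elements.

  RSpan is given only up to equivalence, so a dataset can match inference only up to isomorphism of
  spans, and the identifications of the endpoints have to be traced through the cells of the
  2-colimit.\<close>

lemma sarr_sel [simp]: "sdom (A, f, B) = A" "sfun (A, f, B) = f" "scod (A, f, B) = B"
  by (simp_all add: sdom_def sfun_def scod_def)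

lemma sarr_eqI:
  assumes "sdom h = sdom h'" "scod h = scod h'"
    and "sfun h \<in> extensional (sdom h)" "sfun h' \<in> extensional (sdom h)"
    and "\<And>x. x \<in> sdom h \<Longrightarrow> sfun h x = sfun h' x"
  shows "h = h'"
proof -
  have "sfun h = sfun h'" using assms(3-5) by (rule extensionalityI)
  with assms(1,2) show ?thesis
    by (cases h; cases h') simp
qed

definition rng :: "'s sarr \<Rightarrow> 's set" where
  "rng h = sfun h ` sdom h"

text \<open>Two instances matter: all sets with a single label give \<open>set_cat\<close>, and the
  finite subsets of the coded set \<open>U\<close> give \<open>G\<close>. Labelling elements rather
  than objects makes an object over the label set just a subset of \<open>'s\<close>, whose fibres
  are its subsets with a fixed label.\<close>

definition lcat :: "'s set set \<Rightarrow> ('s \<Rightarrow> 'k) \<Rightarrow> 's scat" where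
  "lcat Ob lab = \<lparr>Obj = Ob,
     Arr = {h. sdom h \<in> Ob \<and> scod h \<in> Ob \<and> sfun h \<in> sdom h \<rightarrow>\<^sub>E scod h \<and>
       (\<forall>x\<in>sdom h. lab (sfun h x) = lab x)},
     Dom = sdom, Cod = scod,
     Ident = (\<lambda>A. (A, \<lambda>x\<in>A. x, A)),
     Comp = (\<lambda>g f. (sdom f, compose (sdom f) (sfun g) (sfun f), scod g))\<rparr>"

lemma lcat_sel [simp]:
  "Obj (lcat Ob lab) = Ob" "Dom (lcat Ob lab) = sdom" "Cod (lcat Ob lab) = scod"
  "Ident (lcat Ob lab) A = (A, \<lambda>x\<in>A. x, A)"
  "Comp (lcat Ob lab) g f = (sdom f, compose (sdom f) (sfun g) (sfun f), scod g)"
  by (simp_all add: lcat_def)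

lemma set_cat_eq_lcat: "set_cat = lcat UNIV (\<lambda>_. ())"
  by (simp add: set_cat_def lcat_def)

lemma Arr_lcat:
  "h \<in> Arr (lcat Ob lab) \<longleftrightarrow> sdom h \<in> Ob \<and> scod h \<in> Ob \<and> sfun h \<in> sdom h \<rightarrow>\<^sub>E scod h \<and>
     (\<forall>x\<in>sdom h. lab (sfun h x) = lab x)"
  by (simp add: lcat_def)

lemma hom_lcat:
  "h \<in> hom (lcat Ob lab) A B \<longleftrightarrow> sdom h = A \<and> scod h = B \<and> A \<in> Ob \<and> B \<in> Ob \<and>
     sfun h \<in> A \<rightarrow>\<^sub>E B \<and> (\<forall>x\<in>A. lab (sfun h x) = lab x)"
  by (auto simp: hom_def Arr_lcat)

lemma arr_eqI:
  assumes "h \<in> hom (lcat Ob lab) A B" "h' \<in> hom (lcat Ob lab) A B"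
    and "\<And>x. x \<in> A \<Longrightarrow> sfun h x = sfun h' x"
  shows "h = h'"
  using assms by (intro sarr_eqI) (auto simp: hom_lcat PiE_def)

lemma category_lcat: "category (lcat Ob lab)"
  unfolding category_def
proof (intro conjI ballI impI)
  fix f assume f: "f \<in> Arr (lcat Ob lab)"
  have h: "f \<in> hom (lcat Ob lab) (sdom f) (scod f)"
    using f by (simp add: hom_def)
  show "Comp (lcat Ob lab) f (Ident (lcat Ob lab) (Dom (lcat Ob lab) f)) = f"
    using h by (intro arr_eqI [OF _ h]) (auto simp: hom_lcat compose_def)
  show "Comp (lcat Ob lab) (Ident (lcat Ob lab) (Cod (lcat Ob lab) f)) f = f"
    using h by (intro arr_eqI [OF _ h]) (auto simp: hom_lcat compose_def)
next
  fix f g h assume "f \<in> Arr (lcat Ob lab)" "g \<in> Arr (lcat Ob lab)" "h \<in> Arr (lcat Ob lab)"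
    and "Cod (lcat Ob lab) f = Dom (lcat Ob lab) g \<and> Cod (lcat Ob lab) g = Dom (lcat Ob lab) h"
  then show "Comp (lcat Ob lab) h (Comp (lcat Ob lab) g f) =
      Comp (lcat Ob lab) (Comp (lcat Ob lab) h g) f"
    by (auto simp: Arr_lcat compose_def fun_eq_iff restrict_def)
next
  fix f g assume "f \<in> Arr (lcat Ob lab)" "g \<in> Arr (lcat Ob lab)"
    and "Cod (lcat Ob lab) f = Dom (lcat Ob lab) g"
  then show "Comp (lcat Ob lab) g f \<in> hom (lcat Ob lab) (Dom (lcat Ob lab) f) (Cod (lcat Ob lab) g)"
    by (simp add: hom_lcat Arr_lcat compose_def PiE_iff)
qed (auto simp: hom_lcat Arr_lcat)

lemma comp_lcat:
  "f \<in> hom (lcat Ob lab) A B \<Longrightarrow> g \<in> hom (lcat Ob lab) B D \<Longrightarrow>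
    Comp (lcat Ob lab) g f \<in> hom (lcat Ob lab) A D"
  by (simp add: hom_lcat compose_def PiE_iff)

lemma set_cat_sel [simp]:
  "Obj set_cat = UNIV" "Dom set_cat = sdom" "Cod set_cat = scod"
  "Ident set_cat A = (A, \<lambda>x\<in>A. x, A)"
  "Comp set_cat g f = (sdom f, compose (sdom f) (sfun g) (sfun f), scod g)"
  by (simp_all add: set_cat_def)

lemma Arr_set_cat: "h \<in> Arr set_cat \<longleftrightarrow> sfun h \<in> sdom h \<rightarrow>\<^sub>E scod h"
  by (simp add: set_cat_def)

lemma hom_set_cat: "h \<in> hom set_cat A B \<longleftrightarrow> sdom h = A \<and> scod h = B \<and> sfun h \<in> A \<rightarrow>\<^sub>E B"
  by (auto simp: hom_def Arr_set_cat)

lemma category_set_cat: "category set_cat"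
  unfolding set_cat_eq_lcat by (rule category_lcat)

lemma is_iso_set_cat:
  "is_iso set_cat h \<longleftrightarrow> h \<in> Arr set_cat \<and> bij_betw (sfun h) (sdom h) (scod h)"
proof (intro iffI conjI)
  assume h: "is_iso set_cat h"
  then show "h \<in> Arr set_cat" by (simp add: is_iso_def)
  from h obtain g where g: "g \<in> hom set_cat (scod h) (sdom h)"
    and gh: "compose (sdom h) (sfun g) (sfun h) = (\<lambda>x\<in>sdom h. x)"
    and hg: "compose (sdom g) (sfun h) (sfun g) = (\<lambda>x\<in>scod h. x)"
    by (auto simp: is_iso_def)
  have "sfun g (sfun h x) = x" if "x \<in> sdom h" for x
    using fun_cong [OF gh, of x] that by (simp add: compose_def)
  moreover have "sfun h (sfun g x) = x" if "x \<in> scod h" for x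
    using fun_cong [OF hg, of x] g that by (simp add: compose_def hom_set_cat)
  moreover have "sfun h \<in> sdom h \<rightarrow> scod h" "sfun g \<in> scod h \<rightarrow> sdom h"
    using h g by (auto simp: is_iso_def Arr_set_cat hom_set_cat PiE_def)
  ultimately show "bij_betw (sfun h) (sdom h) (scod h)"
    by (intro bij_betwI [where g = "sfun g"]) auto
next
  assume h: "h \<in> Arr set_cat \<and> bij_betw (sfun h) (sdom h) (scod h)"
  let ?g = "(scod h, \<lambda>y\<in>scod h. inv_into (sdom h) (sfun h) y, sdom h)"
  have "?g \<in> hom set_cat (scod h) (sdom h)"
    using h by (auto simp: hom_set_cat bij_betw_def intro: inv_into_into)
  moreover have "sfun h \<in> sdom h \<rightarrow> scod h" using h by (auto simp: Arr_set_cat)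
  ultimately show "is_iso set_cat h"
    using h unfolding is_iso_def
    by (auto intro!: bexI [where x = ?g]
        simp: compose_def bij_betw_def f_inv_into_f restrict_def fun_eq_iff image_subset_iff)
qed

text \<open>These are the elements over \<open>j\<close> of the limit of \<open>d\<close> computed
  on sets: the cones whose apex is one element labelled \<open>j\<close>. Values off
  \<open>verts d\<close> are left free.\<close>

definition family :: "('s \<Rightarrow> 'k) \<Rightarrow> ('s set, 's sarr) diag \<Rightarrow> 'k \<Rightarrow> (nat \<Rightarrow> 's) \<Rightarrow> bool" where
  "family lab d j x \<longleftrightarrow> (\<forall>i\<in>verts d. x i \<in> dobj d i \<and> lab (x i) = j) \<and>
     (\<forall>e\<in>edges d. sfun (darr d e) (x (esrc d e)) = x (etgt d e))"

text \<open>Closure under subsets provides singletons as domains of test arrows, and ranges as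
  domains of the inclusions that compute images and unions. Existence of limits is a separate matter
  and is not claimed here.\<close>

locale subset_closed =
  fixes Ob :: "'s set set" and lab :: "'s \<Rightarrow> 'k"
  assumes subset_Ob: "A \<in> Ob \<Longrightarrow> B \<subseteq> A \<Longrightarrow> B \<in> Ob"
begin

section \<open>Monos, images, unions and pullbacks in terms of elements\<close>

abbreviation "C \<equiv> lcat Ob lab"

text \<open>Two elements with the same image have the same label, as \<open>m\<close> keeps labels.
  Hence both constants on the singleton of one of them are arrows, and a mono cannot identify
  them.\<close>

lemma mono_iff: "is_mono C m \<longleftrightarrow> m \<in> Arr C \<and> inj_on (sfun m) (sdom m)"
proof (intro iffI conjI inj_onI)
  assume m: "is_mono C m"
  then show mA: "m \<in> Arr C" by (simp add: is_mono_def)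
  fix x y assume xy: "x \<in> sdom m" "y \<in> sdom m" "sfun m x = sfun m y"
  then have "lab x = lab y" using mA unfolding Arr_lcat by metis
  let ?f = "\<lambda>y. ({x}, \<lambda>_\<in>{x}. y, sdom m)"
  have "{x} \<in> Ob" using mA xy subset_Ob by (auto simp: Arr_lcat)
  then have "?f x \<in> Arr C" "?f y \<in> Arr C"
    using mA xy \<open>lab x = lab y\<close> by (auto simp: Arr_lcat)
  moreover have "Comp C m (?f x) = Comp C m (?f y)"
    using xy by (auto simp: compose_def restrict_def)
  moreover have "Cod C (?f x) = Dom C m" "Cod C (?f y) = Dom C m" "Dom C (?f x) = Dom C (?f y)"
    by simp_all
  ultimately have "?f x = ?f y"
    using m unfolding is_mono_def by blast
  then show "x = y" by (metis Pair_inject restrict_apply' singletonI)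
next
  assume m: "m \<in> Arr C \<and> inj_on (sfun m) (sdom m)"
  show "is_mono C m"
    unfolding is_mono_def
  proof (intro conjI ballI impI)
    fix f g assume fg: "f \<in> Arr C" "g \<in> Arr C"
      and e: "Cod C f = Dom C m \<and> Cod C g = Dom C m \<and> Dom C f = Dom C g \<and>
        Comp C m f = Comp C m g"
    have h: "f \<in> hom C (sdom f) (sdom m)" "g \<in> hom C (sdom f) (sdom m)"
      using fg e by (auto simp: hom_def)
    show "f = g"
    proof (rule arr_eqI [OF h])
      fix x assume x: "x \<in> sdom f"
      then have "sfun m (sfun f x) = sfun m (sfun g x)"
        using e by (auto simp: compose_def restrict_def fun_eq_iff) metis
      moreover have "sfun f x \<in> sdom m" "sfun g x \<in> sdom m"
        using h x by (auto simp: hom_lcat)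
      ultimately show "sfun f x = sfun g x" using m by (auto dest: inj_onD)
    qed
  qed (use m in simp)
qed

text \<open>The inverse of the injection \<open>m\<close> on its range keeps labels because
  \<open>m\<close> does, so it turns an inclusion of ranges into a factorisation. Subobjects are
  compared by their ranges from here on.\<close>

lemma factors_through_iff:
  assumes "f \<in> Arr C" "is_mono C m" "scod f = scod m"
  shows "factors_through C f m \<longleftrightarrow> rng f \<subseteq> rng m"
proof
  assume "factors_through C f m"
  then obtain e where e: "e \<in> hom C (sdom f) (sdom m)" "Comp C m e = f"
    by (auto simp: factors_through_def)
  from e(2) have "sfun f = compose (sdom e) (sfun m) (sfun e)" by auto
  then have "sfun f x = sfun m (sfun e x)" if "x \<in> sdom f" for x
    using e(1) that by (simp add: hom_lcat compose_def)
  then show "rng f \<subseteq> rng m" using e(1) by (auto simp: rng_def hom_lcat)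
next
  assume r: "rng f \<subseteq> rng m"
  have m: "m \<in> Arr C" "inj_on (sfun m) (sdom m)" using assms by (auto simp: mono_iff)
  let ?e = "(sdom f, \<lambda>x\<in>sdom f. inv_into (sdom m) (sfun m) (sfun f x), sdom m)"
  have k: "inv_into (sdom m) (sfun m) (sfun f x) \<in> sdom m"
      "sfun m (inv_into (sdom m) (sfun m) (sfun f x)) = sfun f x" if "x \<in> sdom f" for x
  proof -
    have "sfun f x \<in> sfun m ` sdom m" using r that by (auto simp: rng_def)
    then show "inv_into (sdom m) (sfun m) (sfun f x) \<in> sdom m"
      "sfun m (inv_into (sdom m) (sfun m) (sfun f x)) = sfun f x"
      by (rule inv_into_into, rule f_inv_into_f)
  qed
  have "?e \<in> hom C (sdom f) (sdom m)"
    unfolding hom_lcat sarr_sel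
  proof (intro conjI ballI)
    fix x assume x: "x \<in> sdom f"
    have "lab (sfun m (inv_into (sdom m) (sfun m) (sfun f x))) =
        lab (inv_into (sdom m) (sfun m) (sfun f x))"
      using m k(1) [OF x] unfolding Arr_lcat by blast
    then show "lab ((\<lambda>x\<in>sdom f. inv_into (sdom m) (sfun m) (sfun f x)) x) = lab x"
      using x k(2) [OF x] assms(1) by (simp add: Arr_lcat)
  qed (use k assms(1) m in \<open>auto simp: Arr_lcat\<close>)
  moreover have "f \<in> hom C (sdom f) (scod m)"
    using assms by (simp add: hom_def)
  moreover have "Comp C m ?e \<in> hom C (sdom f) (scod m)"
    using calculation(1) m by (intro comp_lcat) (simp_all add: hom_def)
  ultimately have "Comp C m ?e = f"
    using k by (intro arr_eqI) (auto simp: compose_def)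
  with \<open>?e \<in> _\<close> show "factors_through C f m"
    unfolding factors_through_def by (auto intro!: bexI [where x = ?e])
qed

lemma inclusion_mono:
  assumes "A \<in> Ob" "B \<subseteq> A"
  shows "is_mono C (B, \<lambda>x\<in>B. x, A)" "rng (B, \<lambda>x\<in>B. x, A) = B"
  using assms subset_Ob by (auto simp: mono_iff Arr_lcat rng_def)

lemma rng_subset: "f \<in> Arr C \<Longrightarrow> rng f \<subseteq> scod f"
  by (auto simp: Arr_lcat rng_def)

text \<open>The inclusion of \<open>rng f\<close> is itself a mono through which \<open>f\<close>
  factors, so minimality of an image, tested against it, fixes its range. Unions are treated in the
  same way.\<close>

lemma image_iff:
  "is_image C f m \<longleftrightarrow> f \<in> Arr C \<and> is_mono C m \<and> scod m = scod f \<and> rng m = rng f"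
proof
  assume i: "is_image C f m"
  then have f: "f \<in> Arr C" "is_mono C m" "scod m = scod f" "factors_through C f m"
    by (simp_all add: is_image_def)
  then have fm: "rng f \<subseteq> rng m" by (simp add: factors_through_iff)
  let ?i = "(rng f, \<lambda>x\<in>rng f. x, scod f)"
  have ii: "is_mono C ?i" "rng ?i = rng f"
    using f(1) rng_subset [OF f(1)] by (auto intro!: inclusion_mono simp: Arr_lcat)
  have "factors_through C f ?i" using ii f by (subst factors_through_iff) auto
  then have "factors_through C m ?i" using i ii unfolding is_image_def by simp
  then have "rng m \<subseteq> rng f" using f ii by (subst (asm) factors_through_iff) (auto simp: mono_iff)
  with f fm show "f \<in> Arr C \<and> is_mono C m \<and> scod m = scod f \<and> rng m = rng f" by auto
next
  assume a: "f \<in> Arr C \<and> is_mono C m \<and> scod m = scod f \<and> rng m = rng f"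
  then have "m \<in> Arr C" by (simp add: mono_iff)
  then show "is_image C f m"
    using a by (auto simp: is_image_def factors_through_iff)
qed

lemma union_iff:
  "is_union C A S m \<longleftrightarrow> A \<in> Ob \<and> (\<forall>s\<in>S. is_mono C s \<and> scod s = A) \<and> is_mono C m \<and>
     scod m = A \<and> rng m = (\<Union>s\<in>S. rng s)"
proof
  assume u: "is_union C A S m"
  then have f: "A \<in> Ob" "\<forall>s\<in>S. is_mono C s \<and> scod s = A" "is_mono C m" "scod m = A"
    by (auto simp: is_union_def)
  then have ar: "\<forall>s\<in>S. s \<in> Arr C" "m \<in> Arr C" by (auto simp: mono_iff)
  have g: "\<forall>s\<in>S. rng s \<subseteq> rng m"
    using u f ar factors_through_iff unfolding is_union_def by metis
  let ?B = "\<Union>s\<in>S. rng s"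
  let ?i = "(?B, \<lambda>x\<in>?B. x, A)"
  have "?B \<subseteq> A" using f ar rng_subset by blast
  then have ii: "is_mono C ?i" "rng ?i = ?B"
    using inclusion_mono f(1) by auto
  have "factors_through C s ?i" if "s \<in> S" for s
    using ii f ar that by (subst factors_through_iff) auto
  then have "factors_through C m ?i" using u ii unfolding is_union_def by simp
  then have "rng m \<subseteq> ?B" using f ar ii by (subst (asm) factors_through_iff) auto
  with f g show "A \<in> Ob \<and> (\<forall>s\<in>S. is_mono C s \<and> scod s = A) \<and> is_mono C m \<and>
     scod m = A \<and> rng m = ?B" by auto
next
  assume a: "A \<in> Ob \<and> (\<forall>s\<in>S. is_mono C s \<and> scod s = A) \<and> is_mono C m \<and>
     scod m = A \<and> rng m = (\<Union>s\<in>S. rng s)"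
  then have ar: "\<forall>s\<in>S. s \<in> Arr C" "m \<in> Arr C" by (auto simp: mono_iff)
  have "factors_through C s m" if "s \<in> S" for s
    using a ar that by (subst factors_through_iff) auto
  moreover have "factors_through C m n"
    if n: "is_mono C n" "scod n = A" and "\<forall>s\<in>S. factors_through C s n" for n
  proof -
    have "rng s \<subseteq> rng n" if "s \<in> S" for s
      using that n a ar \<open>\<forall>s\<in>S. factors_through C s n\<close> factors_through_iff by metis
    then show ?thesis using a ar n by (subst factors_through_iff) auto
  qed
  ultimately show "is_union C A S m"
    using a by (auto simp: is_union_def)
qed

lemma ex_image: "f \<in> Arr C \<Longrightarrow> \<exists>m. is_image C f m"
  using inclusion_mono [of "scod f" "rng f"] rng_subset [of f]
  by (auto simp: image_iff Arr_lcat intro!: exI [of _ "(rng f, \<lambda>x\<in>rng f. x, scod f)"])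

lemma ex_union:
  assumes "A \<in> Ob" "\<forall>s\<in>S. is_mono C s \<and> scod s = A"
  shows "\<exists>m. is_union C A S m"
proof -
  let ?B = "\<Union>s\<in>S. rng s"
  have "?B \<subseteq> A" using assms rng_subset mono_iff by blast
  then show ?thesis
    using assms inclusion_mono [of A ?B]
    by (auto simp: union_iff intro!: exI [of _ "(?B, \<lambda>x\<in>?B. x, A)"])
qed

lemma pullback_legs:
  assumes "is_pullback C g f p r"
  shows "p \<in> Arr C" "r \<in> Arr C" "g \<in> Arr C" "f \<in> Arr C"
    "sdom r = sdom p" "scod p = sdom g" "scod r = sdom f"
    "compose (sdom p) (sfun g) (sfun p) = compose (sdom p) (sfun f) (sfun r)"
  using assms by (auto simp: is_pullback_def)

text \<open>The pair \<open>x\<close>, \<open>y\<close> is a cone with apex \<open>{x}\<close>: both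
  elements have the label of their common image, so both constants on \<open>{x}\<close> are arrows.
  The universal property then speaks about single elements.\<close>

lemma pullback_point:
  assumes pb: "is_pullback C g f p r" and x: "x \<in> sdom g" and y: "y \<in> sdom f"
    and e: "sfun g x = sfun f y"
  shows "\<exists>!u. u \<in> sdom p \<and> sfun p u = x \<and> sfun r u = y"
proof -
  have a: "g \<in> Arr C" "f \<in> Arr C" "p \<in> Arr C" "r \<in> Arr C" "sdom r = sdom p"
      "scod p = sdom g" "scod r = sdom f"
    using pb by (auto simp: is_pullback_def)
  have l: "lab x = lab y" using a e x y unfolding Arr_lcat by metis
  let ?k = "\<lambda>B y. ({x}, \<lambda>_\<in>{x}. y, B)"
  have xO: "{x} \<in> Ob" using x a subset_Ob by (auto simp: Arr_lcat)
  have k: "?k (sdom g) x \<in> Arr C" "?k (sdom f) y \<in> Arr C"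
    using xO a x y l by (auto simp: Arr_lcat)
  have "Comp C g (?k (sdom g) x) = Comp C f (?k (sdom f) y)"
    using e pullback_legs [OF pb] pb by (auto simp: compose_def restrict_def is_pullback_def)
  moreover have "\<forall>p'\<in>Arr C. \<forall>q'\<in>Arr C.
        Dom C p' = Dom C q' \<and> Cod C p' = Dom C g \<and> Cod C q' = Dom C f \<and>
        Comp C g p' = Comp C f q' \<longrightarrow>
        (\<exists>!u. u \<in> hom C (Dom C p') (Dom C p) \<and> Comp C p u = p' \<and> Comp C r u = q')"
    using pb unfolding is_pullback_def by blast
  moreover have "Dom C (?k (sdom g) x) = Dom C (?k (sdom f) y)"
    "Cod C (?k (sdom g) x) = Dom C g" "Cod C (?k (sdom f) y) = Dom C f" by simp_all
  ultimately have "\<exists>!u. u \<in> hom C (Dom C (?k (sdom g) x)) (Dom C p) \<and>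
      Comp C p u = ?k (sdom g) x \<and> Comp C r u = ?k (sdom f) y"
    using k by blast
  then have ex: "\<exists>!u. u \<in> hom C {x} (sdom p) \<and> Comp C p u = ?k (sdom g) x \<and>
      Comp C r u = ?k (sdom f) y"
    by simp
  show ?thesis
  proof (rule ex_ex1I)
    from ex obtain u where u: "u \<in> hom C {x} (sdom p)" "Comp C p u = ?k (sdom g) x"
      "Comp C r u = ?k (sdom f) y" by blast
    then have "compose {x} (sfun p) (sfun u) x = x" "compose {x} (sfun r) (sfun u) x = y"
      by (auto simp: hom_lcat)
    then show "\<exists>u. u \<in> sdom p \<and> sfun p u = x \<and> sfun r u = y"
      using u(1) by (intro exI [of _ "sfun u x"]) (auto simp: hom_lcat compose_def)
  next
    fix u v assume uv: "u \<in> sdom p \<and> sfun p u = x \<and> sfun r u = y"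
      "v \<in> sdom p \<and> sfun p v = x \<and> sfun r v = y"
    have "lab u = lab x" "lab v = lab x" using uv a by (auto simp: Arr_lcat)
    moreover have "sdom p \<in> Ob" using a by (auto simp: Arr_lcat)
    ultimately have "?k (sdom p) u \<in> hom C {x} (sdom p)" "?k (sdom p) v \<in> hom C {x} (sdom p)"
      using uv xO by (auto simp: hom_lcat)
    moreover have "Comp C p (?k (sdom p) u) = ?k (sdom g) x" "Comp C r (?k (sdom p) u) = ?k (sdom f) y"
        "Comp C p (?k (sdom p) v) = ?k (sdom g) x" "Comp C r (?k (sdom p) v) = ?k (sdom f) y"
      using uv a by (auto simp: compose_def restrict_def)
    ultimately have "?k (sdom p) u = ?k (sdom p) v" using ex by blast
    then show "u = v" by (metis Pair_inject restrict_apply' singletonI)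
  qed
qed

text \<open>Pulling back a subobject is taking a preimage, which depends on \<open>f\<close> only
  through its range. Stability of images follows at once, and stability of unions because preimages
  commute with unions.\<close>

lemma pullback_rng:
  assumes pb: "is_pullback C g f p r"
  shows "rng p = {x \<in> sdom g. sfun g x \<in> rng f}"
proof (intro equalityI subsetI)
  have a: "p \<in> Arr C" "r \<in> Arr C" "sdom r = sdom p" "scod p = sdom g" "scod r = sdom f"
      "compose (sdom p) (sfun g) (sfun p) = compose (sdom p) (sfun f) (sfun r)"
    using pb by (auto simp: is_pullback_def)
  fix x assume "x \<in> rng p"
  then obtain u where u: "u \<in> sdom p" "x = sfun p u" by (auto simp: rng_def)
  have "sfun g x = sfun f (sfun r u)" using fun_cong [OF a(6), of u] u by (simp add: compose_def)
  then show "x \<in> {x \<in> sdom g. sfun g x \<in> rng f}"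
    using a u by (auto simp: Arr_lcat rng_def)
next
  fix x assume "x \<in> {x \<in> sdom g. sfun g x \<in> rng f}"
  then obtain y where "x \<in> sdom g" "y \<in> sdom f" "sfun g x = sfun f y" by (auto simp: rng_def)
  from pullback_point [OF pb this] show "x \<in> rng p" by (auto simp: rng_def)
qed

lemma pullback_mono:
  assumes pb: "is_pullback C g m p r" and m: "is_mono C m"
  shows "is_mono C p"
  unfolding mono_iff
proof (intro conjI inj_onI)
  have a: "p \<in> Arr C" "r \<in> Arr C" "sdom r = sdom p" "scod p = sdom g" "scod r = sdom m"
      "compose (sdom p) (sfun g) (sfun p) = compose (sdom p) (sfun m) (sfun r)"
    using pb by (auto simp: is_pullback_def)
  then show "p \<in> Arr C" by simp
  fix u v assume uv: "u \<in> sdom p" "v \<in> sdom p" "sfun p u = sfun p v"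
  have e: "sfun g (sfun p w) = sfun m (sfun r w)" if "w \<in> sdom p" for w
    using fun_cong [OF a(6), of w] that by (simp add: compose_def)
  have i: "sfun r w \<in> sdom m" "sfun p w \<in> sdom g" if "w \<in> sdom p" for w
    using a that by (auto simp: Arr_lcat)
  have "sfun r u = sfun r v"
    using e [OF uv(1)] e [OF uv(2)] uv m i unfolding mono_iff by (metis inj_onD)
  with pullback_point [OF pb i(2) [OF uv(1)] i(1) [OF uv(1)] e [OF uv(1)]] uv
  show "u = v" by metis
qed

lemma image_stable:
  assumes "is_image C f m" "is_pullback C g f f' r" "is_pullback C g m m' s"
  shows "is_image C f' m'"
  using assms(1) pullback_rng [OF assms(2)] pullback_rng [OF assms(3)] pullback_mono [OF assms(3)]
    pullback_legs [OF assms(2)] pullback_legs [OF assms(3)]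
  by (auto simp: image_iff)

lemma union_stable:
  assumes u: "is_union C A S m" and m': "is_pullback C g m m' r"
    and n: "\<forall>s\<in>S. is_pullback C g s (n s) (t s)"
  shows "is_union C (sdom g) (n ` S) m'"
proof -
  have "is_mono C (n s)" "rng (n s) = {x \<in> sdom g. sfun g x \<in> rng s}" "scod (n s) = sdom g"
    if "s \<in> S" for s
    using that u pullback_mono [OF bspec [OF n that]] pullback_rng [OF bspec [OF n that]]
      pullback_legs [OF bspec [OF n that]]
    by (auto simp: union_iff)
  then show ?thesis
    using u pullback_mono [OF m'] pullback_rng [OF m'] pullback_legs [OF m']
    by (auto simp: union_iff Arr_lcat)
qed

section \<open>Cones and limits in terms of families of elements\<close>

lemma cone_iff:
  assumes d: "finite_diagram C d"
  shows "is_cone C d L p \<longleftrightarrow> L \<in> Ob \<and> (\<forall>i\<in>verts d. p i \<in> hom C L (dobj d i)) \<and>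
    (\<forall>l\<in>L. family lab d (lab l) (\<lambda>i. sfun (p i) l))"
proof -
  have "Comp C (darr d e) (p (esrc d e)) = p (etgt d e) \<longleftrightarrow>
      (\<forall>l\<in>L. sfun (darr d e) (sfun (p (esrc d e)) l) = sfun (p (etgt d e)) l)"
    if p: "\<forall>i\<in>verts d. p i \<in> hom C L (dobj d i)" and e: "e \<in> edges d" for e
  proof -
    have h: "p (esrc d e) \<in> hom C L (dobj d (esrc d e))"
        "p (etgt d e) \<in> hom C L (dobj d (etgt d e))"
        "darr d e \<in> hom C (dobj d (esrc d e)) (dobj d (etgt d e))"
      using d p e by (auto simp: finite_diagram_def)
    then have c: "Comp C (darr d e) (p (esrc d e)) \<in> hom C L (dobj d (etgt d e))"
      by (blast intro: comp_lcat)
    show ?thesis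
    proof
      assume "Comp C (darr d e) (p (esrc d e)) = p (etgt d e)"
      then have "compose (sdom (p (esrc d e))) (sfun (darr d e)) (sfun (p (esrc d e))) =
          sfun (p (etgt d e))"
        by (metis lcat_sel(5) sarr_sel(2))
      then show "\<forall>l\<in>L. sfun (darr d e) (sfun (p (esrc d e)) l) = sfun (p (etgt d e)) l"
        using h(1) by (metis compose_eq hom_lcat)
    next
      assume "\<forall>l\<in>L. sfun (darr d e) (sfun (p (esrc d e)) l) = sfun (p (etgt d e)) l"
      then show "Comp C (darr d e) (p (esrc d e)) = p (etgt d e)"
        using h by (intro arr_eqI [OF c h(2)]) (auto simp: compose_def hom_lcat)
    qed
  qed
  then show ?thesis
    unfolding is_cone_def family_def by (auto simp: hom_lcat)
qed

text \<open>Singletons detect limits: a cone with apex \<open>{z}\<close> is a family at the label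
  of \<open>z\<close>. Hence \<open>j\<close> ranges over the labels that occur in some object, for
  only these are labels of a test singleton.\<close>

lemma limit_iff:
  assumes d: "finite_diagram C d"
  shows "is_limit C d L p \<longleftrightarrow> is_cone C d L p \<and>
    (\<forall>j \<in> lab ` \<Union>Ob. \<forall>x. family lab d j x \<longrightarrow>
      (\<exists>!l. l \<in> L \<and> lab l = j \<and> (\<forall>i\<in>verts d. sfun (p i) l = x i)))"
proof (intro iffI conjI ballI allI impI)
  assume lim: "is_limit C d L p"
  then show cone: "is_cone C d L p" by (simp add: is_limit_def)
  fix j x assume "j \<in> lab ` \<Union>Ob" and x: "family lab d j x"
  then obtain z X where "z \<in> X" "X \<in> Ob" and z: "lab z = j" by auto
  then have zO: "{z} \<in> Ob" using subset_Ob [of X "{z}"] by simp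
  let ?q = "\<lambda>B y. ({z}, \<lambda>_\<in>{z}. y, B)"
  have q: "?q (dobj d i) (x i) \<in> hom C {z} (dobj d i)" if "i \<in> verts d" for i
    using that x z zO d by (auto simp: hom_lcat family_def finite_diagram_def)
  have "is_cone C d {z} (\<lambda>i. ?q (dobj d i) (x i))"
    using q z zO x by (auto simp: cone_iff [OF d] family_def)
  then have ex: "\<exists>!u. u \<in> hom C {z} L \<and> (\<forall>i\<in>verts d. Comp C (p i) u = ?q (dobj d i) (x i))"
    using lim unfolding is_limit_def by blast
  have LO: "L \<in> Ob" and p: "\<forall>i\<in>verts d. p i \<in> hom C L (dobj d i)"
    using cone by (auto simp: is_cone_def)
  show "\<exists>!l. l \<in> L \<and> lab l = j \<and> (\<forall>i\<in>verts d. sfun (p i) l = x i)"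
  proof (rule ex_ex1I)
    from ex obtain u where u: "u \<in> hom C {z} L" "\<forall>i\<in>verts d. Comp C (p i) u = ?q (dobj d i) (x i)"
      by blast
    have "sfun (p i) (sfun u z) = x i" if "i \<in> verts d" for i
    proof -
      have "compose {z} (sfun (p i)) (sfun u) = (\<lambda>_\<in>{z}. x i)"
        using u that by (auto simp: hom_lcat)
      from fun_cong [OF this, of z] show ?thesis by (simp add: compose_def)
    qed
    then show "\<exists>l. l \<in> L \<and> lab l = j \<and> (\<forall>i\<in>verts d. sfun (p i) l = x i)"
      using u z by (intro exI [of _ "sfun u z"]) (auto simp: hom_lcat)
  next
    fix l l' assume l: "l \<in> L \<and> lab l = j \<and> (\<forall>i\<in>verts d. sfun (p i) l = x i)"
      "l' \<in> L \<and> lab l' = j \<and> (\<forall>i\<in>verts d. sfun (p i) l' = x i)"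
    have "?q L k \<in> hom C {z} L \<and> (\<forall>i\<in>verts d. Comp C (p i) (?q L k) = ?q (dobj d i) (x i))"
      if "k \<in> L \<and> lab k = j \<and> (\<forall>i\<in>verts d. sfun (p i) k = x i)" for k
      using that z zO LO p by (auto simp: hom_lcat compose_def restrict_def split: if_splits)
    from this [OF l(1)] this [OF l(2)] have "?q L l = ?q L l'"
      using ex by blast
    then show "l = l'" by (metis Pair_inject restrict_apply' singletonI)
  qed
next
  assume a: "is_cone C d L p \<and> (\<forall>j \<in> lab ` \<Union>Ob. \<forall>x. family lab d j x \<longrightarrow>
      (\<exists>!l. l \<in> L \<and> lab l = j \<and> (\<forall>i\<in>verts d. sfun (p i) l = x i)))"
  then have LO: "L \<in> Ob" and p: "\<And>i. i \<in> verts d \<Longrightarrow> p i \<in> hom C L (dobj d i)"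
    by (auto simp: is_cone_def)
  show "is_limit C d L p"
    unfolding is_limit_def
  proof (intro conjI allI impI)
    show "is_cone C d L p" using a by simp
    fix K q assume K: "is_cone C d K q"
    then have KO: "K \<in> Ob" and q: "\<And>i. i \<in> verts d \<Longrightarrow> q i \<in> hom C K (dobj d i)"
      and fam: "\<And>k. k \<in> K \<Longrightarrow> family lab d (lab k) (\<lambda>i. sfun (q i) k)"
      by (auto simp: cone_iff [OF d])
    let ?P = "\<lambda>k l. l \<in> L \<and> lab l = lab k \<and> (\<forall>i\<in>verts d. sfun (p i) l = sfun (q i) k)"
    have ex: "\<exists>!l. ?P k l" if "k \<in> K" for k
      using a fam [OF that] that KO by blast
    \<comment> \<open>Being a factorisation is a condition at each element of \<open>K\<close>
      separately, so existence and uniqueness of \<open>u\<close> reduce to those of its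
      values.\<close>
    have fac: "u \<in> hom C K L \<and> (\<forall>i\<in>verts d. Comp C (p i) u = q i) \<longleftrightarrow>
        u \<in> hom C K L \<and> (\<forall>k\<in>K. ?P k (sfun u k))" for u
    proof (intro conj_cong refl)
      assume u: "u \<in> hom C K L"
      have "Comp C (p i) u = q i \<longleftrightarrow> (\<forall>k\<in>K. sfun (p i) (sfun u k) = sfun (q i) k)"
        if i: "i \<in> verts d" for i
      proof
        assume "Comp C (p i) u = q i"
        then have "compose (sdom u) (sfun (p i)) (sfun u) = sfun (q i)"
          by (metis lcat_sel(5) sarr_sel(2))
        then show "\<forall>k\<in>K. sfun (p i) (sfun u k) = sfun (q i) k"
          using u by (metis compose_eq hom_lcat)
      next
        assume k: "\<forall>k\<in>K. sfun (p i) (sfun u k) = sfun (q i) k"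
        have "Comp C (p i) u \<in> hom C K (dobj d i)"
          using u p [OF i] by (rule comp_lcat)
        then show "Comp C (p i) u = q i"
          using q [OF i] by (rule arr_eqI) (use k u in \<open>auto simp: hom_lcat compose_def\<close>)
      qed
      then show "(\<forall>i\<in>verts d. Comp C (p i) u = q i) \<longleftrightarrow> (\<forall>k\<in>K. ?P k (sfun u k))"
        using u by (auto simp: hom_lcat)
    qed
    show "\<exists>!u. u \<in> hom C K L \<and> (\<forall>i\<in>verts d. Comp C (p i) u = q i)"
      unfolding fac
    proof (rule ex_ex1I)
      let ?u = "(K, \<lambda>k\<in>K. THE l. ?P k l, L)"
      have t: "?P k (THE l. ?P k l)" if "k \<in> K" for k
        by (rule theI' [OF ex [OF that]])
      then have "?u \<in> hom C K L" using KO LO by (auto simp: hom_lcat)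
      then show "\<exists>u. u \<in> hom C K L \<and> (\<forall>k\<in>K. ?P k (sfun u k))"
        using t by (intro exI [of _ ?u]) auto
    next
      fix u v assume "u \<in> hom C K L \<and> (\<forall>k\<in>K. ?P k (sfun u k))"
        "v \<in> hom C K L \<and> (\<forall>k\<in>K. ?P k (sfun v k))"
      then show "u = v" using ex by (intro arr_eqI [of u Ob lab K L]) blast+
    qed
  qed
qed

end

section \<open>Coherence of the category of finite labelled sets\<close>

locale finite_labelled =
  fixes U :: "'s set" and lab :: "'s \<Rightarrow> 'k"
  assumes finite_labels: "finite (lab ` U)"
    and infinite_fibres: "\<And>j. j \<in> lab ` U \<Longrightarrow> \<not> finite {x \<in> U. lab x = j}"
begin

sublocale subset_closed "{A. finite A \<and> A \<subseteq> U}" lab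
  by standard (auto intro: finite_subset)

text \<open>Limits arise on pairs and functions, which are not elements of \<open>'s\<close>; this
  moves a finite labelled set back into \<open>U\<close>. Each infinite fibre has room for its
  share, and injections into different fibres have disjoint images.\<close>

lemma realize:
  assumes W: "finite W" and l: "\<And>w. w \<in> W \<Longrightarrow> l w \<in> lab ` U"
  shows "\<exists>g. inj_on g W \<and> (\<forall>w\<in>W. g w \<in> U \<and> lab (g w) = l w)"
proof -
  have "\<exists>g. inj_on g {w \<in> W. l w = j} \<and> g ` {w \<in> W. l w = j} \<subseteq> {x \<in> U. lab x = j}"
    if j: "j \<in> lab ` U" for j
  proof -
    obtain B where B: "finite B" "card B = card {w \<in> W. l w = j}" "B \<subseteq> {x \<in> U. lab x = j}"
      using infinite_arbitrarily_large [OF infinite_fibres [OF j]] by metis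
    obtain g where "bij_betw g {w \<in> W. l w = j} B"
      using finite_same_card_bij [of "{w \<in> W. l w = j}" B] W B by auto
    then have "inj_on g {w \<in> W. l w = j}" "g ` {w \<in> W. l w = j} = B"
      by (simp_all add: bij_betw_def)
    then show ?thesis using B(3) by blast
  qed
  then have "\<forall>j\<in>lab ` U. \<exists>g. inj_on g {w \<in> W. l w = j} \<and>
      g ` {w \<in> W. l w = j} \<subseteq> {x \<in> U. lab x = j}" by blast
  then have "\<exists>g. \<forall>j\<in>lab ` U. inj_on (g j) {w \<in> W. l w = j} \<and>
      g j ` {w \<in> W. l w = j} \<subseteq> {x \<in> U. lab x = j}" by (rule bchoice)
  then obtain g where g: "\<And>j. j \<in> lab ` U \<Longrightarrow> inj_on (g j) {w \<in> W. l w = j} \<and>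
      g j ` {w \<in> W. l w = j} \<subseteq> {x \<in> U. lab x = j}" by blast
  have gg: "g (l w) w \<in> U \<and> lab (g (l w) w) = l w" if "w \<in> W" for w
    using g [OF l [OF that]] that by auto
  moreover have "inj_on (\<lambda>w. g (l w) w) W"
  proof (rule inj_onI)
    fix v w assume vw: "v \<in> W" "w \<in> W" "g (l v) v = g (l w) w"
    then have "l v = l w" using gg by metis
    then show "v = w" using vw g [OF l [OF vw(1)]] by (auto dest: inj_onD)
  qed
  ultimately show ?thesis by (intro exI [of _ "\<lambda>w. g (l w) w"]) auto
qed

lemma Union_Ob: "\<Union>{A. finite A \<and> A \<subseteq> U} = U"
  by auto

text \<open>The limit is formed in each fibre and summed over the labels. Even the empty diagram has
  one point per label, so it is the finiteness of the set of labels that keeps the result an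
  object.\<close>

lemma ex_limit:
  assumes d: "finite_diagram C d"
  shows "\<exists>L p. is_limit C d L p"
proof -
  \<comment> \<open>Extensional families only: there are finitely many, and two of them that agree
    on \<open>verts d\<close> are equal.\<close>
  let ?F = "\<lambda>j. {x \<in> Pi\<^sub>E (verts d) (dobj d). family lab d j x}"
  let ?W = "Sigma (lab ` U) ?F"
  have "finite (Pi\<^sub>E (verts d) (dobj d))"
    using d by (intro finite_PiE) (auto simp: finite_diagram_def)
  then have "finite ?W" using finite_labels by (intro finite_SigmaI) auto
  then obtain g where g: "inj_on g ?W" "\<And>w. w \<in> ?W \<Longrightarrow> g w \<in> U \<and> lab (g w) = fst w"
    using realize [of ?W fst] by fastforce
  let ?L = "g ` ?W"
  let ?x = "\<lambda>l. snd (inv_into ?W g l)"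
  let ?p = "\<lambda>i. (?L, \<lambda>l\<in>?L. ?x l i, dobj d i)"
  have inv: "inv_into ?W g (g w) = w" if "w \<in> ?W" for w
    using g(1) that by (rule inv_into_f_f)
  have x: "?x l \<in> Pi\<^sub>E (verts d) (dobj d)" "family lab d (lab l) (?x l)" if l: "l \<in> ?L" for l
  proof -
    from l obtain w where w: "w \<in> ?W" "l = g w" by auto
    then have "?x l = snd w" "lab l = fst w" using inv g(2) by simp_all
    with w(1) show "?x l \<in> Pi\<^sub>E (verts d) (dobj d)" "family lab d (lab l) (?x l)" by auto
  qed
  have LO: "finite ?L \<and> ?L \<subseteq> U" using \<open>finite ?W\<close> g(2) by blast
  have cone: "is_cone C d ?L ?p"
    unfolding cone_iff [OF d]
  proof (intro conjI ballI)
    fix i assume i: "i \<in> verts d"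
    then have di: "finite (dobj d i) \<and> dobj d i \<subseteq> U"
      using d by (auto simp: finite_diagram_def)
    have "?x l i \<in> dobj d i \<and> lab (?x l i) = lab l" if "l \<in> ?L" for l
      using x(2) [OF that] i by (auto simp: family_def)
    then show "?p i \<in> hom C ?L (dobj d i)"
      using LO di unfolding hom_lcat by simp
  next
    fix l assume l: "l \<in> ?L"
    show "family lab d (lab l) (\<lambda>i. sfun (?p i) l)"
      using x(2) [OF l] l by simp
  qed (use LO in simp)
  have "\<exists>!l. l \<in> ?L \<and> lab l = j \<and> (\<forall>i\<in>verts d. sfun (?p i) l = y i)"
    if j: "j \<in> lab ` U" and y: "family lab d j y" for j y
  proof (rule ex_ex1I)
    let ?y = "restrict y (verts d)"
    have "?y \<in> Pi\<^sub>E (verts d) (dobj d)" using y by (auto simp: family_def)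
    moreover have "family lab d j ?y"
      using y d by (auto simp: family_def finite_diagram_def)
    ultimately have w: "(j, ?y) \<in> ?W" using j by blast
    then have "g (j, ?y) \<in> ?L" by (rule imageI)
    moreover have "lab (g (j, ?y)) = j" "?x (g (j, ?y)) = ?y"
      using g(2) [OF w] inv [OF w] by simp_all
    ultimately show "\<exists>l. l \<in> ?L \<and> lab l = j \<and> (\<forall>i\<in>verts d. sfun (?p i) l = y i)"
      by (intro exI [of _ "g (j, ?y)"]) simp
  next
    fix l l' assume l: "l \<in> ?L \<and> lab l = j \<and> (\<forall>i\<in>verts d. sfun (?p i) l = y i)"
      and l': "l' \<in> ?L \<and> lab l' = j \<and> (\<forall>i\<in>verts d. sfun (?p i) l' = y i)"
    have "?x l = ?x l'"
    proof (rule PiE_ext [OF x(1) x(1)])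
      fix i assume i: "i \<in> verts d"
      have "sfun (?p i) l = y i" "sfun (?p i) l' = y i" using l l' i by blast+
      then show "?x l i = ?x l' i" using l l' by (simp only: sarr_sel restrict_apply' refl)
    qed (rule conjunct1 [OF l], rule conjunct1 [OF l'])
    moreover have "fst (inv_into ?W g k) = lab k" if "k \<in> ?L" for k
      using that inv g(2) by auto
    then have "fst (inv_into ?W g l) = j" "fst (inv_into ?W g l') = j"
      using conjunct1 [OF l] conjunct1 [OF l'] l l' by simp_all
    ultimately have "inv_into ?W g l = inv_into ?W g l'"
      by (simp add: prod_eq_iff)
    then have "g (inv_into ?W g l) = g (inv_into ?W g l')" by simp
    then show "l = l'"
      using f_inv_into_f [OF conjunct1 [OF l]] f_inv_into_f [OF conjunct1 [OF l']] by simp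
  qed
  then have "is_limit C d ?L ?p"
    unfolding limit_iff [OF d] Union_Ob using cone by (intro conjI ballI allI impI)
  then show ?thesis by blast
qed

lemma coherent_finite: "coherent_category C"
  unfolding coherent_category_def
  using category_lcat ex_limit ex_image ex_union image_stable union_stable by auto

end

interpretation S: subset_closed "UNIV :: 's set set" "\<lambda>_. ()"
  rewrites "lcat UNIV (\<lambda>_. ()) = set_cat"
  by (simp_all add: subset_closed_def set_cat_eq_lcat)

section \<open>Functors\<close>

lemma func_comp_sel [simp]:
  "onObj (func_comp G F) = onObj G \<circ> onObj F" "onArr (func_comp G F) = onArr G \<circ> onArr F"
  by (simp_all add: func_comp_def)

lemma map_diagram_sel [simp]:
  "verts (map_diagram F d) = verts d" "edges (map_diagram F d) = edges d"
  "esrc (map_diagram F d) = esrc d" "etgt (map_diagram F d) = etgt d"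
  "dobj (map_diagram F d) = onObj F \<circ> dobj d" "darr (map_diagram F d) = onArr F \<circ> darr d"
  by (simp_all add: map_diagram_def)

lemma map_diagram_comp: "map_diagram (func_comp G F) d = map_diagram G (map_diagram F d)"
  by (simp add: map_diagram_def comp_assoc)

lemma functor_hom: "is_functor C D F \<Longrightarrow> f \<in> hom C A B \<Longrightarrow> onArr F f \<in> hom D (onObj F A) (onObj F B)"
  by (auto simp: is_functor_def hom_def)

lemma functor_Comp:
  "is_functor C D F \<Longrightarrow> f \<in> hom C A B \<Longrightarrow> g \<in> hom C B E \<Longrightarrow>
    onArr F (Comp C g f) = Comp D (onArr F g) (onArr F f)"
  by (auto simp: is_functor_def hom_def)

lemma hom_Arr: "f \<in> Arr C \<Longrightarrow> f \<in> hom C (Dom C f) (Cod C f)"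
  by (simp add: hom_def)

lemma Comp_hom: "category C \<Longrightarrow> f \<in> hom C A B \<Longrightarrow> g \<in> hom C B E \<Longrightarrow> Comp C g f \<in> hom C A E"
  by (auto simp: category_def hom_def)

lemma Comp_assoc:
  "category C \<Longrightarrow> f \<in> hom C A B \<Longrightarrow> g \<in> hom C B E \<Longrightarrow> h \<in> hom C E E' \<Longrightarrow>
    Comp C h (Comp C g f) = Comp C (Comp C h g) f"
  by (auto simp: category_def hom_def)

lemma Comp_Ident:
  assumes "category C" "f \<in> hom C A B"
  shows "Comp C f (Ident C A) = f" "Comp C (Ident C B) f = f"
  using assms by (auto simp: category_def hom_def)

lemma Ident_hom: "category C \<Longrightarrow> A \<in> Obj C \<Longrightarrow> Ident C A \<in> hom C A A"
  by (simp add: category_def)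

lemma is_iso_Ident: "category C \<Longrightarrow> A \<in> Obj C \<Longrightarrow> is_iso C (Ident C A)"
  using Ident_hom [of C A] Comp_Ident [of C "Ident C A" A A]
  by (auto simp: is_iso_def hom_def)

lemma functor_iso:
  assumes F: "is_functor C D F" and f: "is_iso C f"
  shows "is_iso D (onArr F f)"
proof -
  from f obtain g where g: "g \<in> hom C (Cod C f) (Dom C f)" "Comp C g f = Ident C (Dom C f)"
    "Comp C f g = Ident C (Cod C f)" and fA: "f \<in> hom C (Dom C f) (Cod C f)"
    by (auto simp: is_iso_def hom_def)
  have o: "Dom C f \<in> Obj C" "Cod C f \<in> Obj C"
    using F fA by (auto simp: is_functor_def category_def hom_def)
  have "Comp D (onArr F g) (onArr F f) = Ident D (onObj F (Dom C f))"
    using functor_Comp [OF F fA g(1)] g(2) F o by (simp add: is_functor_def)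
  moreover have "Comp D (onArr F f) (onArr F g) = Ident D (onObj F (Cod C f))"
    using functor_Comp [OF F g(1) fA] g(3) F o by (simp add: is_functor_def)
  ultimately show ?thesis
    using functor_hom [OF F fA] functor_hom [OF F g(1)] by (auto simp: is_iso_def hom_def)
qed

lemma coherent_category_limit:
  "coherent_category C \<Longrightarrow> finite_diagram C d \<Longrightarrow> \<exists>L p. is_limit C d L p"
  by (simp add: coherent_category_def)

lemma coherent_category_union:
  assumes "coherent_category C" "A \<in> Obj C" "finite S"
    and "\<And>s. s \<in> S \<Longrightarrow> is_mono C s \<and> Cod C s = A"
  shows "\<exists>m. is_union C A S m"
proof -
  have "\<forall>A\<in>Obj C. \<forall>S. finite S \<and> (\<forall>s\<in>S. is_mono C s \<and> Cod C s = A) \<longrightarrow> (\<exists>m. is_union C A S m)"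
    using assms(1) by (simp add: coherent_category_def)
  then show ?thesis using assms(2-4) by simp
qed

lemma coherent_functor_functor: "coherent_functor C D F \<Longrightarrow> is_functor C D F"
  by (simp add: coherent_functor_def)

lemma coherent_functor_limit:
  "coherent_functor C D F \<Longrightarrow> finite_diagram C d \<Longrightarrow> is_limit C d L p \<Longrightarrow>
    is_limit D (map_diagram F d) (onObj F L) (onArr F \<circ> p)"
  by (simp add: coherent_functor_def)

lemma coherent_functor_image:
  "coherent_functor C D F \<Longrightarrow> is_image C f m \<Longrightarrow> is_image D (onArr F f) (onArr F m)"
  by (simp add: coherent_functor_def)

lemma coherent_functor_union:
  "coherent_functor C D F \<Longrightarrow> finite S \<Longrightarrow> is_union C A S m \<Longrightarrow>
    is_union D (onObj F A) (onArr F ` S) (onArr F m)"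
  by (simp add: coherent_functor_def)

lemma id_func_sel [simp]: "onObj id_func A = A" "onArr id_func f = f" "onArr id_func ` S = S"
  "onArr id_func \<circ> p = p"
  by (simp_all add: id_func_def)

lemma map_diagram_id [simp]: "map_diagram id_func d = d"
  by (simp add: map_diagram_def id_func_def)

lemma is_functor_comp:
  assumes F: "is_functor C D F" and G: "is_functor D E G"
  shows "is_functor C E (func_comp G F)"
  unfolding is_functor_def
proof (intro conjI ballI impI)
  fix f g assume "f \<in> Arr C" "g \<in> Arr C" "Cod C f = Dom C g"
  then have h: "f \<in> hom C (Dom C f) (Cod C f)" "g \<in> hom C (Cod C f) (Cod C g)"
    by (auto simp: hom_def)
  show "onArr (func_comp G F) (Comp C g f) =
      Comp E (onArr (func_comp G F) g) (onArr (func_comp G F) f)"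
    using functor_Comp [OF F h] functor_Comp [OF G functor_hom [OF F h(1)] functor_hom [OF F h(2)]]
    by simp
next
  fix f assume "f \<in> Arr C"
  then show "onArr (func_comp G F) f \<in> hom E (onObj (func_comp G F) (Dom C f))
      (onObj (func_comp G F) (Cod C f))"
    by (simp add: functor_hom [OF G] functor_hom [OF F] hom_Arr)
qed (use F G in \<open>auto simp: is_functor_def\<close>)

lemma finite_diagram_map:
  assumes "is_functor C D F" "finite_diagram C d"
  shows "finite_diagram D (map_diagram F d)"
  using assms functor_hom [OF assms(1)] by (auto simp: finite_diagram_def is_functor_def)

lemma coherent_functor_comp:
  assumes F: "coherent_functor C D F" and G: "coherent_functor D E G"
  shows "coherent_functor C E (func_comp G F)"
  unfolding coherent_functor_def
proof (intro conjI allI impI)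
  have Ff: "is_functor C D F" and Gf: "is_functor D E G"
    using F G by (auto simp: coherent_functor_def)
  then show "is_functor C E (func_comp G F)" by (rule is_functor_comp)
  fix d L p assume d: "finite_diagram C d \<and> is_limit C d L p"
  then have "is_limit D (map_diagram F d) (onObj F L) (onArr F \<circ> p)"
    using F by (simp add: coherent_functor_def)
  moreover have "finite_diagram D (map_diagram F d)"
    using d finite_diagram_map [OF Ff] by simp
  ultimately have "is_limit E (map_diagram G (map_diagram F d)) (onObj G (onObj F L)) (onArr G \<circ> (onArr F \<circ> p))"
    using G by (simp add: coherent_functor_def)
  then show "is_limit E (map_diagram (func_comp G F) d) (onObj (func_comp G F) L)
      (onArr (func_comp G F) \<circ> p)"
    by (simp add: map_diagram_comp comp_assoc)
next
  fix A S m assume "finite S \<and> is_union C A S m"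
  then have "finite (onArr F ` S) \<and> is_union D (onObj F A) (onArr F ` S) (onArr F m)"
    using F by (simp add: coherent_functor_def)
  then have "is_union E (onObj G (onObj F A)) (onArr G ` onArr F ` S) (onArr G (onArr F m))"
    using G by (simp add: coherent_functor_def)
  then show "is_union E (onObj (func_comp G F) A) (onArr (func_comp G F) ` S) (onArr (func_comp G F) m)"
    by (simp add: image_comp)
qed (use F G in \<open>auto simp: coherent_functor_def\<close>)

lemma limit_iso:
  assumes C: "category C" and L: "is_limit C d L p" and L': "is_limit C d L' p'"
  shows "\<exists>h. h \<in> hom C L L' \<and> is_iso C h \<and> (\<forall>i\<in>verts d. Comp C (p' i) h = p i)"
proof -
  have c: "is_cone C d L p" "is_cone C d L' p'" using L L' by (auto simp: is_limit_def)
  obtain h where h: "h \<in> hom C L L'" "\<forall>i\<in>verts d. Comp C (p' i) h = p i"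
    using L' c(1) unfolding is_limit_def by blast
  obtain g where g: "g \<in> hom C L' L" "\<forall>i\<in>verts d. Comp C (p i) g = p' i"
    using L c(2) unfolding is_limit_def by blast
  have ident: "k = Ident C M"
    if "is_limit C d M r" "k \<in> hom C M M" "\<forall>i\<in>verts d. Comp C (r i) k = r i" for M r k
  proof -
    have M: "is_cone C d M r" "M \<in> Obj C" using that by (auto simp: is_limit_def is_cone_def)
    have "\<forall>i\<in>verts d. Comp C (r i) (Ident C M) = r i"
      using C M(1) by (auto simp: is_cone_def Comp_Ident)
    then show ?thesis
      using that M Ident_hom [OF C M(2)] unfolding is_limit_def by blast
  qed
  have ph: "p i \<in> hom C L (dobj d i)" "p' i \<in> hom C L' (dobj d i)" if "i \<in> verts d" for i
    using c that by (auto simp: is_cone_def)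
  have "Comp C g h = Ident C L"
    using h g ph Comp_assoc [OF C h(1) g(1)]
    by (intro ident [OF L] Comp_hom [OF C h(1) g(1)]) metis
  moreover have "Comp C h g = Ident C L'"
    using h g ph Comp_assoc [OF C g(1) h(1)]
    by (intro ident [OF L'] Comp_hom [OF C g(1) h(1)]) metis
  ultimately have "is_iso C h"
    using h(1) g(1) by (auto simp: is_iso_def hom_def)
  with h show ?thesis by blast
qed

lemma is_iso_inverse:
  assumes "is_iso C f"
  obtains g where "is_iso C g" "g \<in> hom C (Cod C f) (Dom C f)" "Comp C g f = Ident C (Dom C f)"
    "Comp C f g = Ident C (Cod C f)"
proof -
  from assms obtain g where "g \<in> hom C (Cod C f) (Dom C f)" "Comp C g f = Ident C (Dom C f)"
    "Comp C f g = Ident C (Cod C f)" "f \<in> Arr C" by (auto simp: is_iso_def)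
  moreover from this have "is_iso C g" by (auto simp: is_iso_def hom_def)
  ultimately show thesis using that by blast
qed

section \<open>The inclusion of Float into Set\<close>

lemma family_set:
  "family (\<lambda>_. ()) d () x \<longleftrightarrow> (\<forall>i\<in>verts d. x i \<in> dobj d i) \<and>
     (\<forall>e\<in>edges d. sfun (darr d e) (x (esrc d e)) = x (etgt d e))"
  by (simp add: family_def)

lemma limit_set_iff:
  assumes "finite_diagram set_cat d"
  shows "is_limit set_cat d L p \<longleftrightarrow> is_cone set_cat d L p \<and>
    (\<forall>x. family (\<lambda>_. ()) d () x \<longrightarrow> (\<exists>!l. l \<in> L \<and> (\<forall>i\<in>verts d. sfun (p i) l = x i)))"
  by (simp add: S.limit_iff [OF assms])

lemma sfun_Comp:
  assumes "f \<in> hom set_cat A B" "x \<in> A"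
  shows "sfun (Comp set_cat g f) x = sfun g (sfun f x)"
  using assms by (simp add: hom_set_cat compose_def)

lemma set_arr_eqI:
  assumes "h \<in> hom set_cat A B" "h' \<in> hom set_cat A B" "\<And>x. x \<in> A \<Longrightarrow> sfun h x = sfun h' x"
  shows "h = h'"
  using arr_eqI [of h UNIV "\<lambda>_. ()" A B h'] assms by (simp add: set_cat_eq_lcat)

text \<open>Pullbacks in the form in which coherent functors are known to preserve them: as limits
  of a diagram, with vertices 0 and 1 for the two domains and 2 for the common codomain.\<close>

definition cospan :: "'s sarr \<Rightarrow> 's sarr \<Rightarrow> ('s set, 's sarr) diag" where
  "cospan m n = \<lparr>verts = {0, 1, 2}, edges = {0, 1}, esrc = id, etgt = (\<lambda>_. 2),
     dobj = (\<lambda>i. if i = 0 then sdom m else if i = 1 then sdom n else scod m),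
     darr = (\<lambda>e. if e = 0 then m else n)\<rparr>"

lemma finite_diagram_cospan:
  assumes "category C" "Dom C = sdom" "Cod C = scod" "m \<in> Arr C" "n \<in> Arr C" "scod m = scod n"
  shows "finite_diagram C (cospan m n)"
  using assms by (auto simp: finite_diagram_def cospan_def hom_def category_def)

section \<open>Replete coherent subcategories of Set\<close>

abbreviation subcat :: "'s set set \<Rightarrow> 's sarr set \<Rightarrow> 's scat" where
  "subcat X Y \<equiv> set_cat\<lparr>Obj := X, Arr := Y\<rparr>"

lemma hom_subcat: "h \<in> hom (subcat X Y) A B \<longleftrightarrow> h \<in> Y \<and> sdom h = A \<and> scod h = B"
  by (auto simp: hom_def)

lemma is_mono_subcat:
  assumes "is_mono set_cat m" "m \<in> Y" "Y \<subseteq> Arr set_cat"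
  shows "is_mono (subcat X Y) m"
  unfolding is_mono_def
proof (intro conjI ballI impI)
  fix f g assume "f \<in> Arr (subcat X Y)" "g \<in> Arr (subcat X Y)" and
    e: "Cod (subcat X Y) f = Dom (subcat X Y) m \<and> Cod (subcat X Y) g = Dom (subcat X Y) m \<and>
      Dom (subcat X Y) f = Dom (subcat X Y) g \<and> Comp (subcat X Y) m f = Comp (subcat X Y) m g"
  then have "f \<in> Arr set_cat" "g \<in> Arr set_cat" using assms(3) by auto
  moreover have "Cod set_cat f = Dom set_cat m" "Cod set_cat g = Dom set_cat m"
    "Dom set_cat f = Dom set_cat g" "Comp set_cat m f = Comp set_cat m g"
    using e by auto
  ultimately show "f = g" using assms(1) unfolding is_mono_def by blast
qed (use assms in simp)

locale replete_subcat =
  fixes X :: "'s set set" and Y :: "'s sarr set"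
  assumes replete: "replete_coherent_subcategory set_cat X Y"
begin

lemma Y_Arr: "h \<in> Y \<Longrightarrow> h \<in> Arr set_cat"
  using replete by (auto simp: replete_coherent_subcategory_def)

lemma coherent: "coherent_category (subcat X Y)"
  and incl: "coherent_functor (subcat X Y) set_cat id_func"
  using replete by (auto simp: replete_coherent_subcategory_def)

lemma category: "category (subcat X Y)"
  using coherent by (simp add: coherent_category_def)

lemma Y_X: "h \<in> Y \<Longrightarrow> sdom h \<in> X \<and> scod h \<in> X"
  using category by (auto simp: category_def)

lemma Y_Comp: "f \<in> Y \<Longrightarrow> g \<in> Y \<Longrightarrow> scod f = sdom g \<Longrightarrow> Comp set_cat g f \<in> Y"
  using Comp_hom [OF category, of f "sdom f" "scod f" g "scod g"] by (simp add: hom_subcat)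

lemma Y_iso_dom: "is_iso set_cat h \<Longrightarrow> sdom h \<in> X \<Longrightarrow> h \<in> Y"
  using replete unfolding replete_coherent_subcategory_def set_cat_sel by blast

text \<open>Repleteness is formulated for isomorphisms leaving an object of the subcategory; for one
  that arrives there, the inverse leaves it and brings the domain in.\<close>

lemma Y_iso_cod:
  assumes "is_iso set_cat h" "scod h \<in> X"
  shows "h \<in> Y"
proof -
  obtain g where g: "is_iso set_cat g" "g \<in> hom set_cat (scod h) (sdom h)"
    by (rule is_iso_inverse [OF assms(1)]) simp
  then have "g \<in> Y" using assms(2) by (intro Y_iso_dom) (auto simp: hom_set_cat)
  then have "sdom h \<in> X" using g(2) Y_X [of g] by (simp add: hom_set_cat)
  then show ?thesis using assms(1) by (rule Y_iso_dom [rotated])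
qed

text \<open>Some limit exists in the subcategory and is preserved by the inclusion; its comparison
  with any limit \<open>L\<close> in Set is an isomorphism, so repleteness puts it in
  \<open>Y\<close>. The point is that \<open>L\<close> and \<open>p\<close> do not depend on the
  subcategory, so they survive an intersection.\<close>

lemma set_limit:
  assumes d: "finite_diagram (subcat X Y) d" and L: "is_limit set_cat d L p"
  shows "L \<in> X" "i \<in> verts d \<Longrightarrow> p i \<in> Y"
    "is_cone (subcat X Y) d K q \<Longrightarrow>
      \<exists>u\<in>Y. u \<in> hom set_cat K L \<and> (\<forall>i\<in>verts d. Comp set_cat (p i) u = q i)"
proof -
  obtain L' p' where lim: "is_limit (subcat X Y) d L' p'"
    using coherent d by (auto simp: coherent_category_def)
  then have L': "is_limit set_cat d L' p'"
    using coherent_functor_limit [OF incl d] by simp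
  have p': "L' \<in> X" "\<And>i. i \<in> verts d \<Longrightarrow> p' i \<in> Y \<and> p' i \<in> hom set_cat L' (dobj d i)"
    using lim L' by (auto simp: is_limit_def is_cone_def hom_subcat)
  obtain h where h: "h \<in> hom set_cat L L'" "is_iso set_cat h"
      "\<And>i. i \<in> verts d \<Longrightarrow> Comp set_cat (p' i) h = p i"
    using limit_iso [OF category_set_cat L L'] by blast
  then have hY: "h \<in> Y" using p' by (intro Y_iso_cod) (auto simp: hom_set_cat)
  then show "L \<in> X" using Y_X [of h] h(1) by (simp add: hom_set_cat)
  show "p i \<in> Y" if "i \<in> verts d"
    using h(3) [OF that] p'(2) [OF that] hY h(1) Y_Comp [of h "p' i"] by (auto simp: hom_set_cat)
  obtain g where g: "is_iso set_cat g" "g \<in> hom set_cat L' L" "Comp set_cat h g = Ident set_cat L'"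
    by (rule is_iso_inverse [OF h(2)]) (use h(1) in \<open>auto simp: hom_set_cat\<close>)
  then have gY: "g \<in> Y" using p' by (intro Y_iso_dom) (auto simp: hom_set_cat)
  have pg: "Comp set_cat (p i) g = p' i" if "i \<in> verts d" for i
  proof -
    have "Comp set_cat (p i) g = Comp set_cat (p' i) (Comp set_cat h g)"
      using h(3) [OF that] Comp_assoc [OF category_set_cat g(2) h(1)] p'(2) [OF that] by metis
    then show ?thesis
      using g(3) Comp_Ident(1) [OF category_set_cat] p'(2) [OF that] by metis
  qed
  assume K: "is_cone (subcat X Y) d K q"
  then obtain u where u: "u \<in> hom (subcat X Y) K L'" "\<forall>i\<in>verts d. Comp (subcat X Y) (p' i) u = q i"
    using lim unfolding is_limit_def by blast
  then have u': "u \<in> hom set_cat K L'" "\<And>i. i \<in> verts d \<Longrightarrow> Comp set_cat (p' i) u = q i"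
    using Y_Arr by (auto simp: hom_subcat hom_def)
  have "Comp set_cat g u \<in> Y"
    using u(1) gY g(2) by (intro Y_Comp) (auto simp: hom_subcat hom_set_cat)
  moreover have "Comp set_cat (p i) (Comp set_cat g u) = q i" if i: "i \<in> verts d" for i
  proof -
    have "p i \<in> hom set_cat L (dobj d i)"
      using L i by (auto simp: is_limit_def is_cone_def)
    from Comp_assoc [OF category_set_cat u'(1) g(2) this] show ?thesis
      using pg [OF i] u'(2) [OF i] by metis
  qed
  ultimately show "\<exists>u\<in>Y. u \<in> hom set_cat K L \<and> (\<forall>i\<in>verts d. Comp set_cat (p i) u = q i)"
    using Comp_hom [OF category_set_cat u'(1) g(2)] by blast
qed

text \<open>The mono that a subcategory offers as an image or union depends on that subcategory, the
  inclusion of its range does not. Repleteness passes between them along the bijection of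
  \<open>sdom m\<close> with \<open>rng m\<close>.\<close>

lemma corestriction_Y:
  assumes m: "m \<in> Y" "is_mono set_cat m"
  shows "(rng m, \<lambda>x\<in>rng m. x, scod m) \<in> Y"
    and "s \<in> Y \<Longrightarrow> factors_through (subcat X Y) s m \<Longrightarrow> (sdom s, sfun s, rng m) \<in> Y"
proof -
  have mA: "m \<in> Arr set_cat" "inj_on (sfun m) (sdom m)"
    using m by (auto simp: S.mono_iff)
  let ?k = "(sdom m, sfun m, rng m)"
  have k: "is_iso set_cat ?k"
    using mA by (auto simp: is_iso_set_cat Arr_set_cat rng_def bij_betw_def)
  then have kY: "?k \<in> Y" using Y_X [OF m(1)] by (intro Y_iso_dom) auto
  obtain j where j: "is_iso set_cat j" "j \<in> hom set_cat (rng m) (sdom m)"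
    "Comp set_cat ?k j = Ident set_cat (rng m)"
    by (rule is_iso_inverse [OF k]) auto
  have jY: "j \<in> Y" using j Y_X [OF m(1)] by (intro Y_iso_cod) (auto simp: hom_set_cat)
  have "Comp set_cat m j = (rng m, \<lambda>x\<in>rng m. x, scod m)"
    using j(2,3) by (simp add: hom_set_cat)
  moreover have "Comp set_cat m j \<in> Y"
    using jY m j(2) by (intro Y_Comp) (auto simp: hom_set_cat)
  ultimately show "(rng m, \<lambda>x\<in>rng m. x, scod m) \<in> Y" by (simp only:)
  assume "s \<in> Y" "factors_through (subcat X Y) s m"
  then obtain e where e: "e \<in> Y" "sdom e = sdom s" "scod e = sdom m" "Comp set_cat m e = s"
    by (auto simp: factors_through_def hom_subcat)
  have "Comp set_cat ?k e \<in> Y" (is "?ke \<in> Y") using e kY by (intro Y_Comp) auto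
  have "sfun s = compose (sdom e) (sfun m) (sfun e)"
    using e(4) by (metis sarr_sel(2) set_cat_sel(5))
  then have "?ke = (sdom s, sfun s, rng m)"
    using e(2) by simp
  with \<open>?ke \<in> Y\<close> show "(sdom s, sfun s, rng m) \<in> Y" by (simp only:)
qed

lemma set_image:
  assumes f: "f \<in> Y"
  shows "(rng f, \<lambda>x\<in>rng f. x, scod f) \<in> Y" "(sdom f, sfun f, rng f) \<in> Y"
proof -
  obtain m where m: "is_image (subcat X Y) f m"
    using coherent f by (auto simp: coherent_category_def)
  then have "is_image set_cat f m"
    using coherent_functor_image [OF incl] by simp
  then have "is_mono set_cat m" "rng m = rng f" "scod m = scod f"
    by (auto simp: S.image_iff)
  moreover have "m \<in> Y" "factors_through (subcat X Y) f m"
    using m by (auto simp: is_image_def is_mono_def)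
  ultimately show "(rng f, \<lambda>x\<in>rng f. x, scod f) \<in> Y" "(sdom f, sfun f, rng f) \<in> Y"
    using corestriction_Y [of m] f by auto
qed

lemma set_union:
  assumes A: "A \<in> X" and S: "finite S" "\<And>s. s \<in> S \<Longrightarrow> s \<in> Y \<and> is_mono set_cat s \<and> scod s = A"
  shows "((\<Union>s\<in>S. rng s), \<lambda>x\<in>(\<Union>s\<in>S. rng s). x, A) \<in> Y"
    "s \<in> S \<Longrightarrow> (sdom s, sfun s, (\<Union>s\<in>S. rng s)) \<in> Y"
proof -
  have mono: "is_mono (subcat X Y) s \<and> Cod (subcat X Y) s = A" if "s \<in> S" for s
    using S(2) [OF that] Y_Arr is_mono_subcat [of s Y X] by (simp add: subsetI)
  obtain m where m: "is_union (subcat X Y) A S m"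
    using coherent_category_union [OF coherent _ S(1), of A] mono A by auto
  then have "is_union set_cat A S m"
    using coherent_functor_union [OF incl S(1)] by simp
  then have "is_mono set_cat m" "rng m = (\<Union>s\<in>S. rng s)" "scod m = A"
    by (auto simp: S.union_iff)
  moreover have "m \<in> Y" "\<And>s. s \<in> S \<Longrightarrow> factors_through (subcat X Y) s m"
    using m by (auto simp: is_union_def is_mono_def)
  ultimately show "((\<Union>s\<in>S. rng s), \<lambda>x\<in>(\<Union>s\<in>S. rng s). x, A) \<in> Y"
    "s \<in> S \<Longrightarrow> (sdom s, sfun s, (\<Union>s\<in>S. rng s)) \<in> Y"
    using corestriction_Y [of m] S(2) by auto
qed

end

text \<open>Both sides have the same description by elements, except that \<open>limit_iff\<close>
  quantifies over the labels that occur. A nonempty object makes the one label occur; if the empty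
  set were the only object, it would be terminal there but not in Set.\<close>

lemma inclusion_coherent:
  assumes Ob: "subset_closed Ob" and ne: "\<Union>Ob \<noteq> {}"
  shows "coherent_functor (lcat Ob (\<lambda>_. ())) set_cat id_func"
proof -
  interpret O: subset_closed Ob "\<lambda>_. ()" by (fact Ob)
  have Arr: "f \<in> Arr set_cat" if "f \<in> Arr O.C" for f
    using that by (simp add: Arr_lcat Arr_set_cat)
  have hom: "f \<in> hom set_cat A B" if "f \<in> hom O.C A B" for f A B
    using that by (simp add: hom_lcat hom_set_cat)
  have F: "is_functor O.C set_cat id_func"
    unfolding is_functor_def
    using category_lcat [of Ob "\<lambda>_. ()"] category_set_cat hom [OF hom_Arr] by simp
  have mono: "is_mono set_cat m" if "is_mono O.C m" for m
    using that Arr by (simp add: O.mono_iff S.mono_iff)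
  show ?thesis
    unfolding coherent_functor_def
  proof (intro conjI allI impI)
    show "is_functor O.C set_cat id_func" by (fact F)
  next
    fix d L p assume a: "finite_diagram O.C d \<and> is_limit O.C d L p"
    then have d: "finite_diagram O.C d" by simp
    have d': "finite_diagram set_cat d" using finite_diagram_map [OF F d] by simp
    have un: "\<exists>z X. X \<in> Ob \<and> z \<in> X" using ne by auto
    have "is_cone O.C d L p" using a by (simp add: is_limit_def)
    then have "is_cone set_cat d L p"
      using hom by (simp add: O.cone_iff [OF d] S.cone_iff [OF d'])
    moreover have "\<forall>x. family (\<lambda>_. ()) d () x \<longrightarrow>
        (\<exists>!l. l \<in> L \<and> (\<forall>i\<in>verts d. sfun (p i) l = x i))"
      using a un by (simp add: O.limit_iff [OF d]) blast
    ultimately show "is_limit set_cat (map_diagram id_func d) (onObj id_func L) (onArr id_func \<circ> p)"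
      by (simp add: limit_set_iff [OF d'])
  next
    fix f m assume "is_image O.C f m"
    then show "is_image set_cat (onArr id_func f) (onArr id_func m)"
      using mono Arr by (simp add: O.image_iff S.image_iff)
  next
    fix A K m assume "finite K \<and> is_union O.C A K m"
    then show "is_union set_cat (onObj id_func A) (onArr id_func ` K) (onArr id_func m)"
      using mono by (simp add: O.union_iff S.union_iff)
  qed
qed

section \<open>The category Float and its inclusion into Set\<close>

locale float_data =
  fixes R :: "'s set" and add mul :: "'s \<Rightarrow> 's \<Rightarrow> 's"
  assumes infinite_type: "infinite (UNIV :: 's set)"
    and finite_R: "finite R"
    and closed: "\<And>x y. x \<in> R \<Longrightarrow> y \<in> R \<Longrightarrow> add x y \<in> R \<and> mul x y \<in> R"
    and coherent_float: "coherent_category (float_cat R add mul)"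
begin

abbreviation "fl \<equiv> float_cat R add mul"
abbreviation "gen \<equiv> float_generated R add mul"

lemma fl_sel [simp]:
  "Dom fl = sdom" "Cod fl = scod" "Ident fl = Ident set_cat" "Comp fl = Comp set_cat"
  by (simp_all add: float_cat_def fun_eq_iff)

lemma category_fl: "category fl"
  using coherent_float by (simp add: coherent_category_def)

lemma fl_Obj: "A \<in> Obj fl \<longleftrightarrow> (\<forall>X Y. gen X Y \<longrightarrow> A \<in> X)"
  by (auto simp: float_cat_def)

lemma fl_Arr: "h \<in> Arr fl \<longleftrightarrow> (\<forall>X Y. gen X Y \<longrightarrow> h \<in> Y)"
  by (auto simp: float_cat_def)

lemma hom_fl: "h \<in> hom fl A B \<longleftrightarrow> h \<in> Arr fl \<and> sdom h = A \<and> scod h = B"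
  by (auto simp: hom_def)

lemma binop_arr_Arr:
  assumes "\<And>x y. x \<in> R \<Longrightarrow> y \<in> R \<Longrightarrow> f x y \<in> R"
  shows "binop_arr R f \<in> Arr set_cat"
proof -
  have "case_prod f (inv_into (R \<times> R) pair_code z) \<in> R" if "z \<in> square R" for z
    using inv_into_into [of z pair_code "R \<times> R"] that assms by (auto simp: square_def)
  then show ?thesis by (simp add: binop_arr_def Arr_set_cat)
qed

text \<open>One member of the family that Float intersects. It confines Float to finite sets and
  functions between them, and shows that the intersection is not over an empty family.\<close>

lemma finite_sets_generated:
  "gen {A. finite A \<and> A \<subseteq> UNIV} (Arr (lcat {A. finite A \<and> A \<subseteq> UNIV} (\<lambda>_. ())))"
proof -
  interpret Fin: finite_labelled "UNIV :: 's set" "\<lambda>_. ()"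
    using infinite_type by unfold_locales auto
  let ?Ob = "{A::'s set. finite A \<and> A \<subseteq> UNIV}"
  have sub: "subcat ?Ob (Arr Fin.C) = Fin.C"
    by (simp add: set_cat_def lcat_def)
  have "replete_coherent_subcategory set_cat ?Ob (Arr Fin.C)"
    unfolding replete_coherent_subcategory_def sub
  proof (intro conjI allI impI)
    show "coherent_category Fin.C" by (rule Fin.coherent_finite)
    show "coherent_functor Fin.C set_cat id_func"
      using Fin.subset_closed_axioms by (rule inclusion_coherent) blast
    fix f :: "'s sarr" assume "is_iso set_cat f \<and> Dom set_cat f \<in> ?Ob"
    then have "f \<in> Arr set_cat" "bij_betw (sfun f) (sdom f) (scod f)" "finite (sdom f)"
      by (simp_all add: is_iso_set_cat)
    then show "f \<in> Arr Fin.C"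
      using bij_betw_finite [of "sfun f" "sdom f" "scod f"] by (simp add: Arr_lcat Arr_set_cat)
  qed (auto simp: Arr_lcat Arr_set_cat)
  moreover have "finite (square R)" using finite_R by (simp add: square_def)
  moreover have "binop_arr R add \<in> Arr set_cat" "binop_arr R mul \<in> Arr set_cat"
    using closed by (auto intro: binop_arr_Arr)
  ultimately show ?thesis
    using finite_R
    by (simp add: float_generated_def Arr_lcat Arr_set_cat const_arr_def)
      (simp add: binop_arr_def)
qed

lemma fl_Obj_finite: "A \<in> Obj fl \<Longrightarrow> finite A"
  using finite_sets_generated unfolding fl_Obj by blast

lemma fl_Arr_set:
  assumes "h \<in> Arr fl"
  shows "h \<in> Arr set_cat"
proof -
  have "h \<in> Arr (lcat {A. finite A \<and> A \<subseteq> UNIV} (\<lambda>_. ()))"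
    using assms finite_sets_generated unfolding fl_Arr by blast
  then show ?thesis by (simp add: Arr_lcat Arr_set_cat)
qed

lemma fl_hom_set: "h \<in> hom fl A B \<Longrightarrow> h \<in> hom set_cat A B"
  using fl_Arr_set by (auto simp: hom_def)

lemma gen_replete: "gen X Y \<Longrightarrow> replete_subcat X Y"
  by (simp add: float_generated_def replete_subcat_def)

lemma const_arr_fl: "r \<in> R \<Longrightarrow> const_arr z r R \<in> Arr fl"
  by (auto simp: fl_Arr float_generated_def)

lemma R_fl: "R \<in> Obj fl"
  by (auto simp: fl_Obj float_generated_def)

lemma incl_functor: "is_functor fl set_cat id_func"
  unfolding is_functor_def
  using category_fl category_set_cat by (simp add: fl_hom_set hom_fl)

text \<open>A limit in Float is tested only on cones in Float, so a limit in Set is needed for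
  comparison: one found in a generated subcategory lies in all of them. The arrows \<open>u\<close>
  and \<open>v\<close> between the two are then both in Float, where \<open>u\<close> after
  \<open>v\<close> is the identity. This is enough: \<open>u\<close> gives existence of elements,
  injectivity of \<open>v\<close> their uniqueness.\<close>

lemma fl_limit_set:
  assumes d: "finite_diagram fl d" and L: "is_limit fl d L p"
  shows "is_limit set_cat d L p"
proof -
  have d_set: "finite_diagram set_cat d"
    using finite_diagram_map [OF incl_functor d] by simp
  have d_gen: "finite_diagram (subcat X Y) d" if "gen X Y" for X Y
    using d that by (auto simp: finite_diagram_def hom_fl hom_subcat fl_Arr fl_Obj)
  have cone_gen: "is_cone (subcat X Y) d K q" if "is_cone fl d K q" "gen X Y" for X Y K q
    using that by (auto simp: is_cone_def hom_fl hom_subcat fl_Arr fl_Obj)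
  have cone: "is_cone fl d L p" using L by (simp add: is_limit_def)
  then have cone_set: "is_cone set_cat d L p"
    by (auto simp: is_cone_def dest: fl_hom_set)
  obtain X1 Y1 where gen1: "gen X1 Y1" using finite_sets_generated by blast
  interpret Q: replete_subcat X1 Y1 by (rule gen_replete [OF gen1])
  obtain L1 p1 where "is_limit (subcat X1 Y1) d L1 p1"
    using coherent_category_limit [OF Q.coherent d_gen [OF gen1]] by blast
  then have L1: "is_limit set_cat d L1 p1"
    using coherent_functor_limit [OF Q.incl d_gen [OF gen1]] by simp
  then have cone1_set: "is_cone set_cat d L1 p1" by (simp add: is_limit_def)
  have "L1 \<in> Obj fl" "\<And>i. i \<in> verts d \<Longrightarrow> p1 i \<in> Arr fl"
    using replete_subcat.set_limit(1,2) [OF gen_replete d_gen L1]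
    unfolding fl_Obj fl_Arr by blast+
  then have cone1: "is_cone fl d L1 p1"
    using cone1_set by (auto simp: is_cone_def hom_fl hom_set_cat)
  obtain u where u: "u \<in> hom fl L1 L" "\<forall>i\<in>verts d. Comp fl (p i) u = p1 i"
    using L cone1 unfolding is_limit_def by blast
  have ex_v: "\<exists>!v. v \<in> hom set_cat L L1 \<and> (\<forall>i\<in>verts d. Comp set_cat (p1 i) v = p i)"
    using L1 cone_set unfolding is_limit_def by blast
  then obtain v where v: "v \<in> hom set_cat L L1" "\<forall>i\<in>verts d. Comp set_cat (p1 i) v = p i"
    by blast
  \<comment> \<open>Each generated subcategory has some factorisation, and uniqueness in Set
    identifies it with \<open>v\<close>.\<close>
  have "v \<in> Y" if g: "gen X Y" for X Y
  proof -
    obtain w where "w \<in> Y" "w \<in> hom set_cat L L1" "\<forall>i\<in>verts d. Comp set_cat (p1 i) w = p i"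
      using replete_subcat.set_limit(3) [OF gen_replete [OF g] d_gen [OF g] L1 cone_gen [OF cone g]]
      by blast
    then show ?thesis using ex_v v by blast
  qed
  then have v_fl: "v \<in> hom fl L L1" using v(1) by (simp add: hom_fl fl_Arr hom_set_cat)
  have LO: "L \<in> Obj fl" using cone by (simp add: is_cone_def)
  have u_set: "u \<in> hom set_cat L1 L" using u(1) by (rule fl_hom_set)
  have pi: "p i \<in> hom set_cat L (dobj d i)" if "i \<in> verts d" for i
    using cone_set that by (simp add: is_cone_def)
  have "Comp set_cat (p i) (Comp set_cat u v) = p i" if i: "i \<in> verts d" for i
    using Comp_assoc [OF category_set_cat v(1) u_set pi [OF i]] u(2) v(2) i
    by (simp only: fl_sel)
  then have "Comp fl u v \<in> hom fl L L \<and> (\<forall>i\<in>verts d. Comp fl (p i) (Comp fl u v) = p i)"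
    using Comp_hom [OF category_fl v_fl u(1)] by simp
  moreover have "Ident fl L \<in> hom fl L L \<and> (\<forall>i\<in>verts d. Comp fl (p i) (Ident fl L) = p i)"
    using Ident_hom [OF category_fl LO] Comp_Ident(1) [OF category_set_cat pi] by simp
  ultimately have uv: "Comp set_cat u v = Ident set_cat L"
    using L cone unfolding is_limit_def fl_sel by blast
  have uv: "sfun u (sfun v l) = l" if "l \<in> L" for l
    using sfun_Comp [OF v(1) that, of u] that unfolding uv by simp
  have pu: "sfun (p i) (sfun u l) = sfun (p1 i) l" if "i \<in> verts d" "l \<in> L1" for i l
    using sfun_Comp [OF u_set that(2), of "p i"] u(2) that(1) by (metis fl_sel(4))
  have pv: "sfun (p1 i) (sfun v l) = sfun (p i) l" if "i \<in> verts d" "l \<in> L" for i l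
    using sfun_Comp [OF v(1) that(2), of "p1 i"] v(2) that(1) by metis
  show ?thesis
    unfolding limit_set_iff [OF d_set]
  proof (intro conjI allI impI ex_ex1I)
    show "is_cone set_cat d L p" by (fact cone_set)
    fix x assume "family (\<lambda>_. ()) d () x"
    then have ex: "\<exists>!l. l \<in> L1 \<and> (\<forall>i\<in>verts d. sfun (p1 i) l = x i)"
      using L1 by (simp add: limit_set_iff [OF d_set])
    then obtain l1 where "l1 \<in> L1 \<and> (\<forall>i\<in>verts d. sfun (p1 i) l1 = x i)" by blast
    moreover from this have "sfun u l1 \<in> L" using u_set by (auto simp: hom_set_cat)
    ultimately show "\<exists>l. l \<in> L \<and> (\<forall>i\<in>verts d. sfun (p i) l = x i)"
      using pu by (intro exI [of _ "sfun u l1"]) simp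
    fix l l' assume l: "l \<in> L \<and> (\<forall>i\<in>verts d. sfun (p i) l = x i)"
      and l': "l' \<in> L \<and> (\<forall>i\<in>verts d. sfun (p i) l' = x i)"
    have "sfun v l \<in> L1" "sfun v l' \<in> L1" using v(1) l l' by (auto simp: hom_set_cat)
    moreover have "\<forall>i\<in>verts d. sfun (p1 i) (sfun v l) = x i"
      "\<forall>i\<in>verts d. sfun (p1 i) (sfun v l') = x i" using l l' pv by simp_all
    ultimately have "sfun v l = sfun v l'" using ex by blast
    then have "sfun u (sfun v l) = sfun u (sfun v l')" by (rule arg_cong)
    then show "l = l'" unfolding uv [OF conjunct1 [OF l]] uv [OF conjunct1 [OF l']] .
  qed
qed

text \<open>The kernel pair of \<open>m\<close> in Float is one in Set by
  \<open>fl_limit_set\<close>. Its legs agree because \<open>m\<close> is mono in Float, and every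
  pair of elements with the same image is a value of the legs.\<close>

lemma fl_mono_set:
  assumes m: "is_mono fl m"
  shows "is_mono set_cat m"
  unfolding S.mono_iff
proof (intro conjI inj_onI)
  have mA: "m \<in> Arr fl" using m by (simp add: is_mono_def)
  then show "m \<in> Arr set_cat" by (rule fl_Arr_set)
  let ?d = "cospan m m"
  have d: "finite_diagram fl ?d"
    using mA category_fl by (intro finite_diagram_cospan) auto
  then obtain L p where L: "is_limit fl ?d L p"
    using coherent_category_limit [OF coherent_float] by blast
  then have Ls: "is_limit set_cat ?d L p" by (rule fl_limit_set [OF d])
  have c: "p 0 \<in> hom fl L (sdom m)" "p 1 \<in> hom fl L (sdom m)"
      "Comp fl m (p 0) = p 2" "Comp fl m (p 1) = p 2"
    using L by (auto simp: is_limit_def is_cone_def cospan_def)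
  have "p 0 = p 1"
  proof -
    have "\<forall>f\<in>Arr fl. \<forall>g\<in>Arr fl. Cod fl f = Dom fl m \<and> Cod fl g = Dom fl m \<and> Dom fl f = Dom fl g \<and>
        Comp fl m f = Comp fl m g \<longrightarrow> f = g"
      using m unfolding is_mono_def by blast
    moreover have "p 0 \<in> Arr fl" "p 1 \<in> Arr fl" "Cod fl (p 0) = Dom fl m" "Cod fl (p 1) = Dom fl m"
        "Dom fl (p 0) = Dom fl (p 1)" "Comp fl m (p 0) = Comp fl m (p 1)"
      using c unfolding hom_def by auto
    ultimately show ?thesis by blast
  qed
  fix x y assume xy: "x \<in> sdom m" "y \<in> sdom m" "sfun m x = sfun m y"
  have ds: "finite_diagram set_cat ?d"
    using finite_diagram_map [OF incl_functor d] by simp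
  let ?x = "\<lambda>i::nat. if i = 0 then x else if i = 1 then y else sfun m x"
  have "sfun m x \<in> scod m" using fl_Arr_set [OF mA] xy by (auto simp: Arr_set_cat)
  then have "family (\<lambda>_. ()) ?d () ?x"
    using xy by (auto simp: family_def cospan_def)
  then obtain l where "\<forall>i\<in>verts ?d. sfun (p i) l = ?x i"
    using Ls unfolding limit_set_iff [OF ds] by blast
  then have "sfun (p 0) l = x" "sfun (p 1) l = y" by (auto simp: cospan_def)
  then show "x = y" using \<open>p 0 = p 1\<close> by simp
qed

lemma set_mono_fl:
  assumes "m \<in> Arr fl" "is_mono set_cat m"
  shows "is_mono fl m"
proof -
  have "fl = subcat (Obj fl) (Arr fl)" by (simp add: float_cat_def)
  moreover have "Arr fl \<subseteq> Arr set_cat" using fl_Arr_set by blast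
  ultimately show ?thesis using is_mono_subcat [of m "Arr fl" "Obj fl"] assms by metis
qed

lemma fl_factors_set: "factors_through fl f m \<Longrightarrow> factors_through set_cat f m"
  by (auto simp: factors_through_def simp del: set_cat_sel(5) dest: fl_hom_set)

text \<open>Minimality of an image or union is known only against subobjects in Float. It is applied
  to the inclusions of the set-theoretic image and union; these, and the corestrictions witnessing
  the factorisations, are arrows of every generated subcategory.\<close>

lemma incl_coherent: "coherent_functor fl set_cat id_func"
  unfolding coherent_functor_def id_func_sel map_diagram_id
proof (intro conjI allI impI)
  show "is_functor fl set_cat id_func" by (rule incl_functor)
next
  fix d L p assume "finite_diagram fl d \<and> is_limit fl d L p"
  then show "is_limit set_cat d L p" using fl_limit_set by blast
next
  fix f m assume "is_image fl f m"
  then have f: "f \<in> Arr fl" "is_mono set_cat m" "scod m = scod f" "factors_through fl f m"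
    and min: "\<And>n. is_mono fl n \<Longrightarrow> scod n = scod f \<Longrightarrow> factors_through fl f n \<Longrightarrow> factors_through fl m n"
    by (simp_all only: is_image_def fl_sel) (blast dest: fl_mono_set)+
  let ?i = "(rng f, \<lambda>x\<in>rng f. x, scod f)" and ?e = "(sdom f, sfun f, rng f)"
  have fs: "f \<in> Arr set_cat" using f(1) by (rule fl_Arr_set)
  have i: "?i \<in> Arr fl" "?e \<in> Arr fl"
    using replete_subcat.set_image [OF gen_replete] f(1) unfolding fl_Arr by blast+
  have isub: "is_mono set_cat ?i" "rng ?i = rng f"
    using S.inclusion_mono [of "scod f" "rng f"] S.rng_subset [OF fs] by auto
  have "compose (sdom f) (\<lambda>x\<in>rng f. x) (sfun f) = sfun f"
    using fs by (auto simp: compose_def rng_def fun_eq_iff Arr_set_cat PiE_def extensional_def)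
  then have "Comp fl ?i ?e = f" by (simp add: sdom_def sfun_def scod_def)
  then have "factors_through fl f ?i"
    using i unfolding factors_through_def by (intro bexI [of _ ?e]) (auto simp: hom_fl)
  then have "factors_through fl m ?i"
    using min [of ?i] set_mono_fl [OF i(1) isub(1)] by simp
  then have "rng m \<subseteq> rng f"
    using fl_factors_set S.factors_through_iff [of m ?i] isub f(2,3) S.mono_iff [of m] by simp
  moreover have "rng f \<subseteq> rng m"
    using fl_factors_set [OF f(4)] S.factors_through_iff [of f m] f fs by auto
  ultimately show "is_image set_cat f m"
    using f fs by (auto simp: S.image_iff)
next
  fix A K m assume a: "finite K \<and> is_union fl A K m"
  then have A: "A \<in> Obj fl" "finite K" "is_mono set_cat m" "scod m = A"
    and s: "\<And>s. s \<in> K \<Longrightarrow> is_mono fl s \<and> is_mono set_cat s \<and> scod s = A \<and> factors_through fl s m"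
    and min: "\<And>n. is_mono fl n \<Longrightarrow> scod n = A \<Longrightarrow> (\<forall>s\<in>K. factors_through fl s n) \<Longrightarrow>
      factors_through fl m n"
    by (simp_all only: is_union_def fl_sel) (blast dest: fl_mono_set)+
  let ?B = "\<Union>s\<in>K. rng s"
  let ?i = "(?B, \<lambda>x\<in>?B. x, A)" and ?e = "\<lambda>s. (sdom s, sfun s, ?B)"
  have sA: "s \<in> Arr fl" if "s \<in> K" for s using s [OF that] by (simp add: is_mono_def)
  then have ss: "s \<in> Arr set_cat" if "s \<in> K" for s using that fl_Arr_set by blast
  have iY: "?i \<in> Y \<and> (\<forall>s\<in>K. ?e s \<in> Y)" if g: "gen X Y" for X Y
    using replete_subcat.set_union [OF gen_replete [OF g], of A K] A(1,2) s sA g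
    unfolding fl_Obj fl_Arr by blast
  then have i: "?i \<in> Arr fl" "\<And>s. s \<in> K \<Longrightarrow> ?e s \<in> Arr fl"
    unfolding fl_Arr by blast+
  have "?B \<subseteq> A" using S.rng_subset ss s by blast
  then have isub: "is_mono set_cat ?i" "rng ?i = ?B"
    using S.inclusion_mono [of A ?B] by auto
  have "factors_through fl s ?i" if sK: "s \<in> K" for s
  proof -
    have "compose (sdom s) (\<lambda>x\<in>?B. x) (sfun s) = sfun s"
      using ss [OF sK] sK by (auto simp: compose_def rng_def fun_eq_iff Arr_set_cat PiE_def extensional_def)
    then have "Comp fl ?i (?e s) = s" using s [OF sK] by (auto simp: sdom_def sfun_def scod_def)
    then show ?thesis
      using i(2) [OF sK] unfolding factors_through_def by (intro bexI [of _ "?e s"]) (auto simp: hom_fl)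
  qed
  then have "factors_through fl m ?i"
    using min [of ?i] set_mono_fl [OF i(1) isub(1)] by simp
  then have "rng m \<subseteq> ?B"
    using fl_factors_set S.factors_through_iff [of m ?i] isub A(3,4) S.mono_iff [of m] by simp
  moreover have "rng s \<subseteq> rng m" if "s \<in> K" for s
    using fl_factors_set S.factors_through_iff [of s m] s [OF that] ss [OF that] A by auto
  ultimately have "rng m = ?B" by blast
  then show "is_union set_cat A K m"
    using A s sA fl_Obj by (simp add: S.union_iff)
qed

end
section \<open>Natural isomorphisms\<close>

lemma nat_iso_naturality:
  "nat_iso C D F G \<eta> \<Longrightarrow> f \<in> hom C A B \<Longrightarrow> Comp D (\<eta> B) (onArr F f) = Comp D (onArr G f) (\<eta> A)"
  by (auto simp: nat_iso_def hom_def)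

lemma nat_iso_refl:
  assumes "is_functor C D F"
  shows "nat_iso C D F F (\<lambda>x. Ident D (onObj F x))"
  unfolding nat_iso_def
proof (intro conjI ballI)
  have D: "category D" "\<And>x. x \<in> Obj C \<Longrightarrow> onObj F x \<in> Obj D"
    using assms by (auto simp: is_functor_def)
  show "Ident D (onObj F x) \<in> hom D (onObj F x) (onObj F x)" "is_iso D (Ident D (onObj F x))"
    if "x \<in> Obj C" for x
    using D that by (auto intro: Ident_hom is_iso_Ident)
  show "Comp D (Ident D (onObj F (Cod C f))) (onArr F f) = Comp D (onArr F f) (Ident D (onObj F (Dom C f)))"
    if "f \<in> Arr C" for f
    using Comp_Ident [OF D(1) functor_hom [OF assms hom_Arr [OF that]]] by simp
qed

lemma is_iso_Comp:
  assumes C: "category C" and f: "is_iso C f" "f \<in> hom C A B" and g: "is_iso C g" "g \<in> hom C B E"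
  shows "is_iso C (Comp C g f)"
proof -
  obtain f' where f': "f' \<in> hom C B A" "Comp C f' f = Ident C A" "Comp C f f' = Ident C B"
    by (rule is_iso_inverse [OF f(1)]) (use f(2) in \<open>auto simp: hom_def\<close>)
  obtain g' where g': "g' \<in> hom C E B" "Comp C g' g = Ident C B" "Comp C g g' = Ident C E"
    by (rule is_iso_inverse [OF g(1)]) (use g(2) in \<open>auto simp: hom_def\<close>)
  note h = Comp_hom [OF C f(2) g(2)] Comp_hom [OF C g'(1) f'(1)]
  have "Comp C (Comp C f' g') (Comp C g f) = Comp C f' (Comp C (Comp C g' g) f)"
    using Comp_assoc [OF C h(1) g'(1) f'(1)] Comp_assoc [OF C f(2) g(2) g'(1)] by simp
  then have 1: "Comp C (Comp C f' g') (Comp C g f) = Ident C A"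
    using f' g' Comp_Ident(2) [OF C f(2)] by simp
  have "Comp C (Comp C g f) (Comp C f' g') = Comp C g (Comp C (Comp C f f') g')"
    using Comp_assoc [OF C h(2) f(2) g(2)] Comp_assoc [OF C g'(1) f'(1) f(2)] by simp
  then have 2: "Comp C (Comp C g f) (Comp C f' g') = Ident C E"
    using f' g' Comp_Ident(2) [OF C g'(1)] by simp
  show ?thesis
    unfolding is_iso_def using h 1 2 by (auto simp: hom_def)
qed

lemma nat_iso_trans:
  assumes F: "is_functor C D F" and G: "is_functor C D G" and H: "is_functor C D H"
    and a: "nat_iso C D F G \<alpha>" and b: "nat_iso C D G H \<beta>"
  shows "nat_iso C D F H (\<lambda>x. Comp D (\<beta> x) (\<alpha> x))"
  unfolding nat_iso_def
proof (intro conjI ballI)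
  have D: "category D" using F by (simp add: is_functor_def)
  have a': "\<alpha> x \<in> hom D (onObj F x) (onObj G x) \<and> is_iso D (\<alpha> x)"
    and b': "\<beta> x \<in> hom D (onObj G x) (onObj H x) \<and> is_iso D (\<beta> x)" if "x \<in> Obj C" for x
    using a b that by (auto simp: nat_iso_def)
  show "Comp D (\<beta> x) (\<alpha> x) \<in> hom D (onObj F x) (onObj H x)" "is_iso D (Comp D (\<beta> x) (\<alpha> x))"
    if "x \<in> Obj C" for x
    using Comp_hom [OF D] is_iso_Comp [OF D] a' [OF that] b' [OF that] by blast+
  fix f assume f: "f \<in> Arr C"
  let ?x = "Dom C f" and ?y = "Cod C f"
  have o: "?x \<in> Obj C" "?y \<in> Obj C" using f F by (auto simp: is_functor_def category_def)
  have h: "onArr F f \<in> hom D (onObj F ?x) (onObj F ?y)" "onArr G f \<in> hom D (onObj G ?x) (onObj G ?y)"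
    "onArr H f \<in> hom D (onObj H ?x) (onObj H ?y)"
    using functor_hom [OF F hom_Arr [OF f]] functor_hom [OF G hom_Arr [OF f]]
      functor_hom [OF H hom_Arr [OF f]] by auto
  have na: "Comp D (\<alpha> ?y) (onArr F f) = Comp D (onArr G f) (\<alpha> ?x)"
    and nb: "Comp D (\<beta> ?y) (onArr G f) = Comp D (onArr H f) (\<beta> ?x)"
    using a b f unfolding nat_iso_def by blast+
  have "Comp D (Comp D (\<beta> ?y) (\<alpha> ?y)) (onArr F f) = Comp D (\<beta> ?y) (Comp D (onArr G f) (\<alpha> ?x))"
    using Comp_assoc [OF D h(1), where g = "\<alpha> ?y" and h = "\<beta> ?y"] a' [OF o(2)] b' [OF o(2)] na by metis
  also have "\<dots> = Comp D (Comp D (onArr H f) (\<beta> ?x)) (\<alpha> ?x)"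
    using Comp_assoc [OF D _ h(2), where f = "\<alpha> ?x" and h = "\<beta> ?y"] a' [OF o(1)] b' [OF o(2)] nb by metis
  also have "\<dots> = Comp D (onArr H f) (Comp D (\<beta> ?x) (\<alpha> ?x))"
    using Comp_assoc [OF D _ _ h(3), where f = "\<alpha> ?x" and g = "\<beta> ?x"] a' [OF o(1)] b' [OF o(1)] by metis
  finally show "Comp D (Comp D (\<beta> ?y) (\<alpha> ?y)) (onArr F f) =
      Comp D (onArr H f) (Comp D (\<beta> ?x) (\<alpha> ?x))" .
qed

lemma nat_iso_sym:
  assumes F: "is_functor C D F" and G: "is_functor C D G" and a: "nat_iso C D F G \<alpha>"
  shows "\<exists>\<beta>. nat_iso C D G F \<beta>"
proof -
  have D: "category D" using F by (simp add: is_functor_def)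
  have a': "\<alpha> x \<in> hom D (onObj F x) (onObj G x) \<and> is_iso D (\<alpha> x)" if "x \<in> Obj C" for x
    using a that by (auto simp: nat_iso_def)
  have "\<exists>g. is_iso D g \<and> g \<in> hom D (onObj G x) (onObj F x) \<and>
      Comp D g (\<alpha> x) = Ident D (onObj F x) \<and> Comp D (\<alpha> x) g = Ident D (onObj G x)"
    if "x \<in> Obj C" for x
  proof -
    have x: "is_iso D (\<alpha> x)" "Dom D (\<alpha> x) = onObj F x" "Cod D (\<alpha> x) = onObj G x"
      using a' [OF that] by (auto simp: hom_def)
    then show ?thesis using is_iso_inverse [OF x(1)] by metis
  qed
  then obtain \<beta> where b: "\<And>x. x \<in> Obj C \<Longrightarrow> is_iso D (\<beta> x) \<and> \<beta> x \<in> hom D (onObj G x) (onObj F x) \<and>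
      Comp D (\<beta> x) (\<alpha> x) = Ident D (onObj F x) \<and> Comp D (\<alpha> x) (\<beta> x) = Ident D (onObj G x)"
    by metis
  have "nat_iso C D G F \<beta>"
    unfolding nat_iso_def
  proof (intro conjI ballI)
    fix f assume f: "f \<in> Arr C"
    let ?x = "Dom C f" and ?y = "Cod C f"
    have o: "?x \<in> Obj C" "?y \<in> Obj C" using f F by (auto simp: is_functor_def category_def)
    have h: "onArr F f \<in> hom D (onObj F ?x) (onObj F ?y)" "onArr G f \<in> hom D (onObj G ?x) (onObj G ?y)"
      using functor_hom [OF F hom_Arr [OF f]] functor_hom [OF G hom_Arr [OF f]] by auto
    note bx = b [OF o(1)] and b_y = b [OF o(2)] and ax = a' [OF o(1)] and ay = a' [OF o(2)]
    have na: "Comp D (\<alpha> ?y) (onArr F f) = Comp D (onArr G f) (\<alpha> ?x)"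
      using a f unfolding nat_iso_def by blast
    have ids: "Comp D (\<beta> ?y) (\<alpha> ?y) = Ident D (onObj F ?y)" "Comp D (\<alpha> ?x) (\<beta> ?x) = Ident D (onObj G ?x)"
      and hs: "\<beta> ?x \<in> hom D (onObj G ?x) (onObj F ?x)" "\<beta> ?y \<in> hom D (onObj G ?y) (onObj F ?y)"
        "\<alpha> ?x \<in> hom D (onObj F ?x) (onObj G ?x)" "\<alpha> ?y \<in> hom D (onObj F ?y) (onObj G ?y)"
      using bx b_y ax ay by auto
    note h1 = Comp_hom [OF D hs(1) h(1)]
    have "Comp D (\<beta> ?y) (onArr G f) = Comp D (\<beta> ?y) (Comp D (onArr G f) (Comp D (\<alpha> ?x) (\<beta> ?x)))"
      by (simp only: ids Comp_Ident(1) [OF D h(2)])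
    also have "\<dots> = Comp D (\<beta> ?y) (Comp D (Comp D (\<alpha> ?y) (onArr F f)) (\<beta> ?x))"
      by (simp only: na Comp_assoc [OF D hs(1,3) h(2)])
    also have "\<dots> = Comp D (\<beta> ?y) (Comp D (\<alpha> ?y) (Comp D (onArr F f) (\<beta> ?x)))"
      by (simp only: Comp_assoc [OF D hs(1) h(1) hs(4)])
    also have "\<dots> = Comp D (onArr F f) (\<beta> ?x)"
      by (simp only: Comp_assoc [OF D h1 hs(4,2)] ids Comp_Ident(2) [OF D h1])
    finally show "Comp D (\<beta> ?y) (onArr G f) = Comp D (onArr F f) (\<beta> ?x)" .
  qed (use b in auto)
  then show ?thesis by blast
qed

section \<open>Finite sets labelled by a finite set\<close>

text \<open>The coded elements stand for \<open>K \<times> 's\<close>, with projections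
  \<open>lab\<close> and \<open>val\<close>. Coding is forced because \<open>G\<close> must have
  objects of type \<open>'s set\<close>, while the elements of \<open>K\<close> have a type of their
  own.\<close>

locale coding =
  fixes K :: "'k set" and enc :: "'k \<Rightarrow> 's \<Rightarrow> 's" and lab :: "'s \<Rightarrow> 'k" and val :: "'s \<Rightarrow> 's"
  assumes infinite_type: "infinite (UNIV :: 's set)" and finite_K: "finite K"
    and lab_enc [simp]: "\<And>k x. k \<in> K \<Longrightarrow> lab (enc k x) = k"
    and val_enc [simp]: "\<And>k x. k \<in> K \<Longrightarrow> val (enc k x) = x"
begin

definition U :: "'s set" where
  "U = (\<lambda>(k, x). enc k x) ` (K \<times> UNIV)"

lemma enc_U [simp]: "k \<in> K \<Longrightarrow> enc k x \<in> U"
  by (auto simp: U_def)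

lemma U_enc: "u \<in> U \<Longrightarrow> lab u \<in> K \<and> enc (lab u) (val u) = u"
  by (auto simp: U_def)

lemma U_eqI: "u \<in> U \<Longrightarrow> v \<in> U \<Longrightarrow> lab u = lab v \<Longrightarrow> val u = val v \<Longrightarrow> u = v"
  by (metis U_enc)

lemma lab_U: "lab ` U = K"
  by (auto simp: U_enc image_iff) (metis enc_U lab_enc)

sublocale finite_labelled U lab
proof
  show "finite (lab ` U)" by (simp add: lab_U finite_K)
  fix j assume "j \<in> lab ` U"
  then have j: "j \<in> K" by (simp add: lab_U)
  then have "inj (enc j)" by (metis injI val_enc)
  then have "infinite (range (enc j))" using infinite_type by (simp add: finite_image_iff)
  moreover have "range (enc j) \<subseteq> {x \<in> U. lab x = j}" using j by auto
  ultimately show "infinite {x \<in> U. lab x = j}" by (rule infinite_super [rotated])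
qed

text \<open>This is \<open>K \<times> A\<close> over \<open>K\<close>: one copy of \<open>A\<close>
  in each fibre.\<close>

definition copies :: "'s set \<Rightarrow> 's set" where
  "copies A = {u \<in> U. val u \<in> A}"

lemma copies_Ob: "finite A \<Longrightarrow> finite (copies A) \<and> copies A \<subseteq> U"
proof -
  assume "finite A"
  moreover have "copies A \<subseteq> (\<lambda>(k, x). enc k x) ` (K \<times> A)"
    by (force simp: copies_def dest: U_enc)
  ultimately show ?thesis
    using finite_K by (auto simp: copies_def intro: finite_subset)
qed

definition copy :: "'s sfunc" where
  "copy = \<lparr>onObj = copies,
     onArr = (\<lambda>h. (copies (sdom h), \<lambda>u\<in>copies (sdom h). enc (lab u) (sfun h (val u)), copies (scod h)))\<rparr>"

lemma copy_sel [simp]: "onObj copy A = copies A" "sdom (onArr copy h) = copies (sdom h)"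
    "scod (onArr copy h) = copies (scod h)"
  by (simp_all add: copy_def)

lemma copy_apply [simp]: "u \<in> copies (sdom h) \<Longrightarrow> sfun (onArr copy h) u = enc (lab u) (sfun h (val u))"
  by (simp add: copy_def)

lemma copy_hom:
  assumes "finite A" "finite B" "h \<in> hom set_cat A B"
  shows "onArr copy h \<in> hom C (copies A) (copies B)"
proof -
  have "enc (lab u) (sfun h (val u)) \<in> copies B \<and> lab (enc (lab u) (sfun h (val u))) = lab u"
    if "u \<in> copies A" for u
    using that assms(3) U_enc [of u] by (auto simp: copies_def hom_set_cat)
  then show ?thesis
    using assms copies_Ob by (simp add: hom_lcat hom_set_cat copy_def)
qed

lemma copy_mono:
  assumes "onArr copy m \<in> Arr C" "is_mono set_cat m"
  shows "is_mono C (onArr copy m)"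
  unfolding mono_iff
proof (intro conjI inj_onI)
  fix u v assume u: "u \<in> sdom (onArr copy m)" and v: "v \<in> sdom (onArr copy m)"
    and e: "sfun (onArr copy m) u = sfun (onArr copy m) v"
  then have U: "u \<in> U" "v \<in> U" "val u \<in> sdom m" "val v \<in> sdom m" by (auto simp: copies_def)
  have e': "enc (lab u) (sfun m (val u)) = enc (lab v) (sfun m (val v))" using e u v by simp
  have "lab u = lab v" using arg_cong [OF e', of lab] U U_enc by simp
  moreover have "sfun m (val u) = sfun m (val v)" using arg_cong [OF e', of val] U U_enc by simp
  then have "val u = val v" using U assms(2) by (auto simp: S.mono_iff dest: inj_onD)
  ultimately show "u = v" using U U_eqI by blast
qed (use assms in simp)

lemma copy_rng:
  assumes "m \<in> Arr set_cat"
  shows "rng (onArr copy m) = copies (rng m)"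
proof (intro equalityI subsetI)
  fix u assume "u \<in> rng (onArr copy m)"
  then show "u \<in> copies (rng m)" using U_enc by (auto simp: rng_def copies_def)
next
  fix u assume "u \<in> copies (rng m)"
  then obtain x where x: "u \<in> U" "x \<in> sdom m" "val u = sfun m x"
    by (auto simp: copies_def rng_def)
  then have "enc (lab u) x \<in> copies (sdom m)" "lab u \<in> K" using U_enc by (auto simp: copies_def)
  moreover from this have "sfun (onArr copy m) (enc (lab u) x) = u"
    using x U_enc [of u] by simp
  ultimately show "u \<in> rng (onArr copy m)" unfolding rng_def copy_sel by (metis imageI)
qed

text \<open>Within the fibre over \<open>j\<close>, \<open>val\<close> and \<open>enc j\<close>
  identify the copied diagram with the original one. Limits, images and unions are therefore
  compared label by label with those of Set, where \<open>incl\<close> has already placed those of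
  \<open>E\<close>.\<close>

lemma copy_coherent:
  assumes incl: "coherent_functor E set_cat id_func" and fin: "\<And>A. A \<in> Obj E \<Longrightarrow> finite A"
  shows "coherent_functor E C copy"
proof -
  have I: "is_functor E set_cat id_func" using incl by (rule coherent_functor_functor)
  have E: "category E" using I by (simp add: is_functor_def)
  have hom: "f \<in> hom set_cat A B" if "f \<in> hom E A B" for f A B
    using functor_hom [OF I that] by simp
  have hom_obj: "finite A \<and> finite B" if "f \<in> hom E A B" for f A B
    using that E fin by (auto simp: hom_def category_def)
  have copy_hom': "onArr copy f \<in> hom C (copies A) (copies B)" if "f \<in> hom E A B" for f A B
    using hom_obj [OF that] by (intro copy_hom [OF _ _ hom [OF that]]) simp_all
  have F: "is_functor E C copy"
    unfolding is_functor_def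
  proof (intro conjI ballI impI)
    show "category E" "category C" by (fact E, rule category_lcat)
    show "onObj copy A \<in> Obj C" if "A \<in> Obj E" for A
      using copies_Ob [OF fin [OF that]] by simp
    show "onArr copy f \<in> hom C (onObj copy (Dom E f)) (onObj copy (Cod E f))" if "f \<in> Arr E" for f
      using copy_hom' [OF hom_Arr [OF that]] by simp
    show "onArr copy (Ident E A) = Ident C (onObj copy A)" if "A \<in> Obj E" for A
    proof -
      have "Ident E A = Ident set_cat A" using I that by (simp add: is_functor_def)
      then show ?thesis by (auto simp: copy_def copies_def U_enc fun_eq_iff)
    qed
    fix f g assume "f \<in> Arr E" "g \<in> Arr E" and fg: "Cod E f = Dom E g"
    then have h: "f \<in> hom E (Dom E f) (Dom E g)" "g \<in> hom E (Dom E g) (Cod E g)"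
      by (auto simp: hom_def)
    have c: "Comp E g f = Comp set_cat g f" using functor_Comp [OF I h] by simp
    show "onArr copy (Comp E g f) = Comp C (onArr copy g) (onArr copy f)"
    proof (rule arr_eqI)
      show "onArr copy (Comp E g f) \<in> hom C (copies (Dom E f)) (copies (Cod E g))"
        by (rule copy_hom' [OF Comp_hom [OF E h]])
      show "Comp C (onArr copy g) (onArr copy f) \<in> hom C (copies (Dom E f)) (copies (Cod E g))"
        by (rule comp_lcat [OF copy_hom' copy_hom']) (fact h)+
      fix u assume u: "u \<in> copies (Dom E f)"
      have fs: "sdom f = Dom E f" "sfun f \<in> Dom E f \<rightarrow>\<^sub>E Dom E g" "sdom g = Dom E g"
        using hom [OF h(1)] hom [OF h(2)] by (auto simp: hom_set_cat)
      have "enc (lab u) (sfun f (val u)) \<in> copies (sdom g)" "lab u \<in> K"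
        using u fs U_enc by (auto simp: copies_def)
      then show "sfun (onArr copy (Comp E g f)) u = sfun (Comp C (onArr copy g) (onArr copy f)) u"
        using u fs by (simp add: c compose_def) (simp add: copies_def)
    qed
  qed
  have mono: "is_mono C (onArr copy m)" if "m \<in> Arr E" "is_mono set_cat m" for m
    using copy_mono copy_hom' [OF hom_Arr [OF that(1)]] that(2) by (simp add: hom_def)
  show ?thesis
    unfolding coherent_functor_def
  proof (intro conjI allI impI)
    show "is_functor E C copy" by (fact F)
  next
    fix d L p assume a: "finite_diagram E d \<and> is_limit E d L p"
    then have d: "finite_diagram E d" and L: "is_limit E d L p" by auto
    have Ls: "is_limit set_cat d L p"
      using coherent_functor_limit [OF incl d L] by simp
    have ds: "finite_diagram set_cat d" using finite_diagram_map [OF I d] by simp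
    have dG: "finite_diagram C (map_diagram copy d)" by (rule finite_diagram_map [OF F d])
    have p: "p i \<in> hom E L (dobj d i)" if "i \<in> verts d" for i
      using L that by (simp add: is_limit_def is_cone_def)
    have ps: "sdom (p i) = L" "sfun (p i) \<in> L \<rightarrow>\<^sub>E dobj d i" if "i \<in> verts d" for i
      using hom [OF p [OF that]] by (auto simp: hom_set_cat)
    have de: "sdom (darr d e) = dobj d (esrc d e)" "esrc d e \<in> verts d" "etgt d e \<in> verts d"
      if "e \<in> edges d" for e
      using ds that by (auto simp: finite_diagram_def hom_set_cat)
    have Lf: "finite L" using L fin by (auto simp: is_limit_def is_cone_def)
    have fam: "family (\<lambda>_. ()) d () (\<lambda>i. sfun (p i) l)" if "l \<in> L" for l
      using Ls that by (simp add: is_limit_def S.cone_iff [OF ds])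
    have cone: "is_cone C (map_diagram copy d) (copies L) (onArr copy \<circ> p)"
      unfolding cone_iff [OF dG]
    proof (intro conjI ballI)
      show "copies L \<in> {A. finite A \<and> A \<subseteq> U}" using copies_Ob [OF Lf] by simp
      show "(onArr copy \<circ> p) i \<in> hom C (copies L) (dobj (map_diagram copy d) i)"
        if "i \<in> verts (map_diagram copy d)" for i
        using copy_hom' [OF p] that by simp
      fix l assume l: "l \<in> copies L"
      then have lU: "lab l \<in> K" "val l \<in> L" using U_enc by (auto simp: copies_def)
      have m: "enc (lab l) (sfun (p i) (val l)) \<in> copies (dobj d i)" if "i \<in> verts d" for i
        using ps [OF that] lU by (auto simp: copies_def)
      show "family lab (map_diagram copy d) (lab l) (\<lambda>i. sfun ((onArr copy \<circ> p) i) l)"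
        unfolding family_def
      proof (intro conjI ballI)
        fix i assume "i \<in> verts (map_diagram copy d)"
        then show "sfun ((onArr copy \<circ> p) i) l \<in> dobj (map_diagram copy d) i"
          "lab (sfun ((onArr copy \<circ> p) i) l) = lab l"
          using m [of i] ps l lU by simp_all
      next
        fix e assume e': "e \<in> edges (map_diagram copy d)"
        then have e: "e \<in> edges d" by simp
        have "sfun (darr d e) (sfun (p (esrc d e)) (val l)) = sfun (p (etgt d e)) (val l)"
          using fam [OF lU(2)] e by (simp add: family_def)
        then show "sfun (darr (map_diagram copy d) e)
            (sfun ((onArr copy \<circ> p) (esrc (map_diagram copy d) e)) l) =
            sfun ((onArr copy \<circ> p) (etgt (map_diagram copy d) e)) l"
          using de [OF e] ps l lU m by simp
      qed
    qed
    show "is_limit C (map_diagram copy d) (onObj copy L) (onArr copy \<circ> p)"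
      unfolding limit_iff [OF dG] Union_Ob lab_U copy_sel
    proof (intro conjI ballI allI impI)
      show "is_cone C (map_diagram copy d) (copies L) (onArr copy \<circ> p)" by (fact cone)
      fix j x assume j: "j \<in> K" and x: "family lab (map_diagram copy d) j x"
      have xi: "x i \<in> U" "val (x i) \<in> dobj d i" "lab (x i) = j" "x i \<in> copies (dobj d i)"
        if "i \<in> verts d" for i
        using x that by (auto simp: family_def copies_def)
      have "family (\<lambda>_. ()) d () (val \<circ> x)"
        unfolding family_set
      proof (intro conjI ballI)
        fix e assume e: "e \<in> edges d"
        then have "sfun (onArr copy (darr d e)) (x (esrc d e)) = x (etgt d e)"
          using x by (simp add: family_def)
        then have "enc j (sfun (darr d e) (val (x (esrc d e)))) = x (etgt d e)"
          using xi [OF de(2) [OF e]] de(1) [OF e] by simp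
        from arg_cong [OF this, of val]
        show "sfun (darr d e) ((val \<circ> x) (esrc d e)) = (val \<circ> x) (etgt d e)"
          using j by simp
      qed (use xi in auto)
      then have ex: "\<exists>!l. l \<in> L \<and> (\<forall>i\<in>verts d. sfun (p i) l = val (x i))"
        using Ls unfolding limit_set_iff [OF ds] comp_def by blast
      \<comment> \<open>Over the label \<open>j\<close>, the condition on an element of the copied
        apex becomes the condition on its \<open>val\<close> in Set.\<close>
      have eq: "l \<in> copies L \<and> lab l = j \<and>
            (\<forall>i\<in>verts (map_diagram copy d). sfun ((onArr copy \<circ> p) i) l = x i) \<longleftrightarrow>
          l \<in> U \<and> lab l = j \<and> val l \<in> L \<and> (\<forall>i\<in>verts d. sfun (p i) (val l) = val (x i))" for l
      proof -
        have "sfun ((onArr copy \<circ> p) i) l = x i \<longleftrightarrow> sfun (p i) (val l) = val (x i)"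
          if i: "i \<in> verts d" and l: "l \<in> copies L" "lab l = j" for i
        proof -
          have "sfun ((onArr copy \<circ> p) i) l = enc j (sfun (p i) (val l))"
            using ps(1) [OF i] l by simp
          moreover have "x i = enc j (val (x i))" using U_enc xi [OF i] by metis
          ultimately show ?thesis using val_enc [OF j] by metis
        qed
        then show ?thesis by (auto simp: copies_def)
      qed
      show "\<exists>!l. l \<in> copies L \<and> lab l = j \<and>
          (\<forall>i\<in>verts (map_diagram copy d). sfun ((onArr copy \<circ> p) i) l = x i)"
        unfolding eq
      proof (rule ex_ex1I)
        from ex obtain l where "l \<in> L \<and> (\<forall>i\<in>verts d. sfun (p i) l = val (x i))" by blast
        then show "\<exists>l. l \<in> U \<and> lab l = j \<and> val l \<in> L \<and> (\<forall>i\<in>verts d. sfun (p i) (val l) = val (x i))"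
          using j by (intro exI [of _ "enc j l"]) simp
      next
        fix l l' assume l: "l \<in> U \<and> lab l = j \<and> val l \<in> L \<and> (\<forall>i\<in>verts d. sfun (p i) (val l) = val (x i))"
          and l': "l' \<in> U \<and> lab l' = j \<and> val l' \<in> L \<and> (\<forall>i\<in>verts d. sfun (p i) (val l') = val (x i))"
        then have "val l = val l'" using ex by blast
        then show "l = l'" using l l' U_eqI by metis
      qed
    qed
  next
    fix f m assume a: "is_image E f m"
    then have ar: "f \<in> Arr E" "m \<in> Arr E" by (auto simp: is_image_def is_mono_def)
    have s: "is_image set_cat f m" using coherent_functor_image [OF incl a] by simp
    then show "is_image C (onArr copy f) (onArr copy m)"
      using mono [OF ar(2)] copy_hom' [OF hom_Arr [OF ar(1)]]
      by (auto simp: image_iff S.image_iff S.mono_iff copy_rng hom_def)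
  next
    fix A J m assume a: "finite J \<and> is_union E A J m"
    then have ar: "A \<in> Obj E" "m \<in> Arr E" "\<And>s. s \<in> J \<Longrightarrow> s \<in> Arr E"
      by (auto simp: is_union_def is_mono_def)
    have s: "is_union set_cat A J m" using coherent_functor_union [OF incl, of J A m] a by simp
    have "copies (\<Union>s\<in>J. rng s) = (\<Union>s\<in>J. copies (rng s))" by (auto simp: copies_def)
    then show "is_union C (onObj copy A) (onArr copy ` J) (onArr copy m)"
      using s mono ar copies_Ob [OF fin [OF ar(1)]]
      by (simp add: union_iff S.union_iff S.mono_iff copy_rng)
  qed
qed

section \<open>The fibre functors, which are the models belonging to the labels\<close>

definition fib :: "'k \<Rightarrow> 's set \<Rightarrow> 's set" where
  "fib k A = {x \<in> A. lab x = k}"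

definition ev :: "'k \<Rightarrow> 's sfunc" where
  "ev k = \<lparr>onObj = fib k, onArr = (\<lambda>h. (fib k (sdom h), \<lambda>x\<in>fib k (sdom h). sfun h x, fib k (scod h)))\<rparr>"

lemma ev_sel [simp]: "onObj (ev k) A = fib k A" "sdom (onArr (ev k) h) = fib k (sdom h)"
    "scod (onArr (ev k) h) = fib k (scod h)"
  by (simp_all add: ev_def)

lemma ev_apply [simp]: "x \<in> fib k (sdom h) \<Longrightarrow> sfun (onArr (ev k) h) x = sfun h x"
  by (simp add: ev_def)

lemma ev_hom: "h \<in> hom C A B \<Longrightarrow> onArr (ev k) h \<in> hom set_cat (fib k A) (fib k B)"
  by (auto simp: hom_lcat hom_set_cat ev_def fib_def)

lemma ev_mono: "is_mono C m \<Longrightarrow> is_mono set_cat (onArr (ev k) m)"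
  using ev_hom [of m "sdom m" "scod m" k]
  by (auto simp: mono_iff S.mono_iff hom_def inj_on_def fib_def)

lemma ev_rng: "m \<in> Arr C \<Longrightarrow> rng (onArr (ev k) m) = fib k (rng m)"
  by (force simp: rng_def fib_def Arr_lcat)

text \<open>By \<open>limit_iff\<close> a limit in \<open>G\<close> is a limit in every occurring
  fibre, and \<open>lab_U\<close> says that each \<open>k \<in> K\<close> occurs. Images and unions
  are given by ranges, and passing to a fibre commutes with ranges because arrows keep
  labels.\<close>

lemma ev_coherent:
  assumes k: "k \<in> K"
  shows "coherent_functor C set_cat (ev k)"
proof -
  have F: "is_functor C set_cat (ev k)"
    unfolding is_functor_def
  proof (intro conjI ballI impI)
    show "category C" "category set_cat" by (rule category_lcat, rule category_set_cat)
    show "onArr (ev k) f \<in> hom set_cat (onObj (ev k) (Dom C f)) (onObj (ev k) (Cod C f))"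
      if "f \<in> Arr C" for f using ev_hom [OF hom_Arr [OF that]] by simp
    show "onArr (ev k) (Ident C A) = Ident set_cat (onObj (ev k) A)" for A
      by (auto simp: ev_def fib_def fun_eq_iff)
    fix f g assume "f \<in> Arr C" "g \<in> Arr C" "Cod C f = Dom C g"
    then show "onArr (ev k) (Comp C g f) = Comp set_cat (onArr (ev k) g) (onArr (ev k) f)"
      by (auto simp: ev_def fib_def fun_eq_iff Arr_lcat compose_def)
  qed simp
  show ?thesis
    unfolding coherent_functor_def
  proof (intro conjI allI impI)
    show "is_functor C set_cat (ev k)" by (fact F)
  next
    fix d L p assume a: "finite_diagram C d \<and> is_limit C d L p"
    then have d: "finite_diagram C d" and L: "is_limit C d L p" by auto
    have ds: "finite_diagram set_cat (map_diagram (ev k) d)" by (rule finite_diagram_map [OF F d])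
    have cone: "is_cone C d L p" using L by (simp add: is_limit_def)
    then have p: "p i \<in> hom C L (dobj d i)" if "i \<in> verts d" for i
      using that by (simp add: is_cone_def)
    then have ps: "sdom (p i) = L" if "i \<in> verts d" for i
      using that by (auto simp: hom_lcat)
    have de: "sdom (darr d e) = dobj d (esrc d e)" "esrc d e \<in> verts d" "etgt d e \<in> verts d"
      if "e \<in> edges d" for e
      using d that by (auto simp: finite_diagram_def hom_lcat)
    have fam: "family (\<lambda>_. ()) (map_diagram (ev k) d) () x \<longleftrightarrow> family lab d k x" for x
      using de by (auto simp: family_def fib_def)
    have fam_p: "family (\<lambda>_. ()) (map_diagram (ev k) d) () (\<lambda>i. sfun ((onArr (ev k) \<circ> p) i) l) \<longleftrightarrow>
        family (\<lambda>_. ()) (map_diagram (ev k) d) () (\<lambda>i. sfun (p i) l)" if "l \<in> fib k L" for l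
      using that ps de by (simp add: family_def)
    show "is_limit set_cat (map_diagram (ev k) d) (onObj (ev k) L) (onArr (ev k) \<circ> p)"
      unfolding limit_set_iff [OF ds] ev_sel S.cone_iff [OF ds]
    proof (intro conjI ballI allI impI)
      show "(onArr (ev k) \<circ> p) i \<in> hom set_cat (fib k L) (dobj (map_diagram (ev k) d) i)"
        if "i \<in> verts (map_diagram (ev k) d)" for i
        using ev_hom [OF p] that by simp
      show "family (\<lambda>_. ()) (map_diagram (ev k) d) () (\<lambda>i. sfun ((onArr (ev k) \<circ> p) i) l)"
        if "l \<in> fib k L" for l
        using that cone unfolding fam_p [OF that] fam by (auto simp: cone_iff [OF d] fib_def)
      fix x assume "family (\<lambda>_. ()) (map_diagram (ev k) d) () x"
      then have "\<exists>!l. l \<in> L \<and> lab l = k \<and> (\<forall>i\<in>verts d. sfun (p i) l = x i)"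
        using L k by (simp add: fam limit_iff [OF d] Union_Ob lab_U)
      moreover have "l \<in> L \<and> lab l = k \<and> (\<forall>i\<in>verts d. sfun (p i) l = x i) \<longleftrightarrow> l \<in> fib k L \<and>
          (\<forall>i\<in>verts (map_diagram (ev k) d). sfun ((onArr (ev k) \<circ> p) i) l = x i)" for l
      proof -
        have "sfun ((onArr (ev k) \<circ> p) i) l = sfun (p i) l" if "i \<in> verts d" "l \<in> fib k L" for i
          using that ps by simp
        then show ?thesis by (auto simp: fib_def)
      qed
      ultimately show "\<exists>!l. l \<in> fib k L \<and>
          (\<forall>i\<in>verts (map_diagram (ev k) d). sfun ((onArr (ev k) \<circ> p) i) l = x i)"
        by simp
    qed simp
  next
    fix f m assume a: "is_image C f m"
    then have "f \<in> Arr C" "m \<in> Arr C" by (auto simp: is_image_def is_mono_def)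
    then show "is_image set_cat (onArr (ev k) f) (onArr (ev k) m)"
      using a ev_mono ev_hom [OF hom_Arr]
      by (auto simp: image_iff S.image_iff ev_rng hom_def)
  next
    fix A J m assume a: "finite J \<and> is_union C A J m"
    then have ar: "m \<in> Arr C" "\<And>s. s \<in> J \<Longrightarrow> s \<in> Arr C"
      by (auto simp: is_union_def is_mono_def)
    have "fib k (\<Union>s\<in>J. rng s) = (\<Union>s\<in>J. fib k (rng s))" by (auto simp: fib_def)
    then show "is_union set_cat (onObj (ev k) A) (onArr (ev k) ` J) (onArr (ev k) m)"
      using a ev_mono ar by (simp add: union_iff S.union_iff ev_rng)
  qed
qed

end

section \<open>Models of the category of labelled finite sets\<close>

lemma set_hom_mem: "h \<in> hom set_cat A B \<Longrightarrow> x \<in> A \<Longrightarrow> sfun h x \<in> B"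
  by (auto simp: hom_set_cat)

locale model = coding K enc lab val
  for K :: "'k set" and enc :: "'k \<Rightarrow> 's \<Rightarrow> 's" and lab and val +
  fixes M :: "'s sfunc"
  assumes coherent_M: "coherent_functor C set_cat M"
begin

lemma functor_M: "is_functor C set_cat M"
  using coherent_M by (rule coherent_functor_functor)

lemma M_hom: "h \<in> hom C A B \<Longrightarrow> onArr M h \<in> hom set_cat (onObj M A) (onObj M B)"
  by (rule functor_hom [OF functor_M])

lemma M_Comp:
  assumes "f \<in> hom C A B" "g \<in> hom C B E" "u \<in> onObj M A"
  shows "sfun (onArr M (Comp C g f)) u = sfun (onArr M g) (sfun (onArr M f) u)"
  unfolding functor_Comp [OF functor_M assms(1,2)]
  by (rule sfun_Comp [OF M_hom [OF assms(1)] assms(3)])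

text \<open>The empty set is the union of no subobjects of itself, and \<open>M\<close> preserves
  this union.\<close>

lemma M_empty: "onObj M {} = {}"
proof -
  have "is_union C {} {} (Ident C {})"
    by (auto simp: union_iff mono_iff Arr_lcat rng_def)
  then have "is_union set_cat (onObj M {}) (onArr M ` {}) (onArr M (Ident C {}))"
    by (intro coherent_functor_union [OF coherent_M]) auto
  then have "rng (onArr M (Ident C {})) = {}" by (simp add: S.union_iff)
  moreover have "{} \<in> Obj C" by simp
  then have "onArr M (Ident C {}) = Ident set_cat (onObj M {})"
    using functor_M unfolding is_functor_def by blast
  ultimately show ?thesis by (simp add: rng_def)
qed

definition point :: "'s \<Rightarrow> 's set \<Rightarrow> 's sarr" where
  "point x A = ({x}, \<lambda>x\<in>{x}. x, A)"

lemma point_hom: "finite A \<Longrightarrow> A \<subseteq> U \<Longrightarrow> x \<in> A \<Longrightarrow> point x A \<in> hom C {x} A"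
  by (auto simp: point_def hom_lcat)

lemma sfun_point [simp]: "sfun (point x A) x = x"
  by (simp add: point_def)

text \<open>A finite set is the union of its points. As \<open>M\<close> preserves finite unions,
  the images of the points under \<open>M\<close> cover \<open>onObj M A\<close>.\<close>

lemma M_points:
  assumes A: "finite A" "A \<subseteq> U" and u: "u \<in> onObj M A"
  obtains x v where "x \<in> A" "v \<in> onObj M {x}" "u = sfun (onArr M (point x A)) v"
proof -
  have AO: "A \<in> Obj C" using A by simp
  have p: "is_mono C (point x A)" "rng (point x A) = {x}" "scod (point x A) = A" if "x \<in> A" for x
    using inclusion_mono [of A "{x}"] A that by (auto simp: point_def)
  have "is_mono C (Ident C A)" "rng (Ident C A) = A"
    using inclusion_mono [of A A] A by auto
  then have "is_union C A ((\<lambda>x. point x A) ` A) (Ident C A)"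
    using p A unfolding union_iff by auto
  then have "is_union set_cat (onObj M A) (onArr M ` (\<lambda>x. point x A) ` A) (onArr M (Ident C A))"
    using A by (intro coherent_functor_union [OF coherent_M]) auto
  then have r: "rng (onArr M (Ident C A)) = (\<Union>x\<in>A. rng (onArr M (point x A)))"
    by (simp add: S.union_iff)
  moreover have "onArr M (Ident C A) = Ident set_cat (onObj M A)"
    using functor_M AO unfolding is_functor_def by blast
  ultimately have "u \<in> (\<Union>x\<in>A. rng (onArr M (point x A)))"
    using u by (simp add: rng_def)
  then obtain x where x: "x \<in> A" "u \<in> rng (onArr M (point x A))" by blast
  moreover have "sdom (onArr M (point x A)) = onObj M {x}"
    using M_hom [OF point_hom [OF A x(1)]] by (simp add: hom_set_cat)
  ultimately show thesis using that by (auto simp: rng_def)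
qed

text \<open>Two distinct points of \<open>B\<close> have an empty pullback, which \<open>M\<close> preserves.\<close>

lemma M_disjoint:
  assumes m: "m \<in> hom C {x} B" and n: "n \<in> hom C {y} B" and ne: "sfun m x \<noteq> sfun n y"
    and u: "u \<in> onObj M {x}" and v: "v \<in> onObj M {y}"
  shows "sfun (onArr M m) u \<noteq> sfun (onArr M n) v"
proof
  assume eq: "sfun (onArr M m) u = sfun (onArr M n) v"
  have mn: "sdom m = {x}" "sdom n = {y}" "scod m = B" "scod n = B" "m \<in> Arr C" "n \<in> Arr C"
    using m n by (auto simp: hom_def)
  let ?d = "cospan m n"
  have d: "finite_diagram C ?d"
    using mn category_lcat by (intro finite_diagram_cospan) auto
  have ds: "finite_diagram set_cat (map_diagram M ?d)" by (rule finite_diagram_map [OF functor_M d])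
  let ?p = "\<lambda>i. ({}, \<lambda>_\<in>{}. undefined, dobj ?d i)"
  have "\<not> family lab ?d j z" for j z
    using ne mn by (auto simp: family_def cospan_def)
  moreover have "is_cone C ?d {} ?p"
    using d unfolding cone_iff [OF d] by (auto simp: hom_lcat finite_diagram_def)
  ultimately have "is_limit C ?d {} ?p" by (simp add: limit_iff [OF d])
  then have "is_limit set_cat (map_diagram M ?d) {} (onArr M \<circ> ?p)"
    using coherent_functor_limit [OF coherent_M d, of "{}" ?p] unfolding M_empty by blast
  moreover have "family (\<lambda>_. ()) (map_diagram M ?d) ()
      (\<lambda>i. if i = 0 then u else if i = 1 then v else sfun (onArr M m) u)"
    using mn u v eq set_hom_mem [OF M_hom [OF m] u] unfolding family_set
    by (auto simp: cospan_def)
  ultimately show False unfolding limit_set_iff [OF ds] by blast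
qed

text \<open>A mono is its own image, and coherent functors preserve images.\<close>

lemma M_mono:
  assumes "is_mono C m"
  shows "inj_on (sfun (onArr M m)) (onObj M (sdom m))"
proof -
  have m: "m \<in> Arr C" using assms by (simp add: mono_iff)
  have "is_image C m m" using assms m by (simp add: image_iff)
  then have "is_image set_cat (onArr M m) (onArr M m)"
    by (rule coherent_functor_image [OF coherent_M])
  then have "is_mono set_cat (onArr M m)" by (simp add: S.image_iff)
  then show ?thesis using M_hom [OF hom_Arr [OF m]] by (simp add: S.mono_iff hom_set_cat)
qed

text \<open>An arbitrary element \<open>z0\<close> gives a terminal object \<open>T\<close> of
  \<open>G\<close>, with one point over each label.\<close>

abbreviation "z0 \<equiv> undefined :: 's"
abbreviation "T \<equiv> copies {z0}"

lemma T_Ob: "finite T" "T \<subseteq> U"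
  using copies_Ob [of "{z0}"] by auto

text \<open>\<open>T\<close> is a limit of the empty diagram, since \<open>limit_iff\<close> then
  asks for exactly one point over each label.\<close>

lemma M_T: "\<exists>!t. t \<in> onObj M T"
proof -
  let ?d = "\<lparr>verts = {}, edges = {}, esrc = id, etgt = id, dobj = \<lambda>_. {}, darr = \<lambda>_. undefined\<rparr>
    :: ('s set, 's sarr) diag"
  let ?p = "\<lambda>_. undefined :: 's sarr"
  have d: "finite_diagram C ?d" by (simp add: finite_diagram_def)
  have ds: "finite_diagram set_cat (map_diagram M ?d)" by (rule finite_diagram_map [OF functor_M d])
  have "\<exists>!l. l \<in> T \<and> lab l = j" if "j \<in> K" for j
  proof (rule ex1I)
    show "enc j z0 \<in> T \<and> lab (enc j z0) = j" using that by (simp add: copies_def)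
    show "l = enc j z0" if "l \<in> T \<and> lab l = j" for l
      using that U_enc [of l] by (auto simp: copies_def)
  qed
  then have "is_limit C ?d T ?p"
    using T_Ob by (simp add: limit_iff [OF d] Union_Ob lab_U cone_iff [OF d] family_def)
  then have "is_limit set_cat (map_diagram M ?d) (onObj M T) (onArr M \<circ> ?p)"
    by (rule coherent_functor_limit [OF coherent_M d])
  then show ?thesis
    by (simp add: limit_set_iff [OF ds] family_def)
qed

definition bang :: "'s \<Rightarrow> 's sarr" where
  "bang x = ({x}, \<lambda>x\<in>{x}. enc (lab x) z0, T)"

lemma bang_hom: "x \<in> U \<Longrightarrow> bang x \<in> hom C {x} T"
  using T_Ob U_enc [of x] by (auto simp: bang_def hom_lcat copies_def)

text \<open>The arrow from \<open>{x}\<close> to the terminal object is injective because its domain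
  is a singleton. Hence \<open>onObj M {x}\<close> embeds in the one-element set
  \<open>onObj M T\<close>.\<close>

lemma M_singleton_unique:
  assumes x: "x \<in> U" and u: "u \<in> onObj M {x}" and v: "v \<in> onObj M {x}"
  shows "u = v"
proof -
  have "bang x \<in> Arr C" "sdom (bang x) = {x}" using bang_hom [OF x] by (auto simp: hom_def)
  then have "is_mono C (bang x)" by (simp add: mono_iff)
  then have "inj_on (sfun (onArr M (bang x))) (onObj M {x})"
    using M_mono [of "bang x"] \<open>sdom (bang x) = {x}\<close> by simp
  moreover have "sfun (onArr M (bang x)) u = sfun (onArr M (bang x)) v"
    using M_T set_hom_mem [OF M_hom [OF bang_hom [OF x]]] u v by blast
  ultimately show ?thesis using u v by (auto dest: inj_onD)
qed

text \<open>The single element of \<open>onObj M T\<close> comes from a point \<open>w\<close> of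
  \<open>T\<close>, whose label is the one sought. An arrow from \<open>{w}\<close> reaches every
  \<open>{x}\<close> with that label; an inhabited \<open>{x}\<close> with another label would
  produce, by \<open>M_disjoint\<close>, a second element of \<open>onObj M T\<close>.\<close>

lemma M_label_ex:
  "\<exists>k\<in>K. \<forall>x\<in>U. onObj M {x} \<noteq> {} \<longleftrightarrow> lab x = k"
proof -
  obtain t where "t \<in> onObj M T" using M_T by blast
  then obtain w v where w: "w \<in> T" and v: "v \<in> onObj M {w}"
    by (rule M_points [OF T_Ob])
  have wU: "w \<in> U" using w by (simp add: copies_def)
  have "onObj M {x} \<noteq> {} \<longleftrightarrow> lab x = lab w" if x: "x \<in> U" for x
  proof
    assume "lab x = lab w"
    then have "({w}, \<lambda>_\<in>{w}. x, {x}) \<in> hom C {w} {x}"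
      using x wU by (auto simp: hom_lcat)
    then show "onObj M {x} \<noteq> {}" using set_hom_mem [OF M_hom v] by blast
  next
    assume "onObj M {x} \<noteq> {}"
    then obtain u where u: "u \<in> onObj M {x}" by blast
    show "lab x = lab w"
    proof (rule ccontr)
      assume "lab x \<noteq> lab w"
      then have "enc (lab x) z0 \<noteq> enc (lab w) z0" using U_enc x wU by (metis lab_enc)
      then have "sfun (bang x) x \<noteq> sfun (bang w) w" by (simp add: bang_def)
      from M_disjoint [OF bang_hom [OF x] bang_hom [OF wU] this u v] show False
        using M_T set_hom_mem [OF M_hom [OF bang_hom [OF x]] u]
          set_hom_mem [OF M_hom [OF bang_hom [OF wU]] v] by blast
    qed
  qed
  then show ?thesis using U_enc [OF wU] by blast
qed

end

context coding
begin

definition label :: "'s sfunc \<Rightarrow> 'k" where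
  "label M = (SOME k. k \<in> K \<and> (\<forall>x\<in>U. onObj M {x} \<noteq> {} \<longleftrightarrow> lab x = k))"

lemma model: "coherent_functor C set_cat M \<Longrightarrow> model K enc lab val M"
  by (simp add: model_def model_axioms_def coding_axioms)

lemma label:
  assumes "coherent_functor C set_cat M"
  shows "label M \<in> K" "\<And>x. x \<in> U \<Longrightarrow> onObj M {x} \<noteq> {} \<longleftrightarrow> lab x = label M"
proof -
  interpret model K enc lab val M by (rule model [OF assms])
  have "label M \<in> K \<and> (\<forall>x\<in>U. onObj M {x} \<noteq> {} \<longleftrightarrow> lab x = label M)"
    unfolding label_def by (rule someI_ex) (use M_label_ex in blast)
  then show "label M \<in> K" "\<And>x. x \<in> U \<Longrightarrow> onObj M {x} \<noteq> {} \<longleftrightarrow> lab x = label M"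
    by auto
qed

lemma label_eqI:
  assumes M: "coherent_functor C set_cat M" and k: "k \<in> K" and ne: "onObj M {enc k x} \<noteq> {}"
  shows "label M = k"
  using label(2) [OF M, of "enc k x"] ne k by simp

lemma label_ev: "k \<in> K \<Longrightarrow> label (ev k) = k"
  by (rule label_eqI [OF ev_coherent, of _ _ undefined]) (simp_all add: fib_def)

text \<open>An element \<open>x\<close> of the fibre corresponds to the image of the only element
  \<open>star x\<close> of \<open>onObj M {x}\<close> under the inclusion of \<open>{x}\<close>.
  \<open>M_disjoint\<close> makes this injective, \<open>M_points\<close> surjective, and naturality
  comes from the uniqueness of \<open>star\<close>.\<close>

lemma nat_iso_ev:
  assumes M: "coherent_functor C set_cat M"
  shows "\<exists>\<mu>. nat_iso C set_cat (ev (label M)) M \<mu>"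
proof -
  interpret model K enc lab val M by (rule model [OF M])
  let ?k = "label M"
  define star where "star x = (SOME u. u \<in> onObj M {x})" for x
  have star: "star x \<in> onObj M {x}" if "x \<in> U" "lab x = ?k" for x
    unfolding star_def some_in_eq using label(2) [OF M that(1)] that(2) by simp
  let ?\<mu> = "\<lambda>A. (fib ?k A, \<lambda>x\<in>fib ?k A. sfun (onArr M (point x A)) (star x), onObj M A)"
  have in_U: "x \<in> U" "lab x = ?k" "x \<in> A" if "A \<in> Obj C" "x \<in> fib ?k A" for x A
    using that by (auto simp: fib_def)
  have mem: "sfun (onArr M (point x A)) (star x) \<in> onObj M A" if "A \<in> Obj C" "x \<in> fib ?k A" for x A
    using set_hom_mem [OF M_hom [OF point_hom] star] in_U [OF that] that(1) by simp
  have "nat_iso C set_cat (ev ?k) M ?\<mu>"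
    unfolding nat_iso_def
  proof (intro conjI ballI)
    fix A assume A: "A \<in> Obj C"
    then have A': "finite A" "A \<subseteq> U" by auto
    show h: "?\<mu> A \<in> hom set_cat (onObj (ev ?k) A) (onObj M A)"
      using mem [OF A] by (simp add: hom_set_cat)
    have "bij_betw (\<lambda>x. sfun (onArr M (point x A)) (star x)) (fib ?k A) (onObj M A)"
      unfolding bij_betw_def
    proof (intro conjI inj_onI equalityI subsetI)
      fix x y assume x: "x \<in> fib ?k A" and y: "y \<in> fib ?k A"
        and e: "sfun (onArr M (point x A)) (star x) = sfun (onArr M (point y A)) (star y)"
      show "x = y"
      proof (rule ccontr)
        note xU = in_U [OF A x] and yU = in_U [OF A y]
        assume "x \<noteq> y"
        then have "sfun (point x A) x \<noteq> sfun (point y A) y" by simp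
        from M_disjoint [OF point_hom [OF A' xU(3)] point_hom [OF A' yU(3)] this star [OF xU(1,2)] star [OF yU(1,2)]]
        show False using e by contradiction
      qed
    next
      fix u assume "u \<in> (\<lambda>x. sfun (onArr M (point x A)) (star x)) ` fib ?k A"
      then show "u \<in> onObj M A" using mem [OF A] by auto
    next
      fix u assume "u \<in> onObj M A"
      then obtain x v where x: "x \<in> A" "v \<in> onObj M {x}" "u = sfun (onArr M (point x A)) v"
        by (rule M_points [OF A'])
      then have xU: "x \<in> U" "lab x = ?k" using A' label(2) [OF M, of x] by auto
      then have "v = star x" using M_singleton_unique star x(2) by blast
      then show "u \<in> (\<lambda>x. sfun (onArr M (point x A)) (star x)) ` fib ?k A"
        using x xU by (auto simp: fib_def)
    qed
    then have "bij_betw (\<lambda>x\<in>fib ?k A. sfun (onArr M (point x A)) (star x)) (fib ?k A) (onObj M A)"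
      by (simp cong: bij_betw_cong)
    then show "is_iso set_cat (?\<mu> A)"
      using h by (simp add: is_iso_set_cat hom_def)
  next
    fix f assume f: "f \<in> Arr C"
    let ?A = "sdom f" and ?B = "scod f"
    have fh: "f \<in> hom C ?A ?B" using f by (simp add: hom_def)
    have O: "?A \<in> Obj C" "?B \<in> Obj C" "finite ?A" "?A \<subseteq> U" "finite ?B" "?B \<subseteq> U"
      using f by (auto simp: Arr_lcat)
    have ef: "onArr (ev ?k) f \<in> hom set_cat (fib ?k ?A) (fib ?k ?B)" by (rule ev_hom [OF fh])
    have mu: "?\<mu> X \<in> hom set_cat (fib ?k X) (onObj M X)" if "X \<in> Obj C" for X
      using mem [OF that] by (simp add: hom_set_cat)
    have "Comp set_cat (?\<mu> ?B) (onArr (ev ?k) f) = Comp set_cat (onArr M f) (?\<mu> ?A)"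
    proof (rule set_arr_eqI)
      show "Comp set_cat (?\<mu> ?B) (onArr (ev ?k) f) \<in> hom set_cat (fib ?k ?A) (onObj M ?B)"
        by (rule Comp_hom [OF category_set_cat ef mu [OF O(2)]])
      show "Comp set_cat (onArr M f) (?\<mu> ?A) \<in> hom set_cat (fib ?k ?A) (onObj M ?B)"
        by (rule Comp_hom [OF category_set_cat mu [OF O(1)] M_hom [OF fh]])
      fix x assume x: "x \<in> fib ?k ?A"
      let ?y = "sfun f x"
      have y: "?y \<in> fib ?k ?B" using set_hom_mem [OF ef x] x by simp
      note xU = in_U [OF O(1) x] and yU = in_U [OF O(2) y]
      \<comment> \<open>The arrow \<open>f\<close> carries the point \<open>x\<close> to the point
        \<open>?y\<close> along \<open>?q\<close>, and \<open>M\<close> of \<open>?q\<close> can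
        only send \<open>star x\<close> to \<open>star ?y\<close>.\<close>
      let ?q = "({x}, \<lambda>_\<in>{x}. ?y, {?y})"
      have q: "?q \<in> hom C {x} {?y}" using xU yU by (auto simp: hom_lcat)
      have px: "point x ?A \<in> hom C {x} ?A" and py: "point ?y ?B \<in> hom C {?y} ?B"
        using point_hom O xU yU by auto
      have c: "Comp C f (point x ?A) = Comp C (point ?y ?B) ?q"
        by (rule arr_eqI [OF comp_lcat [OF px fh] comp_lcat [OF q py]]) (simp add: point_def compose_def)
      have "sfun (onArr M f) (sfun (onArr M (point x ?A)) (star x)) =
          sfun (onArr M (point ?y ?B)) (sfun (onArr M ?q) (star x))"
        using M_Comp [OF px fh star [OF xU(1,2)]] M_Comp [OF q py star [OF xU(1,2)]] unfolding c by simp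
      also have "sfun (onArr M ?q) (star x) = star ?y"
        using M_singleton_unique [OF yU(1)] set_hom_mem [OF M_hom [OF q] star [OF xU(1,2)]]
          star [OF yU(1,2)] by blast
      finally show "sfun (Comp set_cat (?\<mu> ?B) (onArr (ev ?k) f)) x =
          sfun (Comp set_cat (onArr M f) (?\<mu> ?A)) x"
        using x y by (simp add: compose_def)
    qed
    then show "Comp set_cat (?\<mu> (Cod C f)) (onArr (ev ?k) f) = Comp set_cat (onArr M f) (?\<mu> (Dom C f))"
      by simp
  qed
  then show ?thesis by blast
qed

text \<open>Models with the same label are isomorphic to the same fibre functor. Conversely an
  isomorphism preserves which singletons are inhabited, and these determine the label.\<close>

lemma nat_iso_iff_label:
  assumes M: "coherent_functor C set_cat M" and N: "coherent_functor C set_cat N"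
  shows "label M = label N \<longleftrightarrow> (\<exists>\<eta>. nat_iso C set_cat M N \<eta>)"
proof
  note f = coherent_functor_functor [OF M] coherent_functor_functor [OF N]
    coherent_functor_functor [OF ev_coherent [OF label(1) [OF M]]]
  assume "label M = label N"
  then obtain \<mu> \<nu> where a: "nat_iso C set_cat (ev (label M)) M \<mu>" "nat_iso C set_cat (ev (label M)) N \<nu>"
    using nat_iso_ev [OF M] nat_iso_ev [OF N] by auto
  obtain \<mu>' where "nat_iso C set_cat M (ev (label M)) \<mu>'" using nat_iso_sym [OF f(3,1) a(1)] by blast
  then show "\<exists>\<eta>. nat_iso C set_cat M N \<eta>" using nat_iso_trans [OF f(1,3,2) _ a(2)] by blast
next
  assume "\<exists>\<eta>. nat_iso C set_cat M N \<eta>"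
  then obtain \<eta> where \<eta>: "nat_iso C set_cat M N \<eta>" ..
  let ?x = "enc (label M) undefined"
  have k: "label M \<in> K" by (rule label(1) [OF M])
  then have "onObj M {?x} \<noteq> {}" using label(2) [OF M, of ?x] by simp
  moreover have "\<eta> {?x} \<in> hom set_cat (onObj M {?x}) (onObj N {?x})"
    using \<eta> k by (simp add: nat_iso_def)
  ultimately have "onObj N {?x} \<noteq> {}" using set_hom_mem by (metis ex_in_conv)
  then show "label M = label N" using label_eqI [OF N k] by simp
qed

end

section \<open>Reading off datasets\<close>

text \<open>A model is the fibre functor at its label, up to isomorphism, and \<open>val\<close>
  identifies the fibre of \<open>copies A\<close> with \<open>A\<close>. Naturality is stated for
  all arrows between copied sets, not only for copied arrows, because inference differs from fibre
  to fibre.\<close>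

lemma (in model) ex_reading:
  obtains \<rho> where "\<And>A. finite A \<Longrightarrow> bij_betw (\<rho> A) (onObj M (copies A)) A"
    and "\<And>A B h u. finite A \<Longrightarrow> finite B \<Longrightarrow> h \<in> hom C (copies A) (copies B) \<Longrightarrow> u \<in> onObj M (copies A) \<Longrightarrow>
      enc (label M) (\<rho> B (sfun (onArr M h) u)) = sfun h (enc (label M) (\<rho> A u))"
proof -
  let ?k = "label M"
  have k: "?k \<in> K" by (rule label(1) [OF coherent_M])
  obtain \<mu> where "nat_iso C set_cat (ev ?k) M \<mu>" using nat_iso_ev [OF coherent_M] by blast
  then obtain \<nu> where \<nu>: "nat_iso C set_cat M (ev ?k) \<nu>"
    using nat_iso_sym [OF coherent_functor_functor [OF ev_coherent [OF k]] functor_M] by blast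
  define \<rho> where "\<rho> A = val \<circ> sfun (\<nu> (copies A))" for A
  have nb: "\<nu> (copies A) \<in> hom set_cat (onObj M (copies A)) (fib ?k (copies A))"
      "bij_betw (sfun (\<nu> (copies A))) (onObj M (copies A)) (fib ?k (copies A))" if "finite A" for A
    using \<nu> copies_Ob [OF that] unfolding nat_iso_def is_iso_set_cat by (auto simp: hom_set_cat)
  have enc_val: "enc ?k (val x) = x" if "x \<in> fib ?k (copies A)" for x A
    using that U_enc [of x] by (auto simp: fib_def copies_def)
  have "bij_betw val (fib ?k (copies A)) A" for A
    by (rule bij_betwI [where g = "enc ?k"]) (use k enc_val in \<open>auto simp: fib_def copies_def\<close>)
  then have bij: "bij_betw (\<rho> A) (onObj M (copies A)) A" if "finite A" for A
    unfolding \<rho>_def using bij_betw_trans [OF nb(2) [OF that]] by blast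
  have "enc ?k (\<rho> B (sfun (onArr M h) u)) = sfun h (enc ?k (\<rho> A u))"
    if A: "finite A" and B: "finite B" and h: "h \<in> hom C (copies A) (copies B)"
      and u: "u \<in> onObj M (copies A)" for A B h u
  proof -
    have s: "sdom h = copies A" "scod h = copies B" "h \<in> Arr C" using h by (auto simp: hom_def)
    have "Comp set_cat (\<nu> (copies B)) (onArr M h) = Comp set_cat (onArr (ev ?k) h) (\<nu> (copies A))"
      using \<nu> s unfolding nat_iso_def by auto
    then have "sfun (\<nu> (copies B)) (sfun (onArr M h) u) = sfun (onArr (ev ?k) h) (sfun (\<nu> (copies A)) u)"
      using sfun_Comp [OF M_hom [OF h] u] sfun_Comp [OF nb(1) [OF A] u] by metis
    also have "\<dots> = sfun h (sfun (\<nu> (copies A)) u)"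
      using set_hom_mem [OF nb(1) [OF A] u] s by simp
    finally have e: "sfun (\<nu> (copies B)) (sfun (onArr M h) u) = sfun h (sfun (\<nu> (copies A)) u)" .
    have "enc ?k (\<rho> B (sfun (onArr M h) u)) = sfun (\<nu> (copies B)) (sfun (onArr M h) u)"
      unfolding \<rho>_def comp_apply
      using set_hom_mem [OF nb(1) [OF B] set_hom_mem [OF M_hom [OF h] u]] by (rule enc_val)
    moreover have "enc ?k (\<rho> A u) = sfun (\<nu> (copies A)) u"
      unfolding \<rho>_def comp_apply using set_hom_mem [OF nb(1) [OF A] u] by (rule enc_val)
    ultimately show ?thesis using e by simp
  qed
  with bij show thesis by (rule that)
qed

section \<open>Coordinates and decoding of floating point numbers\<close>

context float_data
begin

definition coords :: "(nat \<Rightarrow> 's sarr) \<Rightarrow> nat \<Rightarrow> 's \<Rightarrow> 's list" where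
  "coords pr k x = map (\<lambda>j. sfun (pr j) x) [0..<k]"

lemma power_hom:
  assumes "is_power fl R k L pr"
  shows "L \<in> Obj fl" "\<And>j. j < k \<Longrightarrow> pr j \<in> hom fl L R"
  using assms by (auto simp: is_power_def is_limit_def is_cone_def)

text \<open>A power of \<open>R\<close> in Float is a power in Set by \<open>fl_limit_set\<close>,
  so its elements correspond to the lists of their projections.\<close>

lemma power_bij:
  assumes L: "is_power fl R k L pr"
  shows "bij_betw (coords pr k) L (Rvec R k)"
proof -
  let ?d = "\<lparr>verts = {..<k}, edges = {}, esrc = id, etgt = id,
       dobj = (\<lambda>_. R), darr = (\<lambda>_. Ident fl R)\<rparr>"
  have d: "finite_diagram fl ?d" using R_fl by (simp add: finite_diagram_def)
  have ds: "finite_diagram set_cat ?d" by (simp add: finite_diagram_def)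
  have "is_limit set_cat ?d L pr"
    using fl_limit_set [OF d] L by (simp add: is_power_def)
  then have ex: "\<exists>!l. l \<in> L \<and> (\<forall>i<k. sfun (pr i) l = x i)" if "\<And>i. i < k \<Longrightarrow> x i \<in> R" for x
    using that unfolding limit_set_iff [OF ds] family_set by (simp add: Ball_def)
  have mem: "sfun (pr i) l \<in> R" if "i < k" "l \<in> L" for i l
    using set_hom_mem [OF fl_hom_set [OF power_hom(2) [OF L that(1)]] that(2)] .
  show ?thesis
    unfolding bij_betw_def
  proof (intro conjI inj_onI equalityI subsetI)
    fix l l' assume l: "l \<in> L" "l' \<in> L" and e: "coords pr k l = coords pr k l'"
    have "sfun (pr i) l = sfun (pr i) l'" if "i < k" for i
      using e that by (simp add: coords_def)
    then show "l = l'" using ex [of "\<lambda>i. sfun (pr i) l"] mem l by metis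
  next
    fix xs assume "xs \<in> coords pr k ` L"
    then show "xs \<in> Rvec R k" using mem by (auto simp: coords_def Rvec_def)
  next
    fix xs assume xs: "xs \<in> Rvec R k"
    then have "\<exists>!l. l \<in> L \<and> (\<forall>i<k. sfun (pr i) l = xs ! i)"
      by (intro ex) (auto simp: Rvec_def)
    then obtain l where l: "l \<in> L" "\<forall>i<k. sfun (pr i) l = xs ! i" by blast
    have "coords pr k l = xs"
      using l(2) xs by (auto simp: coords_def Rvec_def intro: nth_equalityI)
    then show "xs \<in> coords pr k ` L" using l(1) by blast
  qed
qed

text \<open>Decoding is defined by the constants, which are arrows of Float; naturality of
  \<open>\<tau>\<close> at them shows that it agrees with any natural bijection to the inclusion
  into Set. Datasets can thus be computed with whichever identification the construction
  provides.\<close>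

lemma float_decode_eq:
  assumes Q: "is_functor fl set_cat Q"
    and bij: "\<And>A. A \<in> Obj fl \<Longrightarrow> bij_betw (\<tau> A) (onObj Q A) A"
    and nat: "\<And>h A B u. h \<in> hom fl A B \<Longrightarrow> u \<in> onObj Q A \<Longrightarrow>
      \<tau> B (sfun (onArr Q h) u) = sfun h (\<tau> A u)"
    and v: "v \<in> onObj Q R"
  shows "float_decode R Q v = \<tau> R v"
  unfolding float_decode_def
proof (rule the_equality)
  have c: "const_arr z r R \<in> hom fl {z} R" if "r \<in> R" for z r
    using const_arr_fl [OF that, of z] by (simp add: hom_def const_arr_def)
  have z: "{z} \<in> Obj fl" if "r \<in> R" for z r
  proof -
    have "Dom fl (const_arr z r R) \<in> Obj fl"
      using const_arr_fl [OF that] category_fl unfolding category_def by blast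
    then show ?thesis by (simp add: const_arr_def)
  qed
  have dom: "sdom (onArr Q (const_arr z r R)) = onObj Q {z}"
    "onArr Q (const_arr z r R) \<in> hom set_cat (onObj Q {z}) (onObj Q R)" if "r \<in> R" for z r
    using functor_hom [OF Q c [OF that]] by (auto simp: hom_set_cat)
  have val: "\<tau> R (sfun (onArr Q (const_arr z r R)) u) = r" if "r \<in> R" "u \<in> onObj Q {z}" for z r u
    using nat [OF c [OF that(1)] that(2)] bij_betwE [OF bij [OF z [OF that(1)]]] that
    by (simp add: const_arr_def)
  show r: "\<tau> R v \<in> R \<and> (\<exists>z. v \<in> sfun (onArr Q (const_arr z (\<tau> R v) R)) `
      sdom (onArr Q (const_arr z (\<tau> R v) R)))"
  proof
    show r: "\<tau> R v \<in> R" using bij [OF R_fl] v by (rule bij_betwE [THEN bspec])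
    \<comment> \<open>Every singleton serves as a terminal object; one is picked, and the bijection
      \<open>\<tau>\<close> shows that \<open>Q\<close> sends it to an inhabited set.\<close>
    obtain z :: 's where True by simp
    have "bij_betw (\<tau> {z}) (onObj Q {z}) {z}" using bij z [OF r] by blast
    then obtain u where u: "u \<in> onObj Q {z}" by (metis bij_betw_empty1 ex_in_conv insert_not_empty)
    let ?v = "sfun (onArr Q (const_arr z (\<tau> R v) R)) u"
    have "?v \<in> onObj Q R" by (rule set_hom_mem [OF dom(2) [OF r] u])
    then have "?v = v"
      using val [OF r u] bij [OF R_fl] v by (auto simp: bij_betw_def dest: inj_onD)
    then show "\<exists>z. v \<in> sfun (onArr Q (const_arr z (\<tau> R v) R)) `
      sdom (onArr Q (const_arr z (\<tau> R v) R))"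
      using u dom(1) [OF r, of z] by (intro exI [of _ z] image_eqI [of _ _ u]) simp_all
  qed
  fix r assume "r \<in> R \<and> (\<exists>z. v \<in> sfun (onArr Q (const_arr z r R)) ` sdom (onArr Q (const_arr z r R)))"
  then show "r = \<tau> R v" using val dom(1) by auto
qed

lemma coords_decode:
  assumes Q: "is_functor fl set_cat Q"
    and bij: "\<And>A. A \<in> Obj fl \<Longrightarrow> bij_betw (\<tau> A) (onObj Q A) A"
    and nat: "\<And>h A B u. h \<in> hom fl A B \<Longrightarrow> u \<in> onObj Q A \<Longrightarrow>
      \<tau> B (sfun (onArr Q h) u) = sfun h (\<tau> A u)"
    and L: "is_power fl R k L pr" and w: "w \<in> onObj Q L"
  shows "map (\<lambda>j. float_decode R Q (sfun (onArr Q (pr j)) w)) [0..<k] = coords pr k (\<tau> L w)"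
proof -
  have "float_decode R Q (sfun (onArr Q (pr j)) w) = sfun (pr j) (\<tau> L w)" if j: "j < k" for j
  proof -
    note h = power_hom(2) [OF L j]
    show ?thesis
      using float_decode_eq [OF Q bij nat set_hom_mem [OF functor_hom [OF Q h] w]] nat [OF h w]
      by simp
  qed
  then show ?thesis by (simp add: coords_def)
qed

end

lemma finite_Rvec: "finite R \<Longrightarrow> finite (Rvec R k)"
  using finite_lists_length_eq [of R k] by (simp add: Rvec_def conj_commute)

section \<open>Extension of a family of vector functions to a functor on RSpan\<close>

locale rspan_setting = Fl: float_data R add mul + coding K enc lab val
  for R :: "'s set" and add mul and K :: "'k set" and enc :: "'k \<Rightarrow> 's \<Rightarrow> 's" and lab val +
  fixes D :: "'s rspan" and p q :: nat and tr :: "'k \<Rightarrow> 's list \<Rightarrow> 's list"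
  assumes rspan: "is_RSpan R add mul p q D"
    and tr: "\<And>k x. k \<in> K \<Longrightarrow> x \<in> Rvec R p \<Longrightarrow> tr k x \<in> Rvec R q"
begin

abbreviation "fl \<equiv> float_cat R add mul"
abbreviation "Sp \<equiv> span_cat D"
abbreviation "vertex \<equiv> rspan_vertex fl D"
abbreviation "x0 \<equiv> sort_obj D"

lemma rspan_facts:
  shows sort: "is_Sort (sort_cat D) x0" and span: "is_Span Sp (span_f D) (span_t D)"
    and pow_p: "is_power fl R p (pow_p D) (proj_p D)"
    and pow_q: "is_power fl R q (pow_q D) (proj_q D)"
    and glue_obj: "onObj (glue D XSpan) x0 = Cod Sp (span_f D)" "onObj (glue D YSpan) x0 = Cod Sp (span_t D)"
      "onObj (glue D XFloat) x0 = pow_p D" "onObj (glue D YFloat) x0 = pow_q D"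
    and colim: "is_2colimit UNIV UNIV redge_src redge_tgt vertex (glue D) (rspan_cat D) (leg D) (cell D)"
  using rspan by (auto simp: is_RSpan_def)

lemma glue_coherent: "coherent_functor (vertex (redge_src e)) (vertex (redge_tgt e)) (glue D e)"
  using colim by (simp add: is_2colimit_def)

lemma leg_coherent: "coherent_functor (vertex v) (rspan_cat D) (leg D v)"
  using colim by (simp add: is_2colimit_def pseudo_cocone_def)

lemma cell_iso: "nat_iso (vertex (redge_src e)) (rspan_cat D) (leg D (redge_src e))
    (func_comp (leg D (redge_tgt e)) (glue D e)) (cell D e)"
  using colim by (simp add: is_2colimit_def pseudo_cocone_def)

lemma x0_Obj: "x0 \<in> Obj (sort_cat D)"
  using sort by (simp add: is_Sort_def)

lemma copy_float: "coherent_functor fl C copy"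
  by (rule copy_coherent [OF Fl.incl_coherent Fl.fl_Obj_finite])

lemma finite_pow: "finite (pow_p D)" "finite (pow_q D)"
  using Fl.fl_Obj_finite Fl.power_hom(1) pow_p pow_q by blast+

text \<open>\<open>pow_p D\<close> and \<open>pow_q D\<close> are arbitrarily chosen powers of
  \<open>R\<close> in Float, so the list function \<open>tr k\<close> is conjugated with their
  coordinate bijections. Between finite sets an arrow of \<open>G\<close> only has to keep labels,
  so \<open>tr k\<close> may be any function of vectors and may vary with \<open>k\<close>, as
  inference does with the network.\<close>

definition inf_arr :: "'s sarr" where
  "inf_arr = (copies (pow_p D), \<lambda>u\<in>copies (pow_p D). enc (lab u)
     (inv_into (pow_q D) (Fl.coords (proj_q D) q) (tr (lab u) (Fl.coords (proj_p D) p (val u)))),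
     copies (pow_q D))"

lemma coords_inv:
  assumes "k \<in> K" "x \<in> pow_p D"
  shows "inv_into (pow_q D) (Fl.coords (proj_q D) q) (tr k (Fl.coords (proj_p D) p x)) \<in> pow_q D"
    "Fl.coords (proj_q D) q (inv_into (pow_q D) (Fl.coords (proj_q D) q)
       (tr k (Fl.coords (proj_p D) p x))) = tr k (Fl.coords (proj_p D) p x)"
proof -
  have "tr k (Fl.coords (proj_p D) p x) \<in> Rvec R q"
    using tr assms bij_betwE [OF Fl.power_bij [OF pow_p]] by blast
  then have "tr k (Fl.coords (proj_p D) p x) \<in> Fl.coords (proj_q D) q ` pow_q D"
    using Fl.power_bij [OF pow_q] by (simp add: bij_betw_def)
  then show "inv_into (pow_q D) (Fl.coords (proj_q D) q) (tr k (Fl.coords (proj_p D) p x)) \<in> pow_q D"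
    "Fl.coords (proj_q D) q (inv_into (pow_q D) (Fl.coords (proj_q D) q)
       (tr k (Fl.coords (proj_p D) p x))) = tr k (Fl.coords (proj_p D) p x)"
    by (rule inv_into_into, rule f_inv_into_f)
qed

lemma inf_arr_hom: "inf_arr \<in> hom C (copies (pow_p D)) (copies (pow_q D))"
proof -
  have u: "lab u \<in> K" "val u \<in> pow_p D" if "u \<in> copies (pow_p D)" for u
    using that U_enc by (auto simp: copies_def)
  have "sfun inf_arr u \<in> copies (pow_q D) \<and> lab (sfun inf_arr u) = lab u"
    if "u \<in> copies (pow_p D)" for u
    using that u [OF that] coords_inv(1) [OF u [OF that]] by (simp add: inf_arr_def) (simp add: copies_def)
  moreover have "sfun inf_arr \<in> extensional (copies (pow_p D))" by (simp add: inf_arr_def)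
  moreover have "sdom inf_arr = copies (pow_p D)" "scod inf_arr = copies (pow_q D)"
    by (simp_all add: inf_arr_def)
  ultimately show ?thesis
    using copies_Ob [OF finite_pow(1)] copies_Ob [OF finite_pow(2)]
    unfolding hom_lcat by (simp add: PiE_def)
qed

lemma sort_extend:
  assumes "coherent_functor (sort_cat D) C F" "coherent_functor (sort_cat D) C G"
    "h \<in> hom C (onObj F x0) (onObj G x0)" "is_iso C h"
  shows "\<exists>\<eta>. nat_iso (sort_cat D) C F G \<eta> \<and> \<eta> x0 = h"
  using sort coherent_finite assms unfolding is_Sort_def by blast

lemma span_extend:
  assumes "span_arrows C f t"
  shows "\<exists>F hN hX hY. coherent_functor Sp C F \<and>
    span_arrows_iso C (onArr F (span_f D)) (onArr F (span_t D)) f t hN hX hY"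
proof -
  have "\<forall>C :: 's scat. coherent_category C \<longrightarrow> (\<forall>f t. span_arrows C f t \<longrightarrow>
      (\<exists>F hN hX hY. coherent_functor Sp C F \<and>
        span_arrows_iso C (onArr F (span_f D)) (onArr F (span_t D)) f t hN hX hY))"
    using span unfolding is_Span_def by (intro allI impI) blast
  then show ?thesis using coherent_finite assms by blast
qed

text \<open>The span formed by the identity and \<open>inf_arr\<close> determines \<open>Fs\<close>
  only up to the isomorphisms \<open>hN\<close>, \<open>hX\<close>, \<open>hY\<close>, so the cocone
  is glued along the inverses of \<open>hX\<close> and \<open>hY\<close>. The last four conclusions
  are the coherence of \<open>\<theta>\<close> with the cells at the generic object of Sort;
  comparing the two formulas for each Sort vertex relates the Span end to the Float end.\<close>

lemma ex_inference_functor: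
  obtains H Fs hN hX hY \<theta> where
    "coherent_functor (rspan_cat D) C H"
    "coherent_functor Sp C Fs"
    "span_arrows_iso C (onArr Fs (span_f D)) (onArr Fs (span_t D)) (Ident C (copies (pow_p D))) inf_arr hN hX hY"
    "nat_iso fl C (func_comp H (leg D FloatV)) copy (\<theta> FloatV)"
    "nat_iso Sp C (func_comp H (leg D SpanV)) Fs (\<theta> SpanV)"
    "\<theta> SortX x0 = Comp C (\<theta> FloatV (pow_p D)) (onArr H (cell D XFloat x0))"
    "\<theta> SortX x0 = Comp C hX (Comp C (\<theta> SpanV (Cod Sp (span_f D))) (onArr H (cell D XSpan x0)))"
    "\<theta> SortY x0 = Comp C (\<theta> FloatV (pow_q D)) (onArr H (cell D YFloat x0))"
    "\<theta> SortY x0 = Comp C hY (Comp C (\<theta> SpanV (Cod Sp (span_t D))) (onArr H (cell D YSpan x0)))"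
proof -
  let ?f = "Ident C (copies (pow_p D))"
  have f: "?f \<in> hom C (copies (pow_p D)) (copies (pow_p D))"
    using copies_Ob [OF finite_pow(1)] by (intro Ident_hom category_lcat) simp
  then have "span_arrows C ?f inf_arr"
    using inf_arr_hom by (auto simp: span_arrows_def hom_def)
  then obtain Fs hN hX hY where Fs: "coherent_functor Sp C Fs"
    and iso: "span_arrows_iso C (onArr Fs (span_f D)) (onArr Fs (span_t D)) ?f inf_arr hN hX hY"
    using span_extend by blast
  have sp: "span_f D \<in> Arr Sp" "span_t D \<in> Arr Sp" using span by (auto simp: is_Span_def span_arrows_def)
  note FsF = coherent_functor_functor [OF Fs]
  have cods: "Cod C (onArr Fs (span_f D)) = onObj Fs (Cod Sp (span_f D))"
    "Cod C (onArr Fs (span_t D)) = onObj Fs (Cod Sp (span_t D))"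
    "Cod C ?f = copies (pow_p D)" "Cod C inf_arr = copies (pow_q D)"
    using functor_hom [OF FsF hom_Arr [OF sp(1)]] functor_hom [OF FsF hom_Arr [OF sp(2)]]
    by (simp_all add: hom_def inf_arr_def)
  have hX: "is_iso C hX" "hX \<in> hom C (onObj Fs (Cod Sp (span_f D))) (copies (pow_p D))"
    and hY: "is_iso C hY" "hY \<in> hom C (onObj Fs (Cod Sp (span_t D))) (copies (pow_q D))"
    using iso unfolding span_arrows_iso_def cods by (iprover elim: conjE)+
  obtain gX where gX: "is_iso C gX" "gX \<in> hom C (copies (pow_p D)) (onObj Fs (Cod Sp (span_f D)))"
    "Comp C hX gX = Ident C (copies (pow_p D))"
    by (rule is_iso_inverse [OF hX(1)]) (use hX(2) in \<open>auto simp: hom_def\<close>)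
  obtain gY where gY: "is_iso C gY" "gY \<in> hom C (copies (pow_q D)) (onObj Fs (Cod Sp (span_t D)))"
    "Comp C hY gY = Ident C (copies (pow_q D))"
    by (rule is_iso_inverse [OF hY(1)]) (use hY(2) in \<open>auto simp: hom_def\<close>)
  \<comment> \<open>The Sort vertices are sent through Float, so the cells on the Float side can be
    identities and all correction sits in the cells on the Span side.\<close>
  define L where "L v = (case v of SortX \<Rightarrow> func_comp copy (glue D XFloat)
    | SortY \<Rightarrow> func_comp copy (glue D YFloat) | SpanV \<Rightarrow> Fs | FloatV \<Rightarrow> copy)" for v
  have L: "coherent_functor (vertex v) C (L v)" for v
    using coherent_functor_comp [OF _ copy_float] glue_coherent [of XFloat] glue_coherent [of YFloat]
      Fs copy_float by (cases v) (simp_all add: L_def)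
  have LG: "coherent_functor (sort_cat D) C (func_comp Fs (glue D XSpan))"
    "coherent_functor (sort_cat D) C (func_comp Fs (glue D YSpan))"
    using coherent_functor_comp [OF _ Fs] glue_coherent [of XSpan] glue_coherent [of YSpan] by simp_all
  \<comment> \<open>The universal property of Sort extends the single isomorphism \<open>gX\<close>
    at the generic object to a whole cell of the cocone.\<close>
  obtain \<eta>X where \<eta>X: "nat_iso (sort_cat D) C (L SortX) (func_comp Fs (glue D XSpan)) \<eta>X" "\<eta>X x0 = gX"
    using sort_extend [OF _ LG(1), of "L SortX" gX] L [of SortX] gX by (auto simp: L_def glue_obj)
  obtain \<eta>Y where \<eta>Y: "nat_iso (sort_cat D) C (L SortY) (func_comp Fs (glue D YSpan)) \<eta>Y" "\<eta>Y x0 = gY"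
    using sort_extend [OF _ LG(2), of "L SortY" gY] L [of SortY] gY by (auto simp: L_def glue_obj)
  define l where "l e = (case e of XSpan \<Rightarrow> \<eta>X | YSpan \<Rightarrow> \<eta>Y
    | XFloat \<Rightarrow> (\<lambda>x. Ident C (onObj (L SortX) x)) | YFloat \<Rightarrow> (\<lambda>x. Ident C (onObj (L SortY) x)))" for e
  have "nat_iso (vertex (redge_src e)) C (L (redge_src e)) (func_comp (L (redge_tgt e)) (glue D e)) (l e)" for e
    using \<eta>X(1) \<eta>Y(1) nat_iso_refl [OF coherent_functor_functor [OF L [of SortX]]]
      nat_iso_refl [OF coherent_functor_functor [OF L [of SortY]]]
    by (cases e) (simp_all add: l_def L_def)
  then have "pseudo_cocone UNIV UNIV redge_src redge_tgt vertex (glue D) C L l"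
    using L coherent_finite by (simp add: pseudo_cocone_def)
  moreover have "\<forall>(C' :: 's scat) L' l'.
      pseudo_cocone UNIV UNIV redge_src redge_tgt vertex (glue D) C' L' l' \<longrightarrow>
        (\<exists>H \<theta>. coherent_functor (rspan_cat D) C' H \<and>
           (\<forall>i\<in>UNIV. nat_iso (vertex i) C' (func_comp H (leg D i)) (L' i) (\<theta> i)) \<and>
           (\<forall>e\<in>UNIV. \<forall>x\<in>Obj (vertex (redge_src e)).
              Comp C' (l' e x) (\<theta> (redge_src e) x) =
              Comp C' (\<theta> (redge_tgt e) (onObj (glue D e) x)) (onArr H (cell D e x))))"
    using colim unfolding is_2colimit_def by blast
  ultimately obtain H \<theta> where H: "coherent_functor (rspan_cat D) C H"
    and \<theta>: "\<And>v. nat_iso (vertex v) C (func_comp H (leg D v)) (L v) (\<theta> v)"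
    and coh: "\<And>e x. x \<in> Obj (vertex (redge_src e)) \<Longrightarrow> Comp C (l e x) (\<theta> (redge_src e) x) =
              Comp C (\<theta> (redge_tgt e) (onObj (glue D e) x)) (onArr H (cell D e x))"
    by blast
  have \<theta>X: "\<theta> SortX x0 \<in> hom C (onObj H (onObj (leg D SortX) x0)) (copies (pow_p D))"
    using \<theta> [of SortX] x0_Obj glue_obj(3) unfolding nat_iso_def by (auto simp: L_def)
  have \<theta>Y: "\<theta> SortY x0 \<in> hom C (onObj H (onObj (leg D SortY) x0)) (copies (pow_q D))"
    using \<theta> [of SortY] x0_Obj glue_obj(4) unfolding nat_iso_def by (auto simp: L_def)
  have l0: "l XFloat x0 = Ident C (copies (pow_p D))" "l YFloat x0 = Ident C (copies (pow_q D))"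
    "l XSpan x0 = gX" "l YSpan x0 = gY"
    by (simp_all add: l_def L_def glue_obj \<eta>X \<eta>Y)
  have x0': "x0 \<in> Obj (vertex (redge_src e))" for e using x0_Obj by (cases e) simp_all
  show thesis
  proof (rule that [of H Fs hN hX hY \<theta>, OF H Fs iso])
    show "nat_iso fl C (func_comp H (leg D FloatV)) copy (\<theta> FloatV)"
      "nat_iso Sp C (func_comp H (leg D SpanV)) Fs (\<theta> SpanV)"
      using \<theta> [of FloatV] \<theta> [of SpanV] by (simp_all add: L_def)
    show "\<theta> SortX x0 = Comp C (\<theta> FloatV (pow_p D)) (onArr H (cell D XFloat x0))"
      using coh [OF x0', of XFloat] Comp_Ident(2) [OF category_lcat \<theta>X]
      unfolding redge_src.simps redge_tgt.simps l0 glue_obj by metis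
    show "\<theta> SortY x0 = Comp C (\<theta> FloatV (pow_q D)) (onArr H (cell D YFloat x0))"
      using coh [OF x0', of YFloat] Comp_Ident(2) [OF category_lcat \<theta>Y]
      unfolding redge_src.simps redge_tgt.simps l0 glue_obj by metis
    show "\<theta> SortX x0 = Comp C hX (Comp C (\<theta> SpanV (Cod Sp (span_f D))) (onArr H (cell D XSpan x0)))"
      using coh [OF x0', of XSpan] Comp_Ident(2) [OF category_lcat \<theta>X]
        Comp_assoc [OF category_lcat \<theta>X gX(2) hX(2)] gX(3)
      unfolding redge_src.simps redge_tgt.simps l0 glue_obj by metis
    show "\<theta> SortY x0 = Comp C hY (Comp C (\<theta> SpanV (Cod Sp (span_t D))) (onArr H (cell D YSpan x0)))"
      using coh [OF x0', of YSpan] Comp_Ident(2) [OF category_lcat \<theta>Y]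
        Comp_assoc [OF category_lcat \<theta>Y gY(2) hY(2)] gY(3)
      unfolding redge_src.simps redge_tgt.simps l0 glue_obj by metis
  qed
qed

end

section \<open>The dataset induced by a model of the constructed category\<close>

locale rspan_model = rspan_setting R add mul K enc lab val D p q tr + model K enc lab val M
  for R :: "'s set" and add mul and K :: "'k set" and enc :: "'k \<Rightarrow> 's \<Rightarrow> 's" and lab val
    and D :: "'s rspan" and p q tr M +
  fixes H :: "'s sfunc" and \<theta> :: "rvert \<Rightarrow> 's set \<Rightarrow> 's sarr" and \<rho> :: "'s set \<Rightarrow> 's \<Rightarrow> 's"
  assumes H: "coherent_functor (rspan_cat D) C H"
    and \<theta>_float: "nat_iso fl C (func_comp H (leg D FloatV)) copy (\<theta> FloatV)"
    and \<rho>_bij: "\<And>A. finite A \<Longrightarrow> bij_betw (\<rho> A) (onObj M (copies A)) A"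
    and \<rho>_nat: "\<And>A B h u. finite A \<Longrightarrow> finite B \<Longrightarrow> h \<in> hom C (copies A) (copies B) \<Longrightarrow>
      u \<in> onObj M (copies A) \<Longrightarrow>
      enc (label M) (\<rho> B (sfun (onArr M h) u)) = sfun h (enc (label M) (\<rho> A u))"
begin

abbreviation "Q \<equiv> func_comp (func_comp M H) (leg D FloatV)"

lemma M_iso_bij:
  assumes "is_iso C h" "h \<in> hom C A B"
  shows "bij_betw (sfun (onArr M h)) (onObj M A) (onObj M B)"
  using functor_iso [OF functor_M assms(1)] M_hom [OF assms(2)]
  by (simp add: is_iso_set_cat hom_set_cat)

lemma functor_MH: "is_functor (rspan_cat D) set_cat (func_comp M H)"
  by (rule is_functor_comp [OF coherent_functor_functor [OF H] functor_M])

lemma functor_Q: "is_functor fl set_cat Q"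
  using is_functor_comp [OF coherent_functor_functor [OF leg_coherent] functor_MH, of FloatV] by simp

text \<open>The component at \<open>A\<close> of a natural bijection from \<open>Q\<close> to the
  inclusion of Float into Set, which is what \<open>coords_decode\<close> consumes.\<close>

definition \<tau> :: "'s set \<Rightarrow> 's \<Rightarrow> 's" where
  "\<tau> A = \<rho> A \<circ> sfun (onArr M (\<theta> FloatV A))"

lemma \<theta>_float_hom:
  assumes "A \<in> Obj fl"
  shows "\<theta> FloatV A \<in> hom C (onObj H (onObj (leg D FloatV) A)) (copies A)" "is_iso C (\<theta> FloatV A)"
  using \<theta>_float assms unfolding nat_iso_def by auto

lemma \<tau>_bij: "A \<in> Obj fl \<Longrightarrow> bij_betw (\<tau> A) (onObj Q A) A"
  unfolding \<tau>_def
  using bij_betw_trans [OF M_iso_bij [OF \<theta>_float_hom(2,1)] \<rho>_bij [OF Fl.fl_Obj_finite]] by simp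

lemma \<tau>_nat:
  assumes h: "h \<in> hom fl A B" and u: "u \<in> onObj Q A"
  shows "\<tau> B (sfun (onArr Q h) u) = sfun h (\<tau> A u)"
proof -
  have o: "A \<in> Obj fl" "B \<in> Obj fl" using h Fl.category_fl by (auto simp: category_def hom_def)
  note fin = Fl.fl_Obj_finite [OF o(1)] Fl.fl_Obj_finite [OF o(2)]
  note \<theta>A = \<theta>_float_hom(1) [OF o(1)] and \<theta>B = \<theta>_float_hom(1) [OF o(2)]
  have u': "u \<in> onObj M (onObj H (onObj (leg D FloatV) A))" using u by simp
  have hh: "onArr H (onArr (leg D FloatV) h) \<in>
      hom C (onObj H (onObj (leg D FloatV) A)) (onObj H (onObj (leg D FloatV) B))"
    using functor_hom [OF is_functor_comp [OF coherent_functor_functor [OF leg_coherent [of FloatV]]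
        coherent_functor_functor [OF H]], of h A B] h by simp
  have ch: "onArr copy h \<in> hom C (copies A) (copies B)"
    by (rule copy_hom [OF fin Fl.fl_hom_set [OF h]])
  let ?w = "sfun (onArr M (\<theta> FloatV A)) u"
  have w: "?w \<in> onObj M (copies A)" by (rule set_hom_mem [OF M_hom [OF \<theta>A] u'])
  have "Comp C (\<theta> FloatV B) (onArr H (onArr (leg D FloatV) h)) = Comp C (onArr copy h) (\<theta> FloatV A)"
    using nat_iso_naturality [OF \<theta>_float h] unfolding func_comp_sel comp_apply .
  then have "sfun (onArr M (\<theta> FloatV B)) (sfun (onArr Q h) u) = sfun (onArr M (onArr copy h)) ?w"
    using M_Comp [OF hh \<theta>B u'] M_Comp [OF \<theta>A ch u'] by (simp del: lcat_sel)
  then have "enc (label M) (\<tau> B (sfun (onArr Q h) u)) = sfun (onArr copy h) (enc (label M) (\<rho> A ?w))"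
    using \<rho>_nat [OF fin ch w] by (simp add: \<tau>_def)
  also have k: "label M \<in> K" by (rule label(1) [OF coherent_M])
  have "\<rho> A ?w \<in> A" using bij_betwE [OF \<rho>_bij [OF fin(1)]] w by blast
  then have "enc (label M) (\<rho> A ?w) \<in> copies (sdom h)" using k h by (auto simp: copies_def hom_def)
  then have "sfun (onArr copy h) (enc (label M) (\<rho> A ?w)) = enc (label M) (sfun h (\<tau> A u))"
    using k by (simp add: \<tau>_def)
  finally show ?thesis using k by (metis val_enc)
qed

text \<open>Reading an endpoint means going back along the Span cell and forward along the Float
  cell. Everything is compared at the element \<open>u\<close> over the generic object, where the
  two formulas for \<open>\<theta> sv x0\<close> make the reading through Float equal to the one
  through \<open>\<theta>S\<close> and \<open>h\<close>.\<close>

lemma endpoint: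
  assumes e: "redge_src eS = sv" "redge_src eF = sv" "redge_tgt eS = SpanV" "redge_tgt eF = FloatV"
      "vertex sv = sort_cat D"
    and L: "onObj (glue D eF) x0 = L" "is_power fl R k L pr" and X: "onObj (glue D eS) x0 = X"
    and \<theta>s: "\<theta> sv x0 = Comp C (\<theta> FloatV L) (onArr H (cell D eF x0))"
      "\<theta> sv x0 = Comp C h (Comp C \<theta>S (onArr H (cell D eS x0)))"
    and h: "h \<in> hom C Y (copies L)" and \<theta>S: "\<theta>S \<in> hom C (onObj H (onObj (leg D SpanV) X)) Y"
    and v: "v \<in> onObj M (onObj H (onObj (leg D SpanV) X))"
  shows "endpoint_coords R D (func_comp M H) eS eF k pr v =
    Fl.coords pr k (\<rho> L (sfun (onArr M h) (sfun (onArr M \<theta>S) v)))"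
proof -
  let ?a = "onArr (func_comp M H) (cell D eS x0)" and ?b = "onArr (func_comp M H) (cell D eF x0)"
  let ?A = "onObj (leg D sv) x0"
  have cS: "cell D eS x0 \<in> hom (rspan_cat D) ?A (onObj (leg D SpanV) X)" "is_iso (rspan_cat D) (cell D eS x0)"
    using cell_iso [of eS] x0_Obj e X by (auto simp: nat_iso_def)
  have cF: "cell D eF x0 \<in> hom (rspan_cat D) ?A (onObj (leg D FloatV) L)"
    using cell_iso [of eF] x0_Obj e L by (auto simp: nat_iso_def)
  note HF = coherent_functor_functor [OF H]
  note hS = functor_hom [OF HF cS(1)] and hF = functor_hom [OF HF cF]
  have a: "?a \<in> hom set_cat (onObj M (onObj H ?A)) (onObj M (onObj H (onObj (leg D SpanV) X)))"
    using functor_hom [OF functor_MH cS(1)] by simp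
  have "bij_betw (sfun ?a) (sdom ?a) (onObj M (onObj H (onObj (leg D SpanV) X)))"
    using functor_iso [OF functor_MH cS(2)] a by (simp add: is_iso_set_cat hom_set_cat)
  then have v': "v \<in> sfun ?a ` sdom ?a" using v by (simp add: bij_betw_def)
  define u where "u = inv_into (sdom ?a) (sfun ?a) v"
  have u: "u \<in> onObj M (onObj H ?A)" "sfun ?a u = v"
    using inv_into_into [OF v'] f_inv_into_f [OF v'] a by (auto simp: u_def hom_set_cat)
  have LO: "L \<in> Obj fl" by (rule Fl.power_hom(1) [OF L(2)])
  have w: "sfun ?b u \<in> onObj Q L"
    using set_hom_mem [OF functor_hom [OF functor_MH cF], of u] u(1) by simp
  have "\<tau> L (sfun ?b u) = \<rho> L (sfun (onArr M (\<theta> sv x0)) u)"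
    using M_Comp [OF hF \<theta>_float_hom(1) [OF LO] u(1)] unfolding \<theta>s(1) by (simp add: \<tau>_def)
  also have "sfun (onArr M (\<theta> sv x0)) u = sfun (onArr M h) (sfun (onArr M \<theta>S) v)"
    using M_Comp [OF comp_lcat [OF hS \<theta>S] h u(1)] M_Comp [OF hS \<theta>S u(1)] u(2)
    unfolding \<theta>s(2) by simp
  finally show ?thesis
    using Fl.coords_decode [OF functor_Q \<tau>_bij \<tau>_nat L(2) w]
    unfolding endpoint_coords_def Let_def u_def by simp
qed

text \<open>The apex is read through \<open>hN\<close>, which gives the bijection
  \<open>\<phi>\<close> with \<open>Rvec R p\<close>. The squares of the span isomorphism move this
  reading along the legs: the identity leg yields \<open>\<phi>\<close> again, and
  \<open>inf_arr\<close> acts in the fibre over \<open>label M\<close>, where in coordinates it is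
  \<open>tr (label M)\<close>.\<close>

lemma dataset:
  assumes Fs: "coherent_functor Sp C Fs"
    and iso: "span_arrows_iso C (onArr Fs (span_f D)) (onArr Fs (span_t D))
      (Ident C (copies (pow_p D))) inf_arr hN hX hY"
    and \<theta>_span: "nat_iso Sp C (func_comp H (leg D SpanV)) Fs (\<theta> SpanV)"
    and X: "\<theta> SortX x0 = Comp C (\<theta> FloatV (pow_p D)) (onArr H (cell D XFloat x0))"
      "\<theta> SortX x0 = Comp C hX (Comp C (\<theta> SpanV (Cod Sp (span_f D))) (onArr H (cell D XSpan x0)))"
    and Y: "\<theta> SortY x0 = Comp C (\<theta> FloatV (pow_q D)) (onArr H (cell D YFloat x0))"
      "\<theta> SortY x0 = Comp C hY (Comp C (\<theta> SpanV (Cod Sp (span_t D))) (onArr H (cell D YSpan x0)))"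
  shows "\<exists>N f t \<phi>. dataset_of R p q D (func_comp M H) = (N, f, t) \<and> bij_betw \<phi> N (Rvec R p) \<and>
    (\<forall>x\<in>N. f x = \<phi> x \<and> t x = tr (label M) (\<phi> x))"
proof -
  let ?f = "Ident C (copies (pow_p D))" and ?Nd = "Dom Sp (span_f D)"
  let ?Xd = "Cod Sp (span_f D)" and ?Yd = "Cod Sp (span_t D)"
  have sp: "span_f D \<in> hom Sp ?Nd ?Xd" "span_t D \<in> hom Sp ?Nd ?Yd" and spO: "category Sp"
    using span by (auto simp: is_Span_def span_arrows_def hom_def coherent_category_def)
  have o: "?Nd \<in> Obj Sp" "?Xd \<in> Obj Sp" "?Yd \<in> Obj Sp"
    using sp spO by (auto simp: category_def hom_def)
  note FsF = coherent_functor_functor [OF Fs]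
  have Fsh: "onArr Fs (span_f D) \<in> hom C (onObj Fs ?Nd) (onObj Fs ?Xd)"
    "onArr Fs (span_t D) \<in> hom C (onObj Fs ?Nd) (onObj Fs ?Yd)"
    using functor_hom [OF FsF sp(1)] functor_hom [OF FsF sp(2)] by auto
  have f: "?f \<in> hom C (copies (pow_p D)) (copies (pow_p D))"
    using copies_Ob [OF finite_pow(1)] by (intro Ident_hom category_lcat) simp
  have ends: "Dom C (onArr Fs (span_f D)) = onObj Fs ?Nd"
    "Cod C (onArr Fs (span_f D)) = onObj Fs ?Xd" "Cod C (onArr Fs (span_t D)) = onObj Fs ?Yd"
    "Dom C ?f = copies (pow_p D)" "Cod C ?f = copies (pow_p D)" "Cod C inf_arr = copies (pow_q D)"
    using Fsh f inf_arr_hom by (simp_all add: hom_def)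
  have hN: "is_iso C hN" "hN \<in> hom C (onObj Fs ?Nd) (copies (pow_p D))"
    and hX: "hX \<in> hom C (onObj Fs ?Xd) (copies (pow_p D))"
    and hY: "hY \<in> hom C (onObj Fs ?Yd) (copies (pow_q D))"
    and sq: "Comp C hX (onArr Fs (span_f D)) = Comp C ?f hN" "Comp C hY (onArr Fs (span_t D)) = Comp C inf_arr hN"
    using iso unfolding span_arrows_iso_def ends by (iprover elim: conjE)+
  have \<theta>S: "\<theta> SpanV A \<in> hom C (onObj H (onObj (leg D SpanV) A)) (onObj Fs A)" "is_iso C (\<theta> SpanV A)"
    if "A \<in> Obj Sp" for A
    using \<theta>_span that unfolding nat_iso_def by auto
  let ?N = "onObj M (onObj H (onObj (leg D SpanV) ?Nd))"
  let ?y = "\<lambda>x. sfun (onArr M hN) (sfun (onArr M (\<theta> SpanV ?Nd)) x)"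
  define \<psi> where "\<psi> = (\<lambda>x. \<rho> (pow_p D) (?y x))"
  define \<phi> where "\<phi> = (\<lambda>x. Fl.coords (proj_p D) p (\<psi> x))"
  have y: "?y x \<in> onObj M (copies (pow_p D))" if "x \<in> ?N" for x
    using set_hom_mem [OF M_hom [OF hN(2)] set_hom_mem [OF M_hom [OF \<theta>S(1) [OF o(1)]] that]] .
  have "bij_betw (\<rho> (pow_p D) \<circ> (sfun (onArr M hN) \<circ> sfun (onArr M (\<theta> SpanV ?Nd)))) ?N (pow_p D)"
    by (rule bij_betw_trans [OF bij_betw_trans [OF M_iso_bij [OF \<theta>S(2,1)] M_iso_bij [OF hN]] \<rho>_bij])
      (fact o(1), fact o(1), fact finite_pow(1))
  then have \<psi>_bij: "bij_betw \<psi> ?N (pow_p D)" by (simp add: \<psi>_def comp_def)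
  have \<phi>_bij: "bij_betw \<phi> ?N (Rvec R p)"
    using bij_betw_trans [OF \<psi>_bij Fl.power_bij [OF pow_p]] unfolding \<phi>_def comp_def .
  note HSpan = is_functor_comp [OF coherent_functor_functor [OF leg_coherent [of SpanV]]
      coherent_functor_functor [OF H]]
  have leg_hom: "onArr H (onArr (leg D SpanV) s) \<in> hom C (onObj H (onObj (leg D SpanV) A)) (onObj H (onObj (leg D SpanV) B))"
    if "s \<in> hom Sp A B" for s A B
    using functor_hom [OF HSpan, of s A B] that by simp
  have nat: "sfun (onArr M (\<theta> SpanV B)) (sfun (onArr M (onArr H (onArr (leg D SpanV) s))) x) =
      sfun (onArr M (onArr Fs s)) (sfun (onArr M (\<theta> SpanV A)) x)"
    if s: "s \<in> hom Sp A B" and AB: "A \<in> Obj Sp" "B \<in> Obj Sp"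
      and x: "x \<in> onObj M (onObj H (onObj (leg D SpanV) A))" for s A B x
  proof -
    have "Comp C (\<theta> SpanV B) (onArr H (onArr (leg D SpanV) s)) = Comp C (onArr Fs s) (\<theta> SpanV A)"
      using nat_iso_naturality [OF \<theta>_span s] unfolding func_comp_sel comp_apply .
    then show ?thesis
      using M_Comp [OF leg_hom [OF s] \<theta>S(1) [OF AB(2)] x]
        M_Comp [OF \<theta>S(1) [OF AB(1)] functor_hom [OF FsF s] x] by (simp del: lcat_sel)
  qed
  let ?g = "\<lambda>x. endpoint_coords R D (func_comp M H) XSpan XFloat p (proj_p D)
      (sfun (onArr M (onArr H (onArr (leg D SpanV) (span_f D)))) x)"
  let ?t = "\<lambda>x. endpoint_coords R D (func_comp M H) YSpan YFloat q (proj_q D)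
      (sfun (onArr M (onArr H (onArr (leg D SpanV) (span_t D)))) x)"
  have "?g x = \<phi> x \<and> ?t x = tr (label M) (\<phi> x)" if x: "x \<in> ?N" for x
  proof
    let ?x = "sfun (onArr M (\<theta> SpanV ?Nd)) x"
    have x': "?x \<in> onObj M (onObj Fs ?Nd)" by (rule set_hom_mem [OF M_hom [OF \<theta>S(1) [OF o(1)]] x])
    have mf: "sfun (onArr M (onArr H (onArr (leg D SpanV) (span_f D)))) x \<in> onObj M (onObj H (onObj (leg D SpanV) ?Xd))"
      and mt: "sfun (onArr M (onArr H (onArr (leg D SpanV) (span_t D)))) x \<in> onObj M (onObj H (onObj (leg D SpanV) ?Yd))"
      using set_hom_mem [OF M_hom [OF leg_hom [OF sp(1)]] x] set_hom_mem [OF M_hom [OF leg_hom [OF sp(2)]] x] .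
    have "?g x = Fl.coords (proj_p D) p (\<rho> (pow_p D) (sfun (onArr M hX) (sfun (onArr M (onArr Fs (span_f D))) ?x)))"
      unfolding nat [OF sp(1) o(1,2) x, symmetric]
      by (rule endpoint [OF _ _ _ _ _ glue_obj(3) pow_p glue_obj(1) X hX \<theta>S(1) [OF o(2)] mf]) simp_all
    also have "sfun (onArr M hX) (sfun (onArr M (onArr Fs (span_f D))) ?x) = sfun (onArr M (Comp C ?f hN)) ?x"
      using M_Comp [OF Fsh(1) hX x'] unfolding sq by simp
    also have "\<dots> = ?y x"
      unfolding Comp_Ident(2) [OF category_lcat hN(2)] ..
    finally show "?g x = \<phi> x" by (simp add: \<phi>_def \<psi>_def)
    have "?t x = Fl.coords (proj_q D) q (\<rho> (pow_q D) (sfun (onArr M hY) (sfun (onArr M (onArr Fs (span_t D))) ?x)))"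
      unfolding nat [OF sp(2) o(1,3) x, symmetric]
      by (rule endpoint [OF _ _ _ _ _ glue_obj(4) pow_q glue_obj(2) Y hY \<theta>S(1) [OF o(3)] mt]) simp_all
    also have "sfun (onArr M hY) (sfun (onArr M (onArr Fs (span_t D))) ?x) = sfun (onArr M inf_arr) (?y x)"
      using M_Comp [OF Fsh(2) hY x'] M_Comp [OF hN(2) inf_arr_hom x'] unfolding sq by simp
    also have "\<rho> (pow_q D) (sfun (onArr M inf_arr) (?y x)) =
        inv_into (pow_q D) (Fl.coords (proj_q D) q) (tr (label M) (\<phi> x))"
    proof -
      have k: "label M \<in> K" by (rule label(1) [OF coherent_M])
      have m: "\<psi> x \<in> pow_p D" using \<psi>_bij x by (rule bij_betwE [THEN bspec])
      have "enc (label M) (\<rho> (pow_q D) (sfun (onArr M inf_arr) (?y x))) = sfun inf_arr (enc (label M) (\<psi> x))"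
        unfolding \<psi>_def by (rule \<rho>_nat [OF finite_pow inf_arr_hom y [OF x]])
      also have "\<dots> = enc (label M) (inv_into (pow_q D) (Fl.coords (proj_q D) q) (tr (label M) (\<phi> x)))"
        using k m by (simp add: inf_arr_def \<phi>_def copies_def)
      finally show ?thesis using k by (metis val_enc)
    qed
    also have "Fl.coords (proj_q D) q (inv_into (pow_q D) (Fl.coords (proj_q D) q) (tr (label M) (\<phi> x))) =
        tr (label M) (\<phi> x)"
      unfolding \<phi>_def using label(1) [OF coherent_M] bij_betwE [OF \<psi>_bij] x by (intro coords_inv(2)) auto
    finally show "?t x = tr (label M) (\<phi> x)" .
  qed
  moreover have "dataset_of R p q D (func_comp M H) = (?N, ?g, ?t)"
    by (simp add: dataset_of_def Let_def)
  ultimately show ?thesis using \<phi>_bij by blast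
qed

end

lemma (in rspan_setting) ex_inference:
  "\<exists>\<iota>. coherent_functor (rspan_cat D) C \<iota> \<and> (\<forall>M. coherent_functor C set_cat M \<longrightarrow>
     dataset_of R p q D (func_comp M \<iota>) \<in> RSpanData R p q \<and>
     lspan_iso (dataset_of R p q D (func_comp M \<iota>)) (Rvec R p, \<lambda>x. x, tr (label M)))"
proof -
  obtain H Fs hN hX hY \<theta> where H: "coherent_functor (rspan_cat D) C H"
    and Fs: "coherent_functor Sp C Fs"
    and iso: "span_arrows_iso C (onArr Fs (span_f D)) (onArr Fs (span_t D))
      (Ident C (copies (pow_p D))) inf_arr hN hX hY"
    and \<theta>: "nat_iso fl C (func_comp H (leg D FloatV)) copy (\<theta> FloatV)"
      "nat_iso Sp C (func_comp H (leg D SpanV)) Fs (\<theta> SpanV)"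
    and X: "\<theta> SortX x0 = Comp C (\<theta> FloatV (pow_p D)) (onArr H (cell D XFloat x0))"
      "\<theta> SortX x0 = Comp C hX (Comp C (\<theta> SpanV (Cod Sp (span_f D))) (onArr H (cell D XSpan x0)))"
    and Y: "\<theta> SortY x0 = Comp C (\<theta> FloatV (pow_q D)) (onArr H (cell D YFloat x0))"
      "\<theta> SortY x0 = Comp C hY (Comp C (\<theta> SpanV (Cod Sp (span_t D))) (onArr H (cell D YSpan x0)))"
    by (rule ex_inference_functor)
  have "dataset_of R p q D (func_comp M H) \<in> RSpanData R p q \<and>
     lspan_iso (dataset_of R p q D (func_comp M H)) (Rvec R p, \<lambda>x. x, tr (label M))"
    if M: "coherent_functor C set_cat M" for M
  proof -
    interpret model K enc lab val M by (rule model [OF M])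
    obtain \<rho> where \<rho>: "\<And>A. finite A \<Longrightarrow> bij_betw (\<rho> A) (onObj M (copies A)) A"
      "\<And>A B h u. finite A \<Longrightarrow> finite B \<Longrightarrow> h \<in> hom C (copies A) (copies B) \<Longrightarrow> u \<in> onObj M (copies A) \<Longrightarrow>
        enc (label M) (\<rho> B (sfun (onArr M h) u)) = sfun h (enc (label M) (\<rho> A u))"
      by (rule ex_reading) (rule that)
    interpret rspan_model R add mul K enc lab val D p q tr M H \<theta> \<rho>
      by unfold_locales (use H \<theta> \<rho> in auto)
    obtain N f t \<phi> where d: "dataset_of R p q D (func_comp M H) = (N, f, t)"
      and \<phi>: "bij_betw \<phi> N (Rvec R p)" and ft: "\<forall>x\<in>N. f x = \<phi> x \<and> t x = tr (label M) (\<phi> x)"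
      using dataset [OF Fs iso \<theta>(2) X Y] by blast
    have m: "\<phi> x \<in> Rvec R p" if "x \<in> N" for x using \<phi> that by (rule bij_betwE [THEN bspec])
    have "finite N" using bij_betw_finite [OF \<phi>] finite_Rvec [OF Fl.finite_R] by blast
    moreover have "f ` N \<subseteq> Rvec R p" "t ` N \<subseteq> Rvec R q"
      using ft m tr [OF label(1) [OF M]] by auto
    ultimately have "(N, f, t) \<in> RSpanData R p q" by (simp add: RSpanData_def)
    moreover have "lspan_iso (N, f, t) (Rvec R p, \<lambda>x. x, tr (label M))"
      unfolding lspan_iso.simps using \<phi> ft by blast
    ultimately show ?thesis unfolding d by blast
  qed
  with H show ?thesis by blast
qed

section \<open>Networks\<close>

text \<open>\<open>pair_code\<close> is a choice among injections, so one must exist: an infinite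
  set is equinumerous with its square.\<close>

lemma inj_pair_code:
  assumes "infinite (UNIV :: 's set)"
  shows "inj (pair_code :: 's \<times> 's \<Rightarrow> 's)"
proof -
  obtain f :: "'s \<times> 's \<Rightarrow> 's" where "bij_betw f (UNIV \<times> UNIV) UNIV"
    using card_of_Times_same_infinite [OF assms, folded card_of_ordIso] by blast
  then have "inj f" by (simp add: bij_betw_def)
  then show ?thesis unfolding pair_code_def by (rule someI [where P = inj])
qed

text \<open>The finite set \<open>K\<close> embeds in the infinite type \<open>'s\<close> by
  cardinality. After this embedding a labelled element is a pair in \<open>'s \<times> 's\<close>,
  which \<open>pair_code\<close> turns into an element of \<open>'s\<close>.\<close>

lemma ex_coding:
  fixes K :: "'k set"
  assumes inf: "infinite (UNIV :: 's set)" and K: "finite K"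
  shows "\<exists>enc lab (val :: 's \<Rightarrow> 's). coding K enc lab val"
proof -
  obtain B :: "'s set" where B: "finite B" "card B = card K"
    using infinite_arbitrarily_large [OF inf, of "card K"] by blast
  obtain e where "bij_betw e K B" using finite_same_card_bij [OF K B(1)] B(2) by auto
  then have e: "inj_on e K" by (simp add: bij_betw_def)
  let ?c = "pair_code :: 's \<times> 's \<Rightarrow> 's"
  have "coding K (\<lambda>k x. ?c (e k, x)) (\<lambda>u. inv_into K e (fst (inv ?c u))) (\<lambda>u. snd (inv ?c u))"
    using inf K e inj_pair_code [OF inf] by unfold_locales simp_all
  then show ?thesis by blast
qed

lemma finite_NN:
  assumes "finite R"
  shows "finite (NN R \<sigma> a)"
proof -
  let ?n = "length \<sigma>"
  let ?W = "\<Union>i<?n. Rmat R (a ! Suc i) (a ! i)" and ?B = "\<Union>i<?n. Rvec R (a ! Suc i)"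
  have "finite (Rmat R k l)" for k l
    using finite_lists_length_eq [OF finite_Rvec [OF assms, of l], of k] by (simp add: Rmat_def conj_commute)
  then have "finite ({w. set w \<subseteq> ?W \<and> length w = ?n} \<times> {b. set b \<subseteq> ?B \<and> length b = ?n})"
    using finite_Rvec [OF assms] by (intro finite_cartesian_product finite_lists_length_eq) auto
  moreover have "NN R \<sigma> a \<subseteq> {w. set w \<subseteq> ?W \<and> length w = ?n} \<times> {b. set b \<subseteq> ?B \<and> length b = ?n}"
  proof (clarsimp simp: NN_def subset_iff)
    fix w b assume n: "length w = ?n" "length b = ?n"
      and wb: "\<forall>i<?n. w ! i \<in> Rmat R (a ! Suc i) (a ! i) \<and> b ! i \<in> Rvec R (a ! Suc i)"
    have "\<exists>i\<in>{..<?n}. v \<in> Rmat R (a ! Suc i) (a ! i)" if "v \<in> set w" for v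
      using that wb n(1) unfolding in_set_conv_nth by auto
    moreover have "\<exists>i\<in>{..<?n}. v \<in> Rvec R (a ! Suc i)" if "v \<in> set b" for v
      using that wb n(2) unfolding in_set_conv_nth by auto
    ultimately show "(\<forall>v. v \<in> set w \<longrightarrow> (\<exists>i\<in>{..<?n}. v \<in> Rmat R (a ! Suc i) (a ! i))) \<and>
        (\<forall>v. v \<in> set b \<longrightarrow> (\<exists>i\<in>{..<?n}. v \<in> Rvec R (a ! Suc i)))" by blast
  qed
  ultimately show ?thesis by (rule finite_subset [rotated])
qed

lemma add_iter_closed:
  assumes "\<And>x y. x \<in> R \<Longrightarrow> y \<in> R \<Longrightarrow> add x y \<in> R" "xs \<noteq> []" "set xs \<subseteq> R"
  shows "add_iter add xs \<in> R"
  using assms(2,3)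
proof (induction xs)
  case (Cons x xs)
  then show ?case using assms(1) by (cases xs) auto
qed simp

lemma forward_Rvec:
  assumes closed: "\<And>x y. x \<in> R \<Longrightarrow> y \<in> R \<Longrightarrow> add x y \<in> R \<and> mul x y \<in> R"
    and \<sigma>: "\<forall>s\<in>set \<sigma>. s \<in> R \<rightarrow> R" and a: "\<forall>i<length \<sigma>. 1 \<le> a ! i"
    and net: "(w, b) \<in> NN R \<sigma> a" and x: "x \<in> Rvec R (a ! 0)"
  shows "i \<le> length \<sigma> \<Longrightarrow> forward add mul \<sigma> (w, b) i x \<in> Rvec R (a ! i)"
proof (induction i)
  case 0
  then show ?case using x by simp
next
  case (Suc i)
  let ?y = "forward add mul \<sigma> (w, b) i x"
  have i: "i < length \<sigma>" using Suc.prems by simp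
  have y: "length ?y = a ! i" "set ?y \<subseteq> R" using Suc by (auto simp: Rvec_def)
  have W: "length (w ! i) = a ! Suc i" "\<And>row. row \<in> set (w ! i) \<Longrightarrow> length row = a ! i \<and> set row \<subseteq> R"
    and B: "length (b ! i) = a ! Suc i" "set (b ! i) \<subseteq> R"
    using net i by (auto simp: NN_def Rmat_def Rvec_def)
  have s: "(\<sigma> ! i) z \<in> R" if "z \<in> R" for z using \<sigma> i that by (auto simp: Pi_iff)
  have "(\<sigma> ! i) (add (add_iter add (map2 mul row ?y)) c) \<in> R"
    if "row \<in> set (w ! i)" "c \<in> set (b ! i)" for row c
  proof -
    have row: "length row = a ! i" "set row \<subseteq> R" using W(2) [OF that(1)] by auto
    have "mul u v \<in> R" if "(u, v) \<in> set (zip row ?y)" for u v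
      using closed set_zip_leftD [OF that] set_zip_rightD [OF that] row y by auto
    then have "set (map2 mul row ?y) \<subseteq> R" by auto
    \<comment> \<open>The iterated sum is unspecified on the empty list, so every layer that is
      summed over must have positive width; this is the use of \<open>1 \<le> a ! i\<close> for
      \<open>i < length \<sigma>\<close>. The width of the last layer may be zero.\<close>
    moreover have "0 < length (zip row ?y)" using row(1) y(1) a i by (simp add: Suc_le_eq)
    then have "map2 mul row ?y \<noteq> []" by auto
    ultimately have "add_iter add (map2 mul row ?y) \<in> R"
      using add_iter_closed [of R add] closed by blast
    then show ?thesis using s closed B(2) that(2) by blast
  qed
  then have "set (layer add mul (\<sigma> ! i) (w ! i) (b ! i) ?y) \<subseteq> R"
    by (auto simp: layer_def dest: set_zip_leftD set_zip_rightD)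
  then show ?case using W(1) B(1) by (simp add: Rvec_def layer_def)
qed

theorem theorem4p13:
  fixes R :: "'s set" and add mul :: "'s \<Rightarrow> 's \<Rightarrow> 's"
    and \<sigma> :: "('s \<Rightarrow> 's) list" and a :: "nat list" and n :: nat
    and D :: "'s rspan"
  assumes "infinite (UNIV :: 's set)"
    and "finite R"
    and "\<forall>x\<in>R. \<forall>y\<in>R. add x y \<in> R \<and> mul x y \<in> R"
    and "length \<sigma> = n" and "\<forall>s\<in>set \<sigma>. s \<in> R \<rightarrow> R"
    and "length a = n + 1" and "\<forall>i<n. 1 \<le> a ! i"
    and "is_RSpan R add mul (a ! 0) (a ! n) D"
  shows "\<exists>(G :: 's scat) \<iota> (net :: 's sfunc \<Rightarrow> 's network).
    coherent_category G \<and> coherent_functor (rspan_cat D) G \<iota> \<and>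
    (\<forall>M. coherent_functor G set_cat M \<longrightarrow> net M \<in> NN R \<sigma> a) \<and>
    (\<forall>x\<in>NN R \<sigma> a. \<exists>M. coherent_functor G set_cat M \<and> net M = x) \<and>
    (\<forall>M M'. coherent_functor G set_cat M \<and> coherent_functor G set_cat M' \<longrightarrow>
       (net M = net M' \<longleftrightarrow> (\<exists>\<eta>. nat_iso G set_cat M M' \<eta>))) \<and>
    (\<forall>M. coherent_functor G set_cat M \<longrightarrow>
       dataset_of R (a ! 0) (a ! n) D (func_comp M \<iota>) \<in> RSpanData R (a ! 0) (a ! n) \<and>
       lspan_iso (dataset_of R (a ! 0) (a ! n) D (func_comp M \<iota>)) (Inf_NN R add mul \<sigma> a (net M)))"
proof -
  let ?K = "NN R \<sigma> a"
  obtain enc lab val where "coding ?K enc lab (val :: 's \<Rightarrow> 's)"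
    using ex_coding [OF assms(1) finite_NN [OF assms(2)]] by blast
  then interpret coding ?K enc lab val .
  \<comment> \<open>Coherence of Float is read off from the 2-colimit, whose definition asks for
    coherent vertices.\<close>
  have "is_2colimit UNIV UNIV redge_src redge_tgt (rspan_vertex (float_cat R add mul) D) (glue D)
      (rspan_cat D) (leg D) (cell D)"
    using assms(8) by (simp add: is_RSpan_def)
  then have "\<forall>i\<in>UNIV. coherent_category (rspan_vertex (float_cat R add mul) D i)"
    unfolding is_2colimit_def by blast
  then have float: "coherent_category (rspan_vertex (float_cat R add mul) D FloatV)" by blast
  have fwd: "forward add mul \<sigma> net n x \<in> Rvec R (a ! n)" if "net \<in> ?K" "x \<in> Rvec R (a ! 0)" for net x
    using forward_Rvec [of R add mul \<sigma> a "fst net" "snd net" x n] assms that by simp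
  interpret rspan_setting R add mul ?K enc lab val D "a ! 0" "a ! n" "\<lambda>net. forward add mul \<sigma> net n"
    by unfold_locales (use assms float fwd in auto)
  obtain \<iota> where \<iota>: "coherent_functor (rspan_cat D) C \<iota>" and
    data: "\<And>M. coherent_functor C set_cat M \<Longrightarrow>
      dataset_of R (a ! 0) (a ! n) D (func_comp M \<iota>) \<in> RSpanData R (a ! 0) (a ! n) \<and>
      lspan_iso (dataset_of R (a ! 0) (a ! n) D (func_comp M \<iota>))
        (Rvec R (a ! 0), \<lambda>x. x, forward add mul \<sigma> (label M) n)"
    using ex_inference by blast
  have inf: "Inf_NN R add mul \<sigma> a net = (Rvec R (a ! 0), \<lambda>x. x, forward add mul \<sigma> net n)" for net
    using assms(4) by (simp add: Inf_NN_def)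
  show ?thesis
  proof (intro exI conjI allI ballI impI)
    show "coherent_category C" by (rule coherent_finite)
    show "coherent_functor (rspan_cat D) C \<iota>" by (fact \<iota>)
    show "label M \<in> ?K" if "coherent_functor C set_cat M" for M using label(1) [OF that] .
    \<comment> \<open>Every network occurs: the fibre functor at \<open>x\<close> is a model with
      label \<open>x\<close>.\<close>
    show "coherent_functor C set_cat (ev x)" "label (ev x) = x" if "x \<in> ?K" for x
      using ev_coherent [OF that] label_ev [OF that] .
    show "label M = label M' \<longleftrightarrow> (\<exists>\<eta>. nat_iso C set_cat M M' \<eta>)"
      if "coherent_functor C set_cat M \<and> coherent_functor C set_cat M'" for M M'
      using nat_iso_iff_label that by blast
    show "dataset_of R (a ! 0) (a ! n) D (func_comp M \<iota>) \<in> RSpanData R (a ! 0) (a ! n)"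
      "lspan_iso (dataset_of R (a ! 0) (a ! n) D (func_comp M \<iota>)) (Inf_NN R add mul \<sigma> a (label M))"
      if "coherent_functor C set_cat M" for M
      using data [OF that] unfolding inf by blast+
  qed
qed

end
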